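(* Let $G=(A\cup B,E)$ be a bipartite graph with $|A|=|B|=n$ and $|E|=m$, where every agent $a\in A$ has a strict partial order $\succ_a$ over her neighbors in $B$. The popular assignment problem in $G$ (decide whether $G$ admits a popular assignment and, if so, find one) can be solved in $O(m\cdot n^{5/2})$ time.
   Context: Nodes of $A$ are agents, nodes of $B$ are objects (objects have no preferences). Each $\succ_a$ is irreflexive and transitive; $a$ is indifferent between $b,b'$ if neither $b\succ_a b'$ nor $b'\succ_a b$. For matchings $M,N$, an agent $a$ prefers $M$ to $N$ if $a$ is matched in $M$ and either $a$ is unmatched in $N$ or $M(a)\succ_a N(a)$. Let $\phi(M,N)$ be the number of agents preferring $M$ to $N$ and $\Delta(M,N)=\phi(M,N)-\phi(N,M)$. An assignment is a perfect matching of $G$. A perfect matching $M$ is a popular assignment if $\Delta(M,N)\ge 0$ for every perfect matching $N$ of $G$. *)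

theory Defs
  imports Complex_Main
begin

section \<open>Popular assignments\<close>

definition nbrs :: "('a \<times> 'b) set \<Rightarrow> 'a \<Rightarrow> 'b set" where
  "nbrs E a = {b. (a, b) \<in> E}"

text \<open>The value of \<open>pref a b b'\<close> (read: agent \<open>a\<close> strictly prefers \<open>b\<close> to \<open>b'\<close>) is unconstrained,
  and irrelevant, unless both \<open>b\<close> and \<open>b'\<close> are neighbours of \<open>a\<close>.\<close>

definition assignment_instance ::
  "'a set \<Rightarrow> 'b set \<Rightarrow> ('a \<times> 'b) set \<Rightarrow> ('a \<Rightarrow> 'b \<Rightarrow> 'b \<Rightarrow> bool) \<Rightarrow> bool" where
  "assignment_instance A B E pref \<longleftrightarrow>
     finite A \<and> finite B \<and> card A = card B \<and> E \<subseteq> A \<times> B \<and>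
     (\<forall>a\<in>A. irreflp_on (nbrs E a) (pref a) \<and> transp_on (nbrs E a) (pref a))"

definition matching :: "('a \<times> 'b) set \<Rightarrow> ('a \<times> 'b) set \<Rightarrow> bool" where
  "matching E M \<longleftrightarrow> M \<subseteq> E \<and> (\<forall>(a, b)\<in>M. \<forall>(a', b')\<in>M. a = a' \<longleftrightarrow> b = b')"

definition perfect_matching ::
  "'a set \<Rightarrow> 'b set \<Rightarrow> ('a \<times> 'b) set \<Rightarrow> ('a \<times> 'b) set \<Rightarrow> bool" where
  "perfect_matching A B E M \<longleftrightarrow> matching E M \<and> Domain M = A \<and> Range M = B"

definition partner :: "('a \<times> 'b) set \<Rightarrow> 'a \<Rightarrow> 'b" where
  "partner M a = (THE b. (a, b) \<in> M)"

definition prefers ::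
  "('a \<Rightarrow> 'b \<Rightarrow> 'b \<Rightarrow> bool) \<Rightarrow> 'a \<Rightarrow> ('a \<times> 'b) set \<Rightarrow> ('a \<times> 'b) set \<Rightarrow> bool" where
  "prefers pref a M N \<longleftrightarrow>
     a \<in> Domain M \<and> (a \<notin> Domain N \<or> pref a (partner M a) (partner N a))"

definition votes ::
  "'a set \<Rightarrow> ('a \<Rightarrow> 'b \<Rightarrow> 'b \<Rightarrow> bool) \<Rightarrow> ('a \<times> 'b) set \<Rightarrow> ('a \<times> 'b) set \<Rightarrow> nat" where
  "votes A pref M N = card {a \<in> A. prefers pref a M N}"

definition vote_margin ::
  "'a set \<Rightarrow> ('a \<Rightarrow> 'b \<Rightarrow> 'b \<Rightarrow> bool) \<Rightarrow> ('a \<times> 'b) set \<Rightarrow> ('a \<times> 'b) set \<Rightarrow> int" where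
  "vote_margin A pref M N = int (votes A pref M N) - int (votes A pref N M)"

definition popular_assignment ::
  "'a set \<Rightarrow> 'b set \<Rightarrow> ('a \<times> 'b) set \<Rightarrow> ('a \<Rightarrow> 'b \<Rightarrow> 'b \<Rightarrow> bool) \<Rightarrow> ('a \<times> 'b) set \<Rightarrow> bool" where
  "popular_assignment A B E pref M \<longleftrightarrow>
     perfect_matching A B E M \<and>
     (\<forall>N. perfect_matching A B E N \<longrightarrow> vote_margin A pref M N \<ge> 0)"


section \<open>A word RAM\<close>

text \<open>
  Programs are structured programs for a random-access machine whose words are the natural numbers
  below a bound \<open>W\<close>. A program refers to its registers and arrays by literal numbers, so each
  program uses only finitely many of them. Array indices are computed words. Every
  operation, register access and array access costs one unit, including each evaluation
  of a loop guard. Addition and multiplication wrap around at \<open>W\<close>, hence huge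
  numbers cannot be used to hide work; subtraction is truncated at zero.
\<close>

datatype aexp =
    Num nat
  | Reg nat
  | Cell nat aexp
  | Add aexp aexp
  | Sub aexp aexp
  | Mul aexp aexp
  | Div aexp aexp
  | Mod aexp aexp

datatype bexp =
    Less aexp aexp
  | Equal aexp aexp
  | Neg bexp
  | Conj bexp bexp

datatype com =
    Skip
  | Assign nat aexp
  | Store nat aexp aexp
  | Seq com com
  | Cond bexp com com
  | While bexp com

record state =
  regs :: "nat \<Rightarrow> nat"
  arrs :: "nat \<Rightarrow> nat \<Rightarrow> nat"

fun aval :: "nat \<Rightarrow> aexp \<Rightarrow> state \<Rightarrow> nat" where
  "aval W (Num c) s = c mod W"
| "aval W (Reg x) s = regs s x"
| "aval W (Cell X i) s = arrs s X (aval W i s)"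
| "aval W (Add e f) s = (aval W e s + aval W f s) mod W"
| "aval W (Sub e f) s = aval W e s - aval W f s"
| "aval W (Mul e f) s = (aval W e s * aval W f s) mod W"
| "aval W (Div e f) s = aval W e s div aval W f s"
| "aval W (Mod e f) s = aval W e s mod aval W f s"

fun bval :: "nat \<Rightarrow> bexp \<Rightarrow> state \<Rightarrow> bool" where
  "bval W (Less e f) s \<longleftrightarrow> aval W e s < aval W f s"
| "bval W (Equal e f) s \<longleftrightarrow> aval W e s = aval W f s"
| "bval W (Neg b) s \<longleftrightarrow> \<not> bval W b s"
| "bval W (Conj b c) s \<longleftrightarrow> bval W b s \<and> bval W c s"

fun acost :: "aexp \<Rightarrow> nat" where
  "acost (Num c) = 1"
| "acost (Reg x) = 1"
| "acost (Cell X i) = 1 + acost i"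
| "acost (Add e f) = 1 + acost e + acost f"
| "acost (Sub e f) = 1 + acost e + acost f"
| "acost (Mul e f) = 1 + acost e + acost f"
| "acost (Div e f) = 1 + acost e + acost f"
| "acost (Mod e f) = 1 + acost e + acost f"

fun bcost :: "bexp \<Rightarrow> nat" where
  "bcost (Less e f) = 1 + acost e + acost f"
| "bcost (Equal e f) = 1 + acost e + acost f"
| "bcost (Neg b) = 1 + bcost b"
| "bcost (Conj b c) = 1 + bcost b + bcost c"

text \<open>\<open>exec W c s t s'\<close>: on words below \<open>W\<close>, command \<open>c\<close> started in \<open>s\<close> terminates in \<open>s'\<close>
  after time \<open>t\<close>.\<close>

inductive exec :: "nat \<Rightarrow> com \<Rightarrow> state \<Rightarrow> nat \<Rightarrow> state \<Rightarrow> bool" for W :: nat where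
  Skip: "exec W Skip s 1 s"
| Assign: "exec W (Assign x e) s (1 + acost e) (s\<lparr>regs := (regs s)(x := aval W e s)\<rparr>)"
| Store: "exec W (Store X i e) s (1 + acost i + acost e)
    (s\<lparr>arrs := (arrs s)(X := (arrs s X)(aval W i s := aval W e s))\<rparr>)"
| Seq: "exec W c s t s' \<Longrightarrow> exec W d s' t' s'' \<Longrightarrow> exec W (Seq c d) s (t + t') s''"
| CondTrue: "bval W b s \<Longrightarrow> exec W c s t s' \<Longrightarrow> exec W (Cond b c d) s (1 + bcost b + t) s'"
| CondFalse: "\<not> bval W b s \<Longrightarrow> exec W d s t s' \<Longrightarrow> exec W (Cond b c d) s (1 + bcost b + t) s'"
| WhileFalse: "\<not> bval W b s \<Longrightarrow> exec W (While b c) s (1 + bcost b) s"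
| WhileTrue: "bval W b s \<Longrightarrow> exec W c s t s' \<Longrightarrow> exec W (While b c) s' t' s'' \<Longrightarrow>
    exec W (While b c) s (1 + bcost b + t + t') s''"

inductive_cases SkipE: "exec W Skip s t s'"
inductive_cases AssignE: "exec W (Assign x e) s t s'"
inductive_cases StoreE: "exec W (Store X i e) s t s'"
inductive_cases SeqE: "exec W (Seq c d) s t s'"
inductive_cases CondE: "exec W (Cond b c d) s t s'"
inductive_cases WhileE: "exec W (While b c) s t s'"

lemma exec_deterministic:
  "exec W c s t s' \<Longrightarrow> exec W c s u s'' \<Longrightarrow> u = t \<and> s'' = s'"
proof (induction arbitrary: u s'' rule: exec.induct)
  case (Skip s)
  then show ?case by (rule SkipE) simp
next
  case (Assign x e s)
  then show ?case by (rule AssignE) simp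
next
  case (Store X i e s)
  then show ?case by (rule StoreE) simp
next
  case (Seq c s t s' d t' s1)
  show ?case
  proof (rule SeqE[OF Seq.prems])
    fix t1 s2 t2
    assume *: "u = t1 + t2" "exec W c s t1 s2" "exec W d s2 t2 s''"
    have 1: "t1 = t" "s2 = s'" using Seq.IH(1)[OF *(2)] by (rule conjunct1, rule conjunct2)
    have "t2 = t' \<and> s'' = s1" by (rule Seq.IH(2)[OF *(3)[unfolded 1]])
    then show ?thesis unfolding *(1) 1 by simp
  qed
next
  case (CondTrue b s c t s' d)
  show ?case
  proof (rule CondE[OF CondTrue.prems])
    fix t1 assume *: "u = Suc (bcost b + t1)" "bval W b s" "exec W c s t1 s''"
    have "t1 = t \<and> s'' = s'" by (rule CondTrue.IH[OF *(3)])
    then show ?thesis unfolding *(1) by simp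
  qed (use CondTrue.hyps(1) in blast)
next
  case (CondFalse b s d t s' c)
  show ?case
  proof (rule CondE[OF CondFalse.prems])
    fix t1 assume *: "u = Suc (bcost b + t1)" "\<not> bval W b s" "exec W d s t1 s''"
    have "t1 = t \<and> s'' = s'" by (rule CondFalse.IH[OF *(3)])
    then show ?thesis unfolding *(1) by simp
  qed (use CondFalse.hyps(1) in blast)
next
  case (WhileFalse b s c)
  show ?case
    by (rule WhileE[OF WhileFalse.prems]) (simp_all add: WhileFalse.hyps)
next
  case (WhileTrue b s c t s' t' s1)
  show ?case
  proof (rule WhileE[OF WhileTrue.prems])
    fix t1 s2 t2
    assume *: "u = Suc (bcost b + t1 + t2)" "bval W b s" "exec W c s t1 s2" "exec W (While b c) s2 t2 s''"
    have 1: "t1 = t" "s2 = s'" using WhileTrue.IH(1)[OF *(3)] by (rule conjunct1, rule conjunct2)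
    have "t2 = t' \<and> s'' = s1" by (rule WhileTrue.IH(2)[OF *(4)[unfolded 1]])
    then show ?thesis unfolding *(1) 1 by simp
  qed (use WhileTrue.hyps(1) in blast)
qed


section \<open>Input and output\<close>

text \<open>
  Agents and objects are both numbered \<open>0, \<dots>, n - 1\<close>. The machine receives \<open>n\<close> and \<open>m\<close> in
  registers 0 and 1, the edges as a list in arbitrary order in arrays 0 (agents) and 1 (objects),
  and the preferences as a comparison table in array 2: the entry at index \<open>(a * n + b) * n + b'\<close>
  is 1 if \<open>a\<close> strictly prefers \<open>b\<close> to \<open>b'\<close>, and 0 otherwise. All other memory is 0.
\<close>

definition input_state ::
  "nat \<Rightarrow> (nat \<times> nat) list \<Rightarrow> (nat \<Rightarrow> nat \<Rightarrow> nat \<Rightarrow> bool) \<Rightarrow> state" where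
  "input_state n es pref =
     \<lparr>regs = (\<lambda>_. 0)(0 := n, 1 := length es),
      arrs = (\<lambda>_ _. 0)
        (0 := \<lambda>i. if i < length es then fst (es ! i) else 0,
         1 := \<lambda>i. if i < length es then snd (es ! i) else 0,
         2 := \<lambda>i. if i < n ^ 3
                  then of_bool (pref (i div n ^ 2) (i div n mod n) (i mod n)) else 0)\<rparr>"

text \<open>The answer is returned in register 0 (1 for yes, 0 for no); in the former case array 3
  holds the object assigned to each agent.\<close>

definition output_assignment :: "nat \<Rightarrow> state \<Rightarrow> (nat \<times> nat) set" where
  "output_assignment n s = {(a, arrs s 3 a) | a. a < n}"

definition correct_output ::
  "nat \<Rightarrow> (nat \<times> nat) set \<Rightarrow> (nat \<Rightarrow> nat \<Rightarrow> nat \<Rightarrow> bool) \<Rightarrow> state \<Rightarrow> bool" where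
  "correct_output n E pref s \<longleftrightarrow>
     (if \<exists>M. popular_assignment {..<n} {..<n} E pref M
      then regs s 0 = 1 \<and> popular_assignment {..<n} {..<n} E pref (output_assignment n s)
      else regs s 0 = 0)"

text \<open>A program \<open>p\<close> solves the popular assignment problem within time \<open>T n m\<close>, on words of
  \<open>O(log n)\<close> bits. The bound \<open>k \<ge> 3\<close> makes all inputs and input addresses fit into one word.\<close>

definition solves_popular_assignment :: "com \<Rightarrow> nat \<Rightarrow> (nat \<Rightarrow> nat \<Rightarrow> real) \<Rightarrow> bool" where
  "solves_popular_assignment p k T \<longleftrightarrow>
     k \<ge> 3 \<and>
     (\<forall>n E pref es.
        assignment_instance {..<n} {..<n} E pref \<and> distinct es \<and> set es = E \<longrightarrow>
        (\<exists>t s. exec ((n + 2) ^ k) p (input_state n es pref) t s \<and>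
               real t \<le> T n (card E) \<and> correct_output n E pref s))"

end

theory Submission imports Defs begin

text \<open>
  Levels \<open>l\<close> on the objects single out the edges \<open>(a, b)\<close> such that no neighbour \<open>b'\<close> of \<open>a\<close> satisfies
  \<open>l b' + [b' \<succ>\<^sub>a b] > l b + [b \<succ>\<^sub>a b']\<close>. These inequalities are dual feasibility, so a perfect matching
  of level edges is popular; conversely the longest-path potentials of the switching graph of a popular
  assignment are levels \<open>y < n\<close> for which it consists of level edges. The algorithm starts from
  \<open>l = 0\<close> and keeps \<open>l \<le> y\<close> for all such \<open>y\<close>: if no augmenting path in the level edges exists, any
  unmatched object can be raised by one. There are at most \<open>n\<^sup>2\<close> raises, each changing the level edges
  in time \<open>O(m)\<close>. After each of them a matching is computed from scratch by an auction with prices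
  capped at about \<open>\<surd>n\<close>, in time \<open>O(m \<surd>n)\<close>; it misses the maximum by at most about \<open>\<surd>n\<close>, so \<open>O(\<surd>n)\<close>
  searches of time \<open>O(m)\<close> finish the matching.
\<close>

section \<open>Levels certify popularity\<close>

text \<open>Finding the worst challenger of \<open>M\<close> is an assignment problem whose weights
  are votes; levels are the dual prices of the objects, with the prices of the agents eliminated.
  Votes lie in {-1, 0, 1}, so a longest simple path weighs less than \<open>n\<close>: certificates
  with integral levels below \<open>n\<close> suffice, and a level forced up to \<open>n\<close>
  refutes popularity. The obstacle is that one raise can delete level edges at many agents, so what
  survives of the old matching may be far from maximum. Restarting gives up all amortization: n * n
  raises at O(m * sqrt n) each are exactly the claimed bound. A cap near sqrt n balances the auction
  cost \<open>cap * m\<close> against the n / \<open>cap\<close> searches that repair the deficit.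
  An auction with one monotone counter per agent is a single flat loop with an evident measure. A
  failed search does more than prove maximality: the objects it did not reach show that every free
  object lies strictly below all certificates, so an arbitrary free object may be raised. Inputs
  with m < n are rejected before anything of order n is paid.\<close>

definition level_edges ::
  "('a \<times> 'b) set \<Rightarrow> ('a \<Rightarrow> 'b \<Rightarrow> 'b \<Rightarrow> bool) \<Rightarrow> ('b \<Rightarrow> nat) \<Rightarrow> ('a \<times> 'b) set" where
  "level_edges E pref l = {(a, b) \<in> E. \<forall>b'\<in>nbrs E a.
     l b' + of_bool (pref a b' b) \<le> l b + of_bool (pref a b b')}"

section \<open>Matchings, vote margins and weak duality\<close>

lemma matching_right_unique: "matching E M \<Longrightarrow> (a, b) \<in> M \<Longrightarrow> (a, b') \<in> M \<Longrightarrow> b = b'"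
  unfolding matching_def by blast

lemma matching_left_unique: "matching E M \<Longrightarrow> (a, b) \<in> M \<Longrightarrow> (a', b) \<in> M \<Longrightarrow> a = a'"
  unfolding matching_def by blast

lemma partner_eq: "matching E M \<Longrightarrow> (a, b) \<in> M \<Longrightarrow> partner M a = b"
  unfolding partner_def using matching_right_unique by (metis the_equality)

lemma perfect_matching_partner:
  assumes "perfect_matching A B E M"
  shows "bij_betw (partner M) A B" "\<And>a. a \<in> A \<Longrightarrow> (a, partner M a) \<in> M"
proof -
  have M: "matching E M" "Domain M = A" "Range M = B"
    using assms by (auto simp: perfect_matching_def)
  show mem: "(a, partner M a) \<in> M" if a: "a \<in> A" for a
  proof -
    obtain b where "(a, b) \<in> M" using M(2) a by blast
    then show ?thesis using partner_eq[OF M(1)] by simp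
  qed
  have "inj_on (partner M) A"
    by (rule inj_onI) (metis mem matching_left_unique[OF M(1)])
  moreover have "partner M ` A = B"
  proof (intro subset_antisym subsetI)
    fix b assume "b \<in> partner M ` A"
    then show "b \<in> B" using mem M(3) by blast
  next
    fix b assume "b \<in> B"
    then obtain a where "(a, b) \<in> M" using M(3) by blast
    moreover from this have "a \<in> A" using M(2) by blast
    ultimately show "b \<in> partner M ` A" using partner_eq[OF M(1)] by force
  qed
  ultimately show "bij_betw (partner M) A B" by (simp add: bij_betw_def)
qed

lemma bij_betw_perfect_matching:
  assumes "bij_betw f A B" "\<And>a. a \<in> A \<Longrightarrow> (a, f a) \<in> E"
  defines "M \<equiv> {(a, f a) | a. a \<in> A}"
  shows "perfect_matching A B E M" "\<And>a. a \<in> A \<Longrightarrow> partner M a = f a"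
proof -
  have m: "matching E M"
    using assms unfolding matching_def bij_betw_def inj_on_def by auto
  moreover have "Domain M = A" "Range M = B"
    using assms unfolding bij_betw_def by (auto simp: Domain_iff Range_iff)
  ultimately show "perfect_matching A B E M" by (simp add: perfect_matching_def)
  show "partner M a = f a" if "a \<in> A" for a
    using partner_eq[OF m] that by (auto simp: M_def)
qed

lemma vote_margin_sum:
  assumes "finite A" "Domain M = A" "Domain N = A"
  shows "vote_margin A pref M N = (\<Sum>a\<in>A. of_bool (pref a (partner M a) (partner N a))
           - of_bool (pref a (partner N a) (partner M a)))"
proof -
  have votes: "int (votes A pref M' N') = (\<Sum>a\<in>A. of_bool (pref a (partner M' a) (partner N' a)))"
    if "Domain M' = A" "Domain N' = A" for M' N'
  proof -
    have "{a \<in> A. prefers pref a M' N'} = A \<inter> {a. pref a (partner M' a) (partner N' a)}"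
      using that by (auto simp: prefers_def)
    then show ?thesis
      using \<open>finite A\<close> by (simp add: votes_def of_bool_def sum.If_cases)
  qed
  show ?thesis
    using assms by (simp add: vote_margin_def votes sum_subtractf)
qed

text \<open>For each agent, the level gained by moving from \<open>M\<close> to \<open>N\<close> is
  at most her vote for \<open>M\<close> over \<open>N\<close>. Both partner maps are bijections onto
  \<open>B\<close>, so the gains sum to zero and the margin is nonnegative.\<close>

lemma popular_if_level_edges:
  assumes "finite A" "perfect_matching A B E M" "M \<subseteq> level_edges E pref l"
  shows "popular_assignment A B E pref M"
  unfolding popular_assignment_def
proof (intro conjI allI impI)
  fix N assume N: "perfect_matching A B E N"
  have D: "Domain M = A" "Domain N = A" using assms(2) N by (auto simp: perfect_matching_def)
  have 1: "int (l (partner N a)) - int (l (partner M a)) \<le>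
      of_bool (pref a (partner M a) (partner N a)) - of_bool (pref a (partner N a) (partner M a))"
    if "a \<in> A" for a
  proof -
    have "(a, partner M a) \<in> level_edges E pref l"
      using perfect_matching_partner(2)[OF assms(2) that] assms(3) by blast
    moreover have "partner N a \<in> nbrs E a"
      using perfect_matching_partner(2)[OF N that] N
      by (auto simp: nbrs_def perfect_matching_def matching_def)
    ultimately have "l (partner N a) + of_bool (pref a (partner N a) (partner M a))
        \<le> l (partner M a) + of_bool (pref a (partner M a) (partner N a))"
      by (auto simp: level_edges_def)
    then have "int (l (partner N a) + of_bool (pref a (partner N a) (partner M a)))
        \<le> int (l (partner M a) + of_bool (pref a (partner M a) (partner N a)))"
      by (rule of_nat_mono)
    then show ?thesis by simp
  qed
  have "(\<Sum>a\<in>A. int (l (partner N a))) = (\<Sum>b\<in>B. int (l b))"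
    by (rule sum.reindex_bij_betw[OF perfect_matching_partner(1)[OF N]])
  moreover have "(\<Sum>a\<in>A. int (l (partner M a))) = (\<Sum>b\<in>B. int (l b))"
    by (rule sum.reindex_bij_betw[OF perfect_matching_partner(1)[OF assms(2)]])
  ultimately have "0 = (\<Sum>a\<in>A. int (l (partner N a)) - int (l (partner M a)))"
    by (simp add: sum_subtractf)
  also have "\<dots> \<le> vote_margin A pref M N"
    unfolding vote_margin_sum[OF assms(1) D] by (rule sum_mono) (rule 1)
  finally show "vote_margin A pref M N \<ge> 0" .
qed (rule assms(2))

section \<open>Longest-path potentials: popular assignments have levels\<close>

definition walk_weight :: "('v \<Rightarrow> 'v \<Rightarrow> int) \<Rightarrow> 'v list \<Rightarrow> int" where
  "walk_weight w xs = sum_list (map2 w xs (tl xs))"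

lemma walk_weight_simps [simp]:
  "walk_weight w [] = 0" "walk_weight w [x] = 0"
  "walk_weight w (x # y # xs) = w x y + walk_weight w (y # xs)"
  by (simp_all add: walk_weight_def)

lemma walk_weight_append:
  "walk_weight w (xs @ x # ys) = walk_weight w (xs @ [x]) + walk_weight w (x # ys)"
proof (induction xs)
  case (Cons z zs)
  then show ?case by (cases zs) simp_all
qed simp

lemma walk_weight_le:
  assumes "\<And>x y. w x y \<le> 1"
  shows "walk_weight w xs \<le> int (length xs - 1)"
proof (induction xs rule: induct_list012)
  case (3 x y zs)
  then show ?case using assms[of x y] by simp
qed simp_all

text \<open>The potential of u is the largest weight of a simple path starting at u. The one-vertex
  path makes it nonnegative; a simple path has at most \<open>card V - 1\<close> arcs of weight at
  most 1. The cycle condition is needed only where prepending u to a best path from v would repeat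
  u.\<close>

lemma potential_exists:
  fixes w :: "'v \<Rightarrow> 'v \<Rightarrow> int"
  assumes "finite V" and w: "\<And>x y. w x y \<le> 1"
    and cycle: "\<And>xs. xs \<noteq> [] \<Longrightarrow> distinct xs \<Longrightarrow> set xs \<subseteq> V \<Longrightarrow> successively R (xs @ [hd xs])
      \<Longrightarrow> walk_weight w (xs @ [hd xs]) \<le> 0"
  shows "\<exists>y :: 'v \<Rightarrow> nat. (\<forall>v\<in>V. y v < card V) \<and>
    (\<forall>u\<in>V. \<forall>v\<in>V. R u v \<longrightarrow> int (y v) + w u v \<le> int (y u))"
proof -
  define P where "P u = {xs. xs \<noteq> [] \<and> hd xs = u \<and> distinct xs \<and> set xs \<subseteq> V \<and> successively R xs}" for u
  define Y where "Y u = Max (walk_weight w ` P u)" for u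
  have fin: "finite (P u)" for u
    by (rule finite_subset[OF _ finite_subset_distinct[OF \<open>finite V\<close>]]) (auto simp: P_def)
  have single: "[u] \<in> P u" if "u \<in> V" for u
    using that by (simp add: P_def)
  have Y_ge: "walk_weight w xs \<le> Y u" if "xs \<in> P u" for xs u
    unfolding Y_def using fin that by (intro Max_ge) auto
  have Y_in: "\<exists>xs\<in>P u. Y u = walk_weight w xs" if "u \<in> V" for u
  proof -
    have "Y u \<in> walk_weight w ` P u"
      unfolding Y_def using fin single[OF that] by (intro Max_in) auto
    then show ?thesis by blast
  qed
  have nonneg: "0 \<le> Y u" if "u \<in> V" for u
    using Y_ge[OF single[OF that]] by simp
  have less: "Y u < int (card V)" if u: "u \<in> V" for u
  proof -
    obtain xs where xs: "xs \<in> P u" "Y u = walk_weight w xs" using Y_in[OF u] by blast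
    have "length xs \<le> card V"
      using xs(1) card_mono[OF \<open>finite V\<close>, of "set xs"] by (auto simp: P_def distinct_card)
    moreover have "0 < length xs" using xs(1) by (auto simp: P_def)
    ultimately show ?thesis using walk_weight_le[of w xs, OF w] xs(2) by linarith
  qed
  have step: "Y v + w u v \<le> Y u" if uv: "u \<in> V" "v \<in> V" "R u v" for u v
  proof -
    obtain xs where xs: "xs \<in> P v" "Y v = walk_weight w xs" using Y_in[OF uv(2)] by blast
    obtain zs where zs: "xs = v # zs" using xs(1) by (cases xs) (auto simp: P_def)
    show ?thesis
    proof (cases "u \<in> set xs")
      case False
      then have "u # xs \<in> P u" using xs(1) uv zs by (auto simp: P_def)
      from Y_ge[OF this] show ?thesis using xs(2) zs by simp
    next
      case True
      \<comment> \<open>Cut the path at u: the prefix and the arc from u to v close a simple cycle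
        of nonpositive weight, and the suffix is itself a path that competes for the potential of
        u.\<close>
      then obtain p q where pq: "xs = p @ u # q" by (meson split_list)
      have suc: "successively R (p @ [u])" "successively R (u # q)"
        using xs(1) unfolding P_def pq by (auto simp: successively_append_iff)
      have "hd (p @ [u]) = v" using zs pq by (cases p) auto
      then obtain r where r: "p @ [u] = v # r" by (cases p) auto
      have "walk_weight w ((u # p) @ [hd (u # p)]) \<le> 0"
      proof (rule cycle)
        show "successively R ((u # p) @ [hd (u # p)])" using suc(1) r uv(3) by simp
      qed (use xs(1) uv in \<open>auto simp: P_def pq\<close>)
      then have "w u v + walk_weight w (p @ [u]) \<le> 0" using r by simp
      moreover have "u # q \<in> P u" using xs(1) suc(2) uv by (auto simp: P_def pq)
      ultimately show ?thesis
        using Y_ge[of "u # q" u] xs(2) walk_weight_append[of w p u q] unfolding pq by linarith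
    qed
  qed
  show ?thesis
  proof (intro exI[of _ "\<lambda>u. nat (Y u)"] conjI ballI impI)
    fix u assume u: "u \<in> V"
    show "nat (Y u) < card V" using nonneg[OF u] less[OF u] by linarith
    fix v assume v: "v \<in> V" "R u v"
    show "int (nat (Y v)) + w u v \<le> int (nat (Y u))"
      using nonneg[OF u] nonneg[OF v(1)] step[OF u v] by simp
  qed
qed

text \<open>Turns a closed walk into the permutation that sends each listed element to its successor
  and fixes the others, so that its weight becomes a sum over agents, comparable with a vote
  margin.\<close>

lemma rotation_of_cycle:
  assumes "distinct xs" "set xs \<subseteq> A" "xs \<noteq> []"
  obtains s where "bij_betw s A A" "\<And>x. x \<in> A - set xs \<Longrightarrow> s x = x"
    "\<And>R x. successively R (xs @ [hd xs]) \<Longrightarrow> x \<in> set xs \<Longrightarrow> R x (s x)"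
    "\<And>w. walk_weight w (xs @ [hd xs]) = (\<Sum>x\<in>set xs. w x (s x))"
proof -
  let ?ys = "rotate1 xs"
  define s where "s x = (case map_of (zip xs ?ys) x of Some y \<Rightarrow> y | None \<Rightarrow> x)" for x
  have nth: "s (xs ! i) = ?ys ! i" if "i < length xs" for i
    using that assms(1) by (simp add: s_def map_of_zip_nth)
  have out: "s x = x" if "x \<notin> set xs" for x
    using that by (simp add: s_def map_of_zip_is_None[THEN iffD2])
  have map: "map s xs = ?ys"
    by (rule nth_equalityI) (auto simp: nth)
  have "s ` set xs = set xs"
    using arg_cong[OF map, of set] by simp
  moreover have "inj_on s (set xs)"
    using assms(1) map by (metis distinct1_rotate distinct_map)
  ultimately have "bij_betw s (set xs) (set xs)" by (simp add: bij_betw_def)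
  moreover have "bij_betw s (A - set xs) (A - set xs)"
    using out by (auto simp: bij_betw_def inj_on_def image_def)
  ultimately have "bij_betw s (set xs \<union> (A - set xs)) (set xs \<union> (A - set xs))"
    by (rule bij_betw_combine) auto
  then have 1: "bij_betw s A A" using assms(2) by (simp add: Un_absorb1)
  have ys: "tl (xs @ [hd xs]) = map s xs" unfolding map using assms(3) by (cases xs) auto
  have "walk_weight w (xs @ [hd xs]) = (\<Sum>x\<in>set xs. w x (s x))" for w
  proof -
    have "zip (xs @ [hd xs]) (map s xs) = zip xs (map s xs)"
      by (simp add: zip_append1)
    also have "\<dots> = map (\<lambda>x. (x, s x)) xs"
      by (simp add: zip_map2 zip_same_conv_map)
    finally show ?thesis
      unfolding walk_weight_def ys using assms(1) by (simp add: sum_list_distinct_conv_sum_set comp_def)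
  qed
  moreover have "R x (s x)" if suc: "successively R (xs @ [hd xs])" and x: "x \<in> set xs" for R x
  proof -
    obtain i where i: "i < length xs" "x = xs ! i" using x by (auto simp: in_set_conv_nth)
    have "R ((xs @ [hd xs]) ! i) ((xs @ [hd xs]) ! Suc i)"
      using suc i by (simp add: successively_conv_nth)
    moreover have "(xs @ [hd xs]) ! Suc i = tl (xs @ [hd xs]) ! i"
      using i by (simp add: nth_tl)
    ultimately show ?thesis
      unfolding ys using i by (simp add: nth_append)
  qed
  ultimately show thesis using that[of s] 1 out by blast
qed

text \<open>In the switching graph an arc from a to a' means that a could take the object of a',
  weighted by her vote for doing so. Rotating along a simple cycle yields another perfect matching,
  so popularity bounds the cycle weights by 0. The resulting potentials of agents are carried over
  to objects along \<open>M\<close>.\<close>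

lemma popular_level_certificate:
  assumes "finite A" "card A = card B" "E \<subseteq> A \<times> B"
    and pop: "popular_assignment A B E pref M"
  shows "\<exists>y. (\<forall>b\<in>B. y b < card B) \<and> M \<subseteq> level_edges E pref y"
proof -
  let ?f = "partner M"
  have M: "perfect_matching A B E M" using pop by (simp add: popular_assignment_def)
  note f = perfect_matching_partner[OF M]
  have ME: "matching E M" "M \<subseteq> E" "Domain M = A" "Range M = B"
    using M by (auto simp: perfect_matching_def matching_def)
  define w :: "'a \<Rightarrow> 'a \<Rightarrow> int" where
    "w a a' = of_bool (pref a (?f a') (?f a)) - of_bool (pref a (?f a) (?f a'))" for a a'
  define R where "R a a' \<longleftrightarrow> (a, ?f a') \<in> E" for a a'
  have "\<exists>y. (\<forall>a\<in>A. y a < card A) \<and> (\<forall>u\<in>A. \<forall>v\<in>A. R u v \<longrightarrow> int (y v) + w u v \<le> int (y u))"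
  proof (rule potential_exists[OF \<open>finite A\<close>])
    show "w x y \<le> 1" for x y by (simp add: w_def)
    fix xs assume xs: "xs \<noteq> []" "distinct xs" "set xs \<subseteq> A" "successively R (xs @ [hd xs])"
    from rotation_of_cycle[OF xs(2,3,1)] obtain s where s: "bij_betw s A A"
      "\<And>x. x \<in> A - set xs \<Longrightarrow> s x = x" "\<And>x. x \<in> set xs \<Longrightarrow> R x (s x)"
      "walk_weight w (xs @ [hd xs]) = (\<Sum>x\<in>set xs. w x (s x))"
      using xs(4) by metis
    have bij: "bij_betw (?f \<circ> s) A B" using s(1) f(1) by (rule bij_betw_trans)
    have E: "(a, (?f \<circ> s) a) \<in> E" if "a \<in> A" for a
      using s(2,3)[of a] that f(2)[OF that] ME(2) by (cases "a \<in> set xs") (auto simp: R_def)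
    let ?N = "{(a, (?f \<circ> s) a) | a. a \<in> A}"
    note N = bij_betw_perfect_matching[OF bij E]
    have "0 \<le> vote_margin A pref M ?N" using pop N(1) unfolding popular_assignment_def by blast
    also have "\<dots> = (\<Sum>a\<in>A. - w a (s a))"
      using N(1) vote_margin_sum[OF \<open>finite A\<close> ME(3), of ?N pref] N(2)
      by (simp add: perfect_matching_def w_def)
    also have "\<dots> = (\<Sum>a\<in>set xs. - w a (s a))"
    proof (rule sum.mono_neutral_right[OF \<open>finite A\<close> xs(3)])
      \<comment> \<open>Agents off the cycle keep their objects, and \<open>w a a\<close> vanishes
        by cancellation.\<close>
      show "\<forall>a\<in>A - set xs. - w a (s a) = 0" using s(2) by (auto simp: w_def)
    qed
    finally show "walk_weight w (xs @ [hd xs]) \<le> 0" using s(4) by (simp add: sum_negf)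
  qed
  then obtain y where y: "\<And>a. a \<in> A \<Longrightarrow> y a < card A"
    "\<And>u v. u \<in> A \<Longrightarrow> v \<in> A \<Longrightarrow> R u v \<Longrightarrow> int (y v) + w u v \<le> int (y u)" by blast
  let ?g = "the_inv_into A ?f"
  have inj: "inj_on ?f A" and img: "?f ` A = B" using f(1) by (auto simp: bij_betw_def)
  have g: "?g b \<in> A" "?f (?g b) = b" if "b \<in> B" for b
    using the_inv_into_into[OF inj, of b A] f_the_inv_into_f[OF inj, of b] that img by auto
  have gf: "?g (?f a) = a" if "a \<in> A" for a using the_inv_into_f_f[OF inj that] .
  show ?thesis
  \<comment> \<open>The default 0 is never consulted on a neighbour, since all edges end in
    \<open>B\<close>.\<close>
  proof (intro exI[of _ "\<lambda>b. if b \<in> B then y (?g b) else 0"] conjI ballI subsetI)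
    fix b assume "b \<in> B" then show "(if b \<in> B then y (?g b) else 0) < card B"
      using y(1) g(1) assms(2) by simp
  next
    fix e assume e: "e \<in> M"
    then obtain a where a: "a \<in> A" "e = (a, ?f a)"
      using ME partner_eq[OF ME(1)] by (cases e) auto
    have fa: "?f a \<in> B" using a(1) img by blast
    show "e \<in> level_edges E pref (\<lambda>b. if b \<in> B then y (?g b) else 0)"
      unfolding a(2) level_edges_def
    proof (clarify, intro conjI ballI)
      show "(a, ?f a) \<in> E" using f(2)[OF a(1)] ME(2) by blast
      then have fn: "?f a \<in> nbrs E a" by (simp add: nbrs_def)
      fix b' assume b': "b' \<in> nbrs E a"
      show "(if b' \<in> B then y (?g b') else 0) + of_bool (pref a b' (?f a))
          \<le> (if ?f a \<in> B then y (?g (?f a)) else 0) + of_bool (pref a (?f a) b')"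
      proof -
        have True: "b' \<in> B" using b' assms(3) by (auto simp: nbrs_def)
        then have "int (y (?g b')) + w a (?g b') \<le> int (y a)"
          using y(2)[OF a(1) g(1)[OF True]] b' g(2)[OF True] by (simp add: R_def nbrs_def)
        then show ?thesis using True fa gf[OF a(1)] g(2)[OF True]
          by (simp add: w_def of_bool_def split: if_splits)
      qed
    qed
  qed
qed

text \<open>Where the levels touch the certificate, the popular assignment \<open>M\<close> consists of level edges,
  so alternating between \<open>M\<close> and the current matching from an unraisable free object would
  never leave the finite set \<open>R\<close>.\<close>

lemma level_less_certificate:
  assumes E: "E \<subseteq> A \<times> B"
    and M: "perfect_matching A B E M" "M \<subseteq> level_edges E pref y"
    and l: "\<And>b. b \<in> B \<Longrightarrow> l b \<le> y b"
    and M': "matching E M'" "M' \<subseteq> level_edges E pref l"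
    and R: "finite R" "R \<subseteq> B" "\<And>a c. (a, c) \<in> level_edges E pref l \<Longrightarrow> c \<in> R \<Longrightarrow> \<exists>d\<in>R. (a, d) \<in> M'"
    and b: "b \<in> R" "b \<notin> Range M'"
  shows "l b < y b"
proof (rule ccontr)
  assume "\<not> l b < y b"
  define S where "S = {c \<in> R. l c = y c}"
  have "b \<in> S" using \<open>\<not> l b < y b\<close> l[of b] b(1) R(2) by (auto simp: S_def)
  have "\<exists>d\<in>S - {b}. \<exists>a. (a, c) \<in> M \<and> (a, d) \<in> M'" if c: "c \<in> S" for c
  proof -
    have "c \<in> B" using c R(2) by (auto simp: S_def)
    then obtain a where a: "(a, c) \<in> M" using M(1) by (auto simp: perfect_matching_def)
    have yac: "(a, c) \<in> level_edges E pref y" using a M(2) by blast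
    have nB: "b' \<in> B" if "b' \<in> nbrs E a" for b'
      using that E by (auto simp: nbrs_def)
    \<comment> \<open>The levels \<open>l\<close> and \<open>y\<close> agree at c and competing
      levels are no larger under \<open>l\<close>, so the inequalities that hold for
      \<open>y\<close> carry over.\<close>
    have "(a, c) \<in> level_edges E pref l"
      using yac c l[OF nB] unfolding level_edges_def S_def by force
    then obtain d where d: "d \<in> R" "(a, d) \<in> M'" using R(3) c by (auto simp: S_def)
    have yad: "(a, d) \<in> level_edges E pref l" using d(2) M'(2) by blast
    moreover have "(a, c) \<in> E" "(a, d) \<in> E" using yac yad by (auto simp: level_edges_def)
    \<comment> \<open>Two level edges bound one vote from opposite sides: y d - y c is at most the
      vote of a for c over d, which is at most l d - l c. With l c = y c and l d \<le> y d this
      forces l d = y d.\<close>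
    ultimately have "l c + of_bool (pref a c d) \<le> l d + of_bool (pref a d c)"
      "y d + of_bool (pref a d c) \<le> y c + of_bool (pref a c d)"
      using yac by (auto simp: level_edges_def nbrs_def)
    then have "l d = y d" using c l[of d] d(1) R(2) by (auto simp: S_def)
    moreover have "d \<noteq> b" using d(2) b(2) by blast
    ultimately show ?thesis using d a by (auto simp: S_def)
  qed
  then obtain h where h: "\<And>c. c \<in> S \<Longrightarrow> h c \<in> S - {b} \<and> (\<exists>a. (a, c) \<in> M \<and> (a, h c) \<in> M')" by metis
  have "inj_on h S"
  proof (rule inj_onI)
    fix c d assume cd: "c \<in> S" "d \<in> S" "h c = h d"
    obtain a a' where "(a, c) \<in> M" "(a, h c) \<in> M'" "(a', d) \<in> M" "(a', h d) \<in> M'"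
      using h cd by meson
    moreover from this have "a = a'" using cd(3) matching_left_unique[OF M'(1)] by metis
    ultimately show "c = d"
      using matching_right_unique M(1) unfolding perfect_matching_def by metis
  qed
  moreover have "finite S" using R(1) by (simp add: S_def)
  moreover have "h ` S \<subseteq> S - {b}" using h by blast
  ultimately have "card S \<le> card (S - {b})" by (metis card_inj_on_le finite_Diff)
  moreover have "card (S - {b}) < card S" using \<open>finite S\<close> \<open>b \<in> S\<close> by (rule card_Diff1_less)
  ultimately show False by simp
qed

text \<open>For each threshold \<open>t\<close>, the objects of price at least \<open>t\<close> together with the agents that see a
  price below \<open>t\<close> form a vertex cover; it exceeds the matching \<open>M\<close> by at most the number of
  objects of price exactly \<open>t\<close>. Summing over \<open>t = 1, \<dots>, K\<close> gives the bound.\<close>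

lemma auction_near_optimal:
  fixes p :: "'b \<Rightarrow> nat"
  assumes fin: "finite B" "finite G" "Range G \<subseteq> B"
    and M: "matching G M" and N: "matching G N"
    and near: "\<And>a b b'. (a, b) \<in> M \<Longrightarrow> (a, b') \<in> G \<Longrightarrow> p b \<le> p b' + 1"
    and free: "\<And>b. b \<in> B \<Longrightarrow> b \<notin> Range M \<Longrightarrow> p b = 0"
    and high: "\<And>a b. (a, b) \<in> G \<Longrightarrow> a \<notin> Domain M \<Longrightarrow> K \<le> p b"
  shows "K * card N \<le> K * card M + card B"
proof -
  have sub: "M \<subseteq> G" "N \<subseteq> G" using M N by (auto simp: matching_def)
  have finMN: "finite M" "finite N" using sub fin(2) finite_subset by auto
  have inj: "inj_on snd X" "inj_on fst X" if "X \<subseteq> Y" "matching G Y" for X Y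
    using that unfolding inj_on_def matching_def by fastforce+
  have one: "card N \<le> card M + card {b \<in> B. p b = t}" if t: "t \<in> {1..K}" for t
  proof -
    \<comment> \<open>\<open>?N1\<close> is counted by its objects and \<open>?N2\<close> by its
      agents. Every cover vertex is matched by \<open>M\<close>: an object of price at least t is
      not free because t is positive, and an agent seeing a price below t is matched because t is at
      most \<open>K\<close>.\<close>
    let ?N1 = "{e \<in> N. t \<le> p (snd e)}" and ?N2 = "{e \<in> N. p (snd e) < t}"
    let ?M1 = "{e \<in> M. t \<le> p (snd e)}" and ?M2 = "{e \<in> M. \<exists>b'. (fst e, b') \<in> G \<and> p b' < t}"
    have "card ?N1 = card (snd ` ?N1)" by (rule card_image[symmetric], rule inj[OF _ N]) auto
    also have "\<dots> \<le> card (snd ` ?M1)"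
    proof (rule card_mono)
      show "finite (snd ` ?M1)" using finMN by auto
      show "snd ` ?N1 \<subseteq> snd ` ?M1"
      proof
        fix b assume "b \<in> snd ` ?N1"
        then obtain a where ab: "(a, b) \<in> N" "t \<le> p b" by auto
        then have "b \<in> B" using sub fin(3) by blast
        then have "b \<in> Range M" using free[of b] ab(2) t by force
        then show "b \<in> snd ` ?M1" using ab(2) by force
      qed
    qed
    also have "\<dots> \<le> card ?M1" using finMN by (intro card_image_le) auto
    finally have 1: "card ?N1 \<le> card ?M1" .
    have "card ?N2 = card (fst ` ?N2)" by (rule card_image[symmetric], rule inj[OF _ N]) auto
    also have "\<dots> \<le> card (fst ` ?M2)"
    proof (rule card_mono)
      show "finite (fst ` ?M2)" using finMN by auto
      show "fst ` ?N2 \<subseteq> fst ` ?M2"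
      proof
        fix a assume "a \<in> fst ` ?N2"
        then obtain b where ab: "(a, b) \<in> N" "p b < t" by auto
        then have "(a, b) \<in> G" using sub by blast
        moreover from this have "a \<in> Domain M" using high[of a b] ab(2) t by force
        ultimately show "a \<in> fst ` ?M2" using ab(2) by force
      qed
    qed
    also have "\<dots> \<le> card ?M2" using finMN by (intro card_image_le) auto
    finally have 2: "card ?N2 \<le> card ?M2" .
    have "card N = card (?N1 \<union> ?N2)" by (rule arg_cong[of _ _ card]) auto
    also have "\<dots> \<le> card ?N1 + card ?N2" by (rule card_Un_le)
    also have "\<dots> \<le> card ?M1 + card ?M2" using 1 2 by simp
    also have "\<dots> = card (?M1 \<union> ?M2) + card (?M1 \<inter> ?M2)"
      using finMN by (intro card_Un_Int) auto
    also have "card (?M1 \<union> ?M2) \<le> card M" using finMN by (intro card_mono) auto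
    also have "card (?M1 \<inter> ?M2) = card (snd ` (?M1 \<inter> ?M2))"
      by (rule card_image[symmetric], rule inj[OF _ M]) auto
    also have "\<dots> \<le> card {b \<in> B. p b = t}"
    proof (rule card_mono)
      show "finite {b \<in> B. p b = t}" using fin by simp
      show "snd ` (?M1 \<inter> ?M2) \<subseteq> {b \<in> B. p b = t}"
      proof
        fix b assume "b \<in> snd ` (?M1 \<inter> ?M2)"
        then obtain a b' where *: "(a, b) \<in> M" "t \<le> p b" "(a, b') \<in> G" "p b' < t" by auto
        then have "p b = t" using near[OF *(1,3)] by simp
        then show "b \<in> {b \<in> B. p b = t}" using *(1) sub fin(3) by blast
      qed
    qed
    finally show ?thesis by simp
  qed
  have "K * card N = (\<Sum>t\<in>{1..K}. card N)" by simp
  also have "\<dots> \<le> (\<Sum>t\<in>{1..K}. card M + card {b \<in> B. p b = t})" by (rule sum_mono) (rule one)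
  also have "\<dots> = K * card M + (\<Sum>t\<in>{1..K}. card {b \<in> B. p b = t})" by (simp add: sum.distrib)
  also have "(\<Sum>t\<in>{1..K}. card {b \<in> B. p b = t}) = card (\<Union>t\<in>{1..K}. {b \<in> B. p b = t})"
    using fin(1) by (intro card_UN_disjoint[symmetric]) auto
  also have "\<dots> \<le> card B" using fin(1) by (intro card_mono) auto
  finally show ?thesis by simp
qed

section \<open>Timed program logic\<close>

fun loop_free :: "com \<Rightarrow> bool" where
  "loop_free (While b c) = False"
| "loop_free (Seq c d) = (loop_free c \<and> loop_free d)"
| "loop_free (Cond b c d) = (loop_free c \<and> loop_free d)"
| "loop_free _ = True"

text \<open>\<open>sem\<close> and \<open>ccost\<close> are meaningful for loop-free commands only.\<close>

fun sem :: "nat \<Rightarrow> com \<Rightarrow> state \<Rightarrow> state" where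
  "sem W (Assign x e) s = s\<lparr>regs := (regs s)(x := aval W e s)\<rparr>"
| "sem W (Store X i e) s = s\<lparr>arrs := (arrs s)(X := (arrs s X)(aval W i s := aval W e s))\<rparr>"
| "sem W (Seq c d) s = sem W d (sem W c s)"
| "sem W (Cond b c d) s = (if bval W b s then sem W c s else sem W d s)"
| "sem W _ s = s"

fun ccost :: "com \<Rightarrow> nat" where
  "ccost Skip = 1"
| "ccost (Assign x e) = 1 + acost e"
| "ccost (Store X i e) = 1 + acost i + acost e"
| "ccost (Seq c d) = ccost c + ccost d"
| "ccost (Cond b c d) = 1 + bcost b + max (ccost c) (ccost d)"
| "ccost (While b c) = 0"

fun wr_regs :: "com \<Rightarrow> nat set" where
  "wr_regs (Assign x e) = {x}"
| "wr_regs (Seq c d) = wr_regs c \<union> wr_regs d"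
| "wr_regs (Cond b c d) = wr_regs c \<union> wr_regs d"
| "wr_regs (While b c) = wr_regs c"
| "wr_regs _ = {}"

fun wr_arrs :: "com \<Rightarrow> nat set" where
  "wr_arrs (Store X i e) = {X}"
| "wr_arrs (Seq c d) = wr_arrs c \<union> wr_arrs d"
| "wr_arrs (Cond b c d) = wr_arrs c \<union> wr_arrs d"
| "wr_arrs (While b c) = wr_arrs c"
| "wr_arrs _ = {}"

definition same_except :: "nat set \<Rightarrow> nat set \<Rightarrow> state \<Rightarrow> state \<Rightarrow> bool" where
  "same_except R X s s' \<longleftrightarrow> (\<forall>x. x \<notin> R \<longrightarrow> regs s' x = regs s x) \<and> (\<forall>x. x \<notin> X \<longrightarrow> arrs s' x = arrs s x)"

abbreviation framed :: "com \<Rightarrow> state \<Rightarrow> state \<Rightarrow> bool" where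
  "framed c \<equiv> same_except (wr_regs c) (wr_arrs c)"

lemma same_exceptD:
  "same_except R X s s' \<Longrightarrow> x \<notin> R \<Longrightarrow> regs s' x = regs s x"
  "same_except R X s s' \<Longrightarrow> y \<notin> X \<Longrightarrow> arrs s' y = arrs s y"
  by (simp_all add: same_except_def)

lemma same_except_refl [simp]: "same_except R X s s"
  by (simp add: same_except_def)

lemma same_except_trans:
  "same_except R X s s' \<Longrightarrow> same_except R' X' s' s'' \<Longrightarrow> R \<subseteq> R'' \<Longrightarrow> R' \<subseteq> R'' \<Longrightarrow> X \<subseteq> X'' \<Longrightarrow> X' \<subseteq> X''
    \<Longrightarrow> same_except R'' X'' s s''"
  unfolding same_except_def by (metis subsetD)

lemma exec_framed: "exec W c s t s' \<Longrightarrow> framed c s s'"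
  by (induction rule: exec.induct) (auto simp: same_except_def)

text \<open>Total correctness with a budget. Since \<open>T\<close> is only an upper bound, both
  branches of a conditional can share it and all iterations of a loop can be charged alike.\<close>

definition runs :: "nat \<Rightarrow> com \<Rightarrow> state \<Rightarrow> nat \<Rightarrow> (state \<Rightarrow> bool) \<Rightarrow> bool" where
  "runs W c s T Q \<longleftrightarrow> (\<exists>t s'. exec W c s t s' \<and> t \<le> T \<and> Q s')"

text \<open>The frame is read off the syntax and comes for free when weakening, so specifications
  need to state only what changes.\<close>

lemma runs_mono:
  "runs W c s T Q \<Longrightarrow> T \<le> T' \<Longrightarrow> (\<And>s'. Q s' \<Longrightarrow> framed c s s' \<Longrightarrow> Q' s') \<Longrightarrow> runs W c s T' Q'"
  unfolding runs_def using exec_framed order_trans by blast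

lemma runs_seq:
  assumes "runs W c s T1 R" "\<And>s'. R s' \<Longrightarrow> framed c s s' \<Longrightarrow> runs W d s' T2 Q"
  shows "runs W (Seq c d) s (T1 + T2) Q"
proof -
  obtain t1 s1 where 1: "exec W c s t1 s1" "t1 \<le> T1" "R s1" using assms(1) by (auto simp: runs_def)
  obtain t2 s2 where 2: "exec W d s1 t2 s2" "t2 \<le> T2" "Q s2"
    using assms(2)[OF 1(3) exec_framed[OF 1(1)]] by (auto simp: runs_def)
  show ?thesis
    unfolding runs_def using exec.Seq[OF 1(1) 2(1)] 1(2) 2(2,3) add_mono by blast
qed

lemma runs_cond:
  assumes "bval W b s \<Longrightarrow> runs W c s T Q" "\<not> bval W b s \<Longrightarrow> runs W d s T Q"
  shows "runs W (Cond b c d) s (1 + bcost b + T) Q"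
proof (cases "bval W b s")
  case True
  then obtain t s' where "exec W c s t s'" "t \<le> T" "Q s'" using assms(1) by (auto simp: runs_def)
  then show ?thesis unfolding runs_def using exec.CondTrue[OF True] by (meson add_left_mono)
next
  case False
  then obtain t s' where "exec W d s t s'" "t \<le> T" "Q s'" using assms(2) by (auto simp: runs_def)
  then show ?thesis unfolding runs_def using exec.CondFalse[OF False] by (meson add_left_mono)
qed

text \<open>Reduces straight-line code to simplification of \<open>sem\<close>; the time is only
  bounded because \<open>ccost\<close> takes the dearer branch.\<close>

lemma exec_sem: "loop_free c \<Longrightarrow> \<exists>t\<le>ccost c. exec W c s t (sem W c s)"
proof (induction c arbitrary: s)
  case (Seq c d)
  obtain t1 where 1: "t1 \<le> ccost c" "exec W c s t1 (sem W c s)"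
    using Seq.IH(1) Seq.prems by auto
  obtain t2 where 2: "t2 \<le> ccost d" "exec W d (sem W c s) t2 (sem W d (sem W c s))"
    using Seq.IH(2) Seq.prems by auto
  show ?case using exec.Seq[OF 1(2) 2(2)] 1(1) 2(1) by (auto intro!: exI[of _ "t1 + t2"])
next
  case (Cond b c d)
  show ?case
  proof (cases "bval W b s")
    case True
    obtain t where "t \<le> ccost c" "exec W c s t (sem W c s)" using Cond.IH(1) Cond.prems by auto
    then show ?thesis using exec.CondTrue[OF True, of c t] True
      by (auto intro!: exI[of _ "1 + bcost b + t"])
  next
    case False
    obtain t where "t \<le> ccost d" "exec W d s t (sem W d s)" using Cond.IH(2) Cond.prems by auto
    then show ?thesis using exec.CondFalse[OF False, of d t] False
      by (auto intro!: exI[of _ "1 + bcost b + t"])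
  qed
next
  case Skip
  show ?case using exec.Skip[of W s] by auto
next
  case (Assign x e)
  show ?case using exec.Assign[of W x e s] by auto
next
  case (Store X i e)
  show ?case using exec.Store[of W X i e s] by auto
qed simp

lemma runs_sem: "loop_free c \<Longrightarrow> ccost c \<le> T \<Longrightarrow> Q (sem W c s) \<Longrightarrow> runs W c s T Q"
  unfolding runs_def using exec_sem order_trans by blast

lemma runs_seq_sem:
  "loop_free c \<Longrightarrow> runs W d (sem W c s) T Q \<Longrightarrow> runs W (Seq c d) s (ccost c + T) Q"
  by (rule runs_seq[where R = "\<lambda>s'. s' = sem W c s"]) (auto intro: runs_sem)

text \<open>The measure bounds the number of iterations, and the added 1 pays for the last, failing
  guard. Each step may use the frame relative to the state before the loop, so invariants need not
  repeat what the body never writes.\<close>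

lemma runs_while:
  assumes "I s"
    and step: "\<And>s'. I s' \<Longrightarrow> bval W b s' \<Longrightarrow> framed c s s' \<Longrightarrow>
      runs W c s' T (\<lambda>s''. I s'' \<and> \<mu> s'' < (\<mu> s' :: nat))"
  shows "runs W (While b c) s ((\<mu> s + 1) * (1 + bcost b + T)) (\<lambda>s'. I s' \<and> \<not> bval W b s')"
proof -
  have "runs W (While b c) s' ((\<mu> s' + 1) * (1 + bcost b + T)) (\<lambda>s'. I s' \<and> \<not> bval W b s')"
    if "I s'" "framed c s s'" for s'
    using that
  proof (induction "\<mu> s'" arbitrary: s' rule: less_induct)
    case less
    show ?case
    proof (cases "bval W b s'")
      case False
      then show ?thesis using exec.WhileFalse[OF False, of c] less.prems(1)
        unfolding runs_def by (intro exI[of _ "1 + bcost b"] exI[of _ s']) auto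
    next
      case True
      from step[OF less.prems(1) True less.prems(2)] obtain t1 s1 where
        1: "exec W c s' t1 s1" "t1 \<le> T" "I s1" "\<mu> s1 < \<mu> s'" by (auto simp: runs_def)
      have "framed c s s1"
        using same_except_trans[OF less.prems(2) exec_framed[OF 1(1)]] by blast
      from less.hyps[OF 1(4,3) this] obtain t2 s2 where
        2: "exec W (While b c) s1 t2 s2" "t2 \<le> (\<mu> s1 + 1) * (1 + bcost b + T)"
          "I s2 \<and> \<not> bval W b s2"
        by (auto simp: runs_def)
      have "(\<mu> s1 + 1) * (1 + bcost b + T) \<le> \<mu> s' * (1 + bcost b + T)"
        using 1(4) by (intro mult_right_mono) auto
      then have "1 + bcost b + t1 + t2 \<le> (\<mu> s' + 1) * (1 + bcost b + T)"
        using 1(2) 2(2) by simp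
      then show ?thesis
        unfolding runs_def using exec.WhileTrue[OF True 1(1) 2(1)] 2(3) by blast
    qed
  qed
  from this[OF assms(1)] show ?thesis by simp
qed

abbreviation Inc :: "nat \<Rightarrow> com" where
  "Inc x \<equiv> Assign x (Add (Reg x) (Num 1))"

definition for_loop :: "nat \<Rightarrow> nat \<Rightarrow> com \<Rightarrow> com" where
  "for_loop i hi c = Seq (Assign i (Num 0)) (While (Less (Reg i) (Reg hi)) (Seq c (Inc i)))"

lemma wr_for_loop [simp]:
  "wr_regs (for_loop i hi c) = insert i (wr_regs c)" "wr_arrs (for_loop i hi c) = wr_arrs c"
  by (auto simp: for_loop_def)

text \<open>Guard and increment cost 4 each, whence the 8. The increment invalidates the counter
  register, so \<open>P\<close> must be stable under writing to it; \<open>N < W\<close> prevents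
  wrap-around of the counter.\<close>

lemma runs_for_loop:
  assumes N: "regs s hi = N" "N < W" and i: "i \<noteq> hi" "i \<notin> wr_regs c" "hi \<notin> wr_regs c"
    and start: "P 0 s"
    and stable: "\<And>j s' v. P j s' \<Longrightarrow> P j (s'\<lparr>regs := (regs s')(i := v)\<rparr>)"
    and step: "\<And>j s'. j < N \<Longrightarrow> regs s' i = j \<Longrightarrow> P j s' \<Longrightarrow> framed (for_loop i hi c) s s' \<Longrightarrow>
      runs W c s' T (P (Suc j))"
  shows "runs W (for_loop i hi c) s ((N + 2) * (T + 8)) (P N)"
proof -
  let ?s0 = "s\<lparr>regs := (regs s)(i := 0)\<rparr>"
  define I where "I s' \<longleftrightarrow> regs s' i \<le> N \<and> P (regs s' i) s'" for s'
  have W: "Suc 0 \<le> W" using N by simp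
  have fr: "framed (for_loop i hi c) s ?s0" by (simp add: same_except_def)
  have "runs W (While (Less (Reg i) (Reg hi)) (Seq c (Inc i))) ?s0
     ((N - regs ?s0 i + 1) * (1 + bcost (Less (Reg i) (Reg hi)) + (T + 4)))
     (\<lambda>s'. I s' \<and> \<not> bval W (Less (Reg i) (Reg hi)) s')"
  proof (rule runs_while[where \<mu> = "\<lambda>s. N - regs s i"])
    show "I ?s0" using stable[OF start, of 0] by (simp add: I_def)
    fix s' assume I: "I s'" and b: "bval W (Less (Reg i) (Reg hi)) s'"
      and f: "framed (Seq c (Inc i)) ?s0 s'"
    have f': "framed (for_loop i hi c) s s'"
      by (rule same_except_trans[OF fr f]) auto
    have hi: "regs s' hi = N"
      using f' i N(1) by (simp add: same_except_def)
    have lt: "regs s' i < N" using b hi by simp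
    have "runs W c s' T (P (Suc (regs s' i)))"
      by (rule step[OF lt refl _ f']) (use I in \<open>simp add: I_def\<close>)
    then show "runs W (Seq c (Inc i)) s' (T + 4) (\<lambda>s''. I s'' \<and> N - regs s'' i < N - regs s' i)"
    proof (rule runs_seq)
      fix s'' assume P: "P (Suc (regs s' i)) s''" and f'': "framed c s' s''"
      have eq: "regs s'' i = regs s' i" using f'' i by (simp add: same_except_def)
      have "(regs s' i + 1 mod W) mod W = Suc (regs s' i)"
        using lt N(2) by simp
      then show "runs W (Inc i) s'' 4 (\<lambda>s''. I s'' \<and> N - regs s'' i < N - regs s' i)"
        using stable[OF P, of "Suc (regs s' i)"] lt eq
        by (intro runs_sem) (auto simp: I_def)
    qed
  qed
  then have w: "runs W (While (Less (Reg i) (Reg hi)) (Seq c (Inc i))) ?s0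
     ((N + 1) * (1 + bcost (Less (Reg i) (Reg hi)) + (T + 4))) (P N)"
  proof (rule runs_mono)
    fix s' assume "I s' \<and> \<not> bval W (Less (Reg i) (Reg hi)) s'"
      "framed (While (Less (Reg i) (Reg hi)) (Seq c (Inc i))) ?s0 s'"
    then have "regs s' i = N" "P (regs s' i) s'"
      using i N(1) by (auto simp: I_def same_except_def)
    then show "P N s'" by simp
  qed simp
  show ?thesis
    unfolding for_loop_def
  proof (rule runs_mono[OF runs_seq[where R = "\<lambda>s'. s' = ?s0" and ?T1.0 = 2]])
    show "runs W (Assign i (Num 0)) s 2 (\<lambda>s'. s' = ?s0)"
      by (rule runs_sem) auto
    show "runs W (While (Less (Reg i) (Reg hi)) (Seq c (Inc i))) s'
       ((N + 1) * (1 + bcost (Less (Reg i) (Reg hi)) + (T + 4))) (P N)" if "s' = ?s0" for s'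
      using w that by simp
  qed (auto simp: algebra_simps)
qed

section \<open>The program\<close>

fun Seqs :: "com list \<Rightarrow> com" where
  "Seqs [] = Skip"
| "Seqs [c] = c"
| "Seqs (c # d # cs) = Seq c (Seqs (d # cs))"

abbreviation pair_index :: "nat \<Rightarrow> nat \<Rightarrow> aexp" where
  "pair_index a b \<equiv> Add (Mul (Reg a) (Reg 0)) (Reg b)"

abbreviation triple_index :: "nat \<Rightarrow> nat \<Rightarrow> nat \<Rightarrow> aexp" where
  "triple_index a b c \<equiv> Add (Mul (pair_index a b) (Reg 0)) (Reg c)"

text \<open>Registers: 0 \<open>n\<close>, 1 \<open>m\<close>, 2 price cap, 3 loop index, 4 object being raised, 5 agent,
  6 agents that entered the auction, 7 bidding agent plus 1, 8 object, 9 and 10 scratch,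
  11 and 12 head and tail of the search queue, 13 adjacency position, 14 object found plus 1,
  15 matching can still be augmented, 16 verdict (0 undecided, 1 yes, 2 no).

  Arrays: 4 adjacency matrix, 5 and 6 adjacency lists and their lengths, 7 levels, 8 matrix of the
  level edges, 9 prices, 10 owner plus 1 of each object, 11 adjacency positions inspected so far
  by each agent in the auction, 12 discovery time of each object in the search, 13 agent from
  which it was discovered, 14 object plus 1 through which an agent was reached, 15 search queue,
  16 (shifted by 1) matched agents.\<close>

definition build_body :: com where
  "build_body = Seqs [
     Assign 5 (Cell 0 (Reg 3)), Assign 8 (Cell 1 (Reg 3)),
     Store 4 (pair_index 5 8) (Num 1),
     Store 5 (Add (Mul (Reg 5) (Reg 0)) (Cell 6 (Reg 5))) (Reg 8),
     Store 6 (Reg 5) (Add (Cell 6 (Reg 5)) (Num 1))]"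

definition cap_prog :: com where
  "cap_prog = Seq (Assign 2 (Num 1)) (While (Neg (Less (Reg 0) (Mul (Reg 2) (Reg 2)))) (Inc 2))"

text \<open>With b in register 4 and a scanned edge (a, c), registers 9 and 10 hold the two sides of
  the level inequality for b and c; the smaller side loses its edge. Comparing only with b keeps a
  refresh to a single pass over the edges.\<close>

definition refresh_body :: com where
  "refresh_body = Seqs [
     Assign 5 (Cell 0 (Reg 3)), Assign 8 (Cell 1 (Reg 3)),
     Cond (Equal (Cell 4 (pair_index 5 4)) (Num 1))
       (Seqs [
         Assign 9 (Add (Cell 7 (Reg 4)) (Cell 2 (triple_index 5 4 8))),
         Assign 10 (Add (Cell 7 (Reg 8)) (Cell 2 (triple_index 5 8 4))),
         Cond (Less (Reg 9) (Reg 10)) (Store 8 (pair_index 5 4) (Num 0))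
           (Cond (Less (Reg 10) (Reg 9)) (Store 8 (pair_index 5 8) (Num 0)) Skip)])
       Skip]"

definition refresh :: com where
  "refresh = Seq
     (for_loop 3 0 (Store 8 (pair_index 3 4) (Cell 4 (pair_index 3 4))))
     (for_loop 3 1 refresh_body)"

text \<open>Every run admits one agent, lets one give up, or inspects one list position. Division of
  the counter by the degree gives the current price and the remainder the position, so no loops have
  to be nested and the iterations can be counted globally.\<close>

definition auction_body :: com where
  "auction_body = Cond (Equal (Reg 7) (Num 0))
     (Seqs [Inc 6, Assign 7 (Reg 6)])
     (Seq (Assign 5 (Sub (Reg 7) (Num 1)))
       (Cond (Less (Cell 11 (Reg 5)) (Mul (Reg 2) (Cell 6 (Reg 5))))
         (Seqs [
           Assign 8 (Cell 5 (Add (Mul (Reg 5) (Reg 0)) (Mod (Cell 11 (Reg 5)) (Cell 6 (Reg 5))))),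
           Assign 9 (Div (Cell 11 (Reg 5)) (Cell 6 (Reg 5))),
           Store 11 (Reg 5) (Add (Cell 11 (Reg 5)) (Num 1)),
           Cond (Conj (Equal (Cell 8 (pair_index 5 8)) (Num 1)) (Neg (Less (Reg 9) (Cell 9 (Reg 8)))))
             (Seqs [
               Store 9 (Reg 8) (Add (Reg 9) (Num 1)),
               Assign 7 (Cell 10 (Reg 8)),
               Store 10 (Reg 8) (Add (Reg 5) (Num 1))])
             Skip])
         (Assign 7 (Num 0))))"

definition auction :: com where
  "auction = Seqs [
     for_loop 3 0 (Seqs [Store 9 (Reg 3) (Num 0), Store 10 (Reg 3) (Num 0), Store 11 (Reg 3) (Num 0)]),
     Assign 6 (Num 0), Assign 7 (Num 0),
     While (Less (Num 0) (Add (Sub (Reg 0) (Reg 6)) (Reg 7))) auction_body]"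

text \<open>Breadth-first search flattened in the same way: one adjacency position, or one move of
  the queue head, per run.\<close>

definition search_body :: com where
  "search_body = Seq (Assign 5 (Cell 15 (Reg 11)))
     (Cond (Less (Reg 13) (Cell 6 (Reg 5)))
       (Seqs [
         Assign 8 (Cell 5 (pair_index 5 13)),
         Inc 13,
         Cond (Conj (Equal (Cell 8 (pair_index 5 8)) (Num 1)) (Equal (Cell 12 (Reg 8)) (Num 0)))
           (Seqs [
             Store 12 (Reg 8) (Reg 12),
             Store 13 (Reg 8) (Reg 5),
             Cond (Equal (Cell 10 (Reg 8)) (Num 0))
               (Assign 14 (Add (Reg 8) (Num 1)))
               (Seqs [
                 Assign 9 (Sub (Cell 10 (Reg 8)) (Num 1)),
                 Store 15 (Reg 12) (Reg 9),
                 Store 14 (Reg 9) (Add (Reg 8) (Num 1)),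
                 Inc 12])])
           Skip])
       (Seqs [Inc 11, Assign 13 (Num 0)]))"

definition search :: com where
  "search = Seqs [
     for_loop 3 0 (Seqs [Store 12 (Reg 3) (Num 0), Store 14 (Reg 3) (Num 0),
       Store 16 (Add (Reg 3) (Num 1)) (Num 0)]),
     for_loop 3 0 (Store 16 (Cell 10 (Reg 3)) (Num 1)),
     Assign 12 (Num 0),
     for_loop 3 0 (Cond (Equal (Cell 16 (Add (Reg 3) (Num 1))) (Num 0))
       (Seqs [Store 15 (Reg 12) (Reg 3), Inc 12]) Skip),
     Assign 11 (Num 0), Assign 13 (Num 0), Assign 14 (Num 0),
     While (Conj (Less (Reg 11) (Reg 12)) (Equal (Reg 14) (Num 0))) search_body]"

definition augment_body :: com where
  "augment_body = Seqs [
     Assign 8 (Sub (Reg 14) (Num 1)),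
     Assign 5 (Cell 13 (Reg 8)),
     Assign 14 (Cell 14 (Reg 5)),
     Store 10 (Reg 8) (Add (Reg 5) (Num 1))]"

definition augment :: com where
  "augment = While (Neg (Equal (Reg 14) (Num 0))) augment_body"

definition improve :: com where
  "improve = Seq (Assign 15 (Num 1))
     (While (Equal (Reg 15) (Num 1))
       (Seq search (Seq (Cond (Equal (Reg 14) (Num 0)) (Assign 15 (Num 0)) Skip) augment)))"

definition find_free :: com where
  "find_free = Seq (Assign 4 (Num 0))
     (While (Conj (Less (Reg 4) (Reg 0)) (Neg (Equal (Cell 10 (Reg 4)) (Num 0)))) (Inc 4))"

definition raise :: com where
  "raise = Cond (Less (Reg 4) (Reg 0))
     (Seq (Store 7 (Reg 4) (Add (Cell 7 (Reg 4)) (Num 1)))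
       (Cond (Less (Cell 7 (Reg 4)) (Reg 0)) refresh (Assign 16 (Num 2))))
     (Assign 16 (Num 1))"

definition phase :: com where
  "phase = Seq auction (Seq improve (Seq find_free raise))"

text \<open>At level 0 everywhere, refreshing each object in turn fills the level matrix column by
  column. The difference 2 minus the verdict maps 1 and 2 to the answers 1 and 0.\<close>

definition main_prog :: com where
  "main_prog = Seq (for_loop 3 1 build_body) (Seq cap_prog (Seq (for_loop 4 0 refresh)
     (Seq (While (Equal (Reg 16) (Num 0)) phase)
       (Seq (for_loop 3 0 (Store 3 (Sub (Cell 10 (Reg 3)) (Num 1)) (Reg 3)))
         (Assign 0 (Sub (Num 2) (Reg 16)))))))"

text \<open>A perfect matching has \<open>n\<close> edges, so \<open>m < n\<close> means no. Past
  this test \<open>m\<close> absorbs every additive term in \<open>n\<close>.\<close>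

definition popular_prog :: com where
  "popular_prog = Cond (Less (Reg 1) (Reg 0)) (Assign 0 (Num 0)) main_prog"

section \<open>Word bounds and the graph in memory\<close>

locale popular_machine =
  fixes n :: nat and E :: "(nat \<times> nat) set" and pref :: "nat \<Rightarrow> nat \<Rightarrow> nat \<Rightarrow> bool"
    and es :: "(nat \<times> nat) list" and W :: nat
  assumes inst: "assignment_instance {..<n} {..<n} E pref"
    and es: "distinct es" "set es = E"
    and W: "W = (n + 2) ^ 4"
begin

definition deg :: "nat \<Rightarrow> nat" where
  "deg a = card (nbrs E a)"

lemma E_sub: "E \<subseteq> {..<n} \<times> {..<n}"
  using inst by (simp add: assignment_instance_def)

lemma E_less: "(a, b) \<in> E \<Longrightarrow> a < n" "(a, b) \<in> E \<Longrightarrow> b < n"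
  using E_sub by auto

lemma finite_E: "finite E"
  using E_sub finite_subset by blast

lemma nbrs_less: "nbrs E a \<subseteq> {..<n}"
  using E_less by (auto simp: nbrs_def)

lemma deg_le: "deg a \<le> n"
  unfolding deg_def using card_mono[OF _ nbrs_less] by simp

lemma sum_deg: "(\<Sum>a<n. deg a) = length es"
proof -
  have "E = Sigma {..<n} (nbrs E)" using E_less by (auto simp: nbrs_def)
  then have "card E = (\<Sum>a<n. card (nbrs E a))"
    using card_SigmaI[of "{..<n}" "nbrs E"] finite_subset[OF nbrs_less] by simp
  then show ?thesis using es distinct_card[of es] by (simp add: deg_def)
qed

text \<open>The largest words that occur are indices into the comparison table, below n * n * n.
  Hence no arithmetic of the program ever wraps around.\<close>

lemma word: "x \<le> (n + 1) * (n + 1) * (n + 1) \<Longrightarrow> x < W"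
proof -
  have "(n + 1) * (n + 1) * (n + 1) = (n + 1) ^ 3" by (simp add: power3_eq_cube)
  also have "\<dots> < (n + 2) ^ 3" by (rule power_strict_mono) auto
  also have "\<dots> \<le> W" unfolding W by (rule power_increasing) auto
  finally show "x \<le> (n + 1) * (n + 1) * (n + 1) \<Longrightarrow> x < W" by simp
qed

lemma word2: "x \<le> (n + 1) * (n + 1) \<Longrightarrow> x < W"
  by (rule word, erule order_trans) simp

lemma pair_less: "a < n \<Longrightarrow> b < n \<Longrightarrow> a * n + b < n * n"
proof -
  assume "a < n" "b < n"
  then have "a * n + b < (a + 1) * n" by simp
  also have "\<dots> \<le> n * n" using \<open>a < n\<close> by (intro mult_right_mono) auto
  finally show ?thesis .
qed

lemma pair_eq_iff: "b < n \<Longrightarrow> b' < n \<Longrightarrow> a * n + b = a' * n + b' \<longleftrightarrow> a = a' \<and> b = b'"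
  by (metis add.commute add_right_cancel div_mult_self1 div_less mod_less mod_mult_self1 not_less_zero
      add_0 neq0_conv)

lemma word_pair: "a < n \<Longrightarrow> b < n \<Longrightarrow> (a * n + b) mod W = a * n + b"
  using pair_less[of a b] word2[of "a * n + b"] by simp

lemma word_row: "a < n \<Longrightarrow> (a * n) mod W = a * n"
  using word_pair[of a 0] by simp

lemma triple_less: "a < n \<Longrightarrow> b < n \<Longrightarrow> c < n \<Longrightarrow> (a * n + b) * n + c < n * n * n"
proof -
  assume less: "a < n" "b < n" "c < n"
  then have "(a * n + b) * n + c < (a * n + b + 1) * n" by simp
  also have "\<dots> \<le> (n * n) * n" using pair_less[OF less(1,2)] by (intro mult_right_mono) auto
  finally show ?thesis .
qed

lemma word_triple: "a < n \<Longrightarrow> b < n \<Longrightarrow> c < n \<Longrightarrow> ((a * n + b) * n + c) mod W = (a * n + b) * n + c"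
proof -
  assume "a < n" "b < n" "c < n"
  then have "(a * n + b) * n + c < n * n * n" by (rule triple_less)
  also have "\<dots> \<le> (n + 1) * (n + 1) * (n + 1)" by (intro mult_mono) auto
  finally show ?thesis using word by simp
qed

lemma word_pair_row: "a < n \<Longrightarrow> b < n \<Longrightarrow> ((a * n + b) * n) mod W = (a * n + b) * n"
  using word_triple[of a b 0] by simp

lemma word_small: "x \<le> n * n + n \<Longrightarrow> x mod W = x" "x \<le> n * n + n \<Longrightarrow> Suc x mod W = Suc x"
  using word2[of x] word2[of "Suc x"] by simp_all

lemma word_const: "0 mod W = 0" "1 mod W = 1" "2 mod W = 2" "Suc 0 mod W = Suc 0" "W \<noteq> Suc 0"
proof -
  have "2 ^ 4 \<le> W" unfolding W by (rule power_mono) auto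
  then show "0 mod W = 0" "1 mod W = 1" "2 mod W = 2" "Suc 0 mod W = Suc 0" "W \<noteq> Suc 0" by simp_all
qed

text \<open>The order of an adjacency list is left open. Its length is the number of neighbours, so
  the image equation also rules out repetitions.\<close>

definition graph_arrays :: "state \<Rightarrow> bool" where
  "graph_arrays s \<longleftrightarrow> regs s 0 = n \<and> regs s 1 = length es
     \<and> (\<forall>i<length es. arrs s 0 i = fst (es ! i) \<and> arrs s 1 i = snd (es ! i))
     \<and> (\<forall>a<n. \<forall>b<n. \<forall>c<n. arrs s 2 ((a * n + b) * n + c) = of_bool (pref a b c))
     \<and> (\<forall>a<n. \<forall>b<n. arrs s 4 (a * n + b) = of_bool ((a, b) \<in> E))
     \<and> (\<forall>a<n. arrs s 6 a = deg a)
     \<and> (\<forall>a<n. (\<lambda>i. arrs s 5 (a * n + i)) ` {..<deg a} = nbrs E a)"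

lemma graph_arrays_frame:
  "graph_arrays s \<Longrightarrow> same_except R X s s' \<Longrightarrow> R \<inter> {0, 1} = {} \<Longrightarrow> X \<inter> {0, 1, 2, 4, 5, 6} = {}
    \<Longrightarrow> graph_arrays s'"
  unfolding graph_arrays_def same_except_def by auto

lemma length_es: "length es \<le> n * n" "length es < W"
proof -
  have "length es = card E" using es distinct_card[of es] by simp
  also have "\<dots> \<le> card ({..<n} \<times> {..<n})" using E_sub by (intro card_mono) auto
  finally show "length es \<le> n * n" by simp
  then show "length es < W" using word2[of "length es"] by simp
qed

lemma n_less_W: "n < W"
  by (rule word2) simp

lemma es_nth: "i < length es \<Longrightarrow> (fst (es ! i), snd (es ! i)) \<in> E"
  using es(2) nth_mem[of i es] by simp

lemma build_spec:
  assumes s: "s = input_state n es pref"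
  shows "runs W (for_loop 3 1 build_body) s (100 * (length es + 1)) graph_arrays"
proof -
  define P where "P j s' \<longleftrightarrow>
     (\<forall>a<n. \<forall>b<n. arrs s' 4 (a * n + b) = of_bool ((a, b) \<in> set (take j es)))
     \<and> (\<forall>a<n. arrs s' 6 a = card (nbrs (set (take j es)) a))
     \<and> (\<forall>a<n. (\<lambda>i. arrs s' 5 (a * n + i)) ` {..<card (nbrs (set (take j es)) a)}
           = nbrs (set (take j es)) a)" for j and s' :: state
  have s0: "regs s 0 = n" "regs s 1 = length es"
    "\<And>i. i < length es \<Longrightarrow> arrs s 0 i = fst (es ! i) \<and> arrs s 1 i = snd (es ! i)"
    by (simp_all add: s input_state_def)
  have pref: "arrs s 2 ((a * n + b) * n + c) = of_bool (pref a b c)" if "a < n" "b < n" "c < n" for a b c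
  proof -
    have "(a * n + b) * n + c < n ^ 3" using triple_less[OF that] by (simp add: power3_eq_cube)
    moreover have "((a * n + b) * n + c) div n = a * n + b" "((a * n + b) * n + c) mod n = c"
      "(a * n + b) mod n = b" "(a * n + b) div n = a"
      using that by simp_all
    moreover have "((a * n + b) * n + c) div n ^ 2 = a"
      using calculation(2,5) by (simp add: power2_eq_square div_mult2_eq)
    ultimately show ?thesis by (simp add: s input_state_def)
  qed
  have "runs W (for_loop 3 1 build_body) s ((length es + 2) * (ccost build_body + 8)) (P (length es))"
  proof (rule runs_for_loop)
    show "P 0 s" by (simp add: P_def s input_state_def nbrs_def)
  next
    fix j s' assume j: "j < length es" and ri: "regs s' 3 = j" and P: "P j s'"
      and fr: "framed (for_loop 3 1 build_body) s s'"
    obtain a0 c0 where e: "es ! j = (a0, c0)" by fastforce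
    let ?F = "set (take j es)" and ?F' = "set (take (Suc j) es)"
    have E: "(a0, c0) \<in> E" using es_nth[OF j] e by simp
    have less: "a0 < n" "c0 < n" using E_less[OF E] .
    have F': "?F' = insert (a0, c0) ?F" using j e by (simp add: take_Suc_conv_app_nth)
    \<comment> \<open>Distinctness of \<open>es\<close> is what keeps the list length equal to the
      number of neighbours found so far.\<close>
    have new: "(a0, c0) \<notin> ?F"
    proof
      assume "(a0, c0) \<in> ?F"
      then obtain i where "i < j" "es ! i = es ! j" using e j by (auto simp: in_set_conv_nth)
      then show False using es(1) j nth_eq_iff_index_eq[of es i j] by simp
    qed
    have nb: "nbrs ?F' a = (if a = a0 then insert c0 (nbrs ?F a) else nbrs ?F a)" for a
      unfolding F' by (auto simp: nbrs_def)
    have fin: "finite (nbrs ?F a)" for a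
      by (rule finite_subset[of _ "snd ` ?F"]) (auto simp: nbrs_def intro: rev_image_eqI)
    have sub: "nbrs ?F a \<subseteq> {..<n}" for a
      using nbrs_less[of a] set_take_subset[of j es] es(2) by (auto simp: nbrs_def)
    have cardn: "card (nbrs ?F a) \<le> n" for a
      using card_mono[OF _ sub[of a]] by simp
    have card': "card (nbrs ?F' a0) = Suc (card (nbrs ?F a0))"
      using new fin by (simp add: nb) (simp add: nbrs_def)
    have "insert c0 (nbrs ?F a0) \<subseteq> {..<n}" using sub less by auto
    \<comment> \<open>The next free position is below \<open>n\<close>, so the store stays within
      the row of \<open>a0\<close>.\<close>
    then have lt: "card (nbrs ?F a0) < n"
      using card' card_mono[of "{..<n}" "nbrs ?F' a0"] by (simp add: nb)
    have reg: "regs s' 0 = n" "arrs s' 0 j = a0" "arrs s' (Suc 0) j = c0"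
      using fr s0 j e by (auto simp: same_except_def build_body_def)
    have deg: "arrs s' 6 a0 = card (nbrs ?F a0)" using P less by (simp add: P_def)
    have arrs: "arrs (sem W build_body s') = (arrs s')(
        4 := (arrs s' 4)(a0 * n + c0 := 1),
        5 := (arrs s' 5)(a0 * n + card (nbrs ?F a0) := c0),
        6 := (arrs s' 6)(a0 := Suc (card (nbrs ?F a0))))"
      using less lt
      by (simp add: build_body_def ri reg deg word_row word_pair word_const word_small)
    have "P (Suc j) (sem W build_body s')"
      unfolding P_def arrs
    proof (intro conjI allI impI)
      fix a b assume ab: "a < n" "b < n"
      show "((arrs s')(4 := (arrs s' 4)(a0 * n + c0 := 1),
        5 := (arrs s' 5)(a0 * n + card (nbrs ?F a0) := c0),
        6 := (arrs s' 6)(a0 := Suc (card (nbrs ?F a0))))) 4 (a * n + b) = of_bool ((a, b) \<in> ?F')"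
        using P ab less by (auto simp: P_def F' pair_eq_iff)
    next
      fix a assume a: "a < n"
      show "((arrs s')(4 := (arrs s' 4)(a0 * n + c0 := 1),
        5 := (arrs s' 5)(a0 * n + card (nbrs ?F a0) := c0),
        6 := (arrs s' 6)(a0 := Suc (card (nbrs ?F a0))))) 6 a = card (nbrs ?F' a)"
        using P a card' by (auto simp: P_def nb)
    next
      fix a assume a: "a < n"
      have "(\<lambda>i. ((arrs s' 5)(a0 * n + card (nbrs ?F a0) := c0)) (a * n + i)) ` {..<card (nbrs ?F a)}
         = (\<lambda>i. arrs s' 5 (a * n + i)) ` {..<card (nbrs ?F a)}"
        using lt cardn[of a] by (intro image_cong) (auto simp: pair_eq_iff)
      then have "(\<lambda>i. ((arrs s' 5)(a0 * n + card (nbrs ?F a0) := c0)) (a * n + i)) ` {..<card (nbrs ?F a)}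
         = nbrs ?F a" using P a by (simp add: P_def)
      then show "(\<lambda>i. ((arrs s')(4 := (arrs s' 4)(a0 * n + c0 := 1),
        5 := (arrs s' 5)(a0 * n + card (nbrs ?F a0) := c0),
        6 := (arrs s' 6)(a0 := Suc (card (nbrs ?F a0))))) 5 (a * n + i)) ` {..<card (nbrs ?F' a)}
         = nbrs ?F' a"
        using card' by (cases "a = a0") (auto simp: nb lessThan_Suc)
    qed
    then show "runs W build_body s' (ccost build_body) (P (Suc j))"
      by (intro runs_sem) (auto simp: build_body_def)
  qed (use s0 length_es in \<open>auto simp: P_def build_body_def\<close>)
  then show ?thesis
  proof (rule runs_mono)
    fix s' assume P: "P (length es) s'" and fr: "framed (for_loop 3 1 build_body) s s'"
    then show "graph_arrays s'"
      using s0 pref es(2) unfolding graph_arrays_def P_def deg_def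
      by (simp add: same_except_def build_body_def)
  qed (simp add: build_body_def)
qed

text \<open>The least integer whose square exceeds \<open>n\<close>: large enough for
  \<open>n div cap\<close> to stay below it, and within a constant factor of sqrt n when
  \<open>n\<close> is positive.\<close>

definition cap :: nat where
  "cap = (LEAST k. n < k * k)"

lemma cap_square: "n < cap * cap"
  unfolding cap_def by (rule LeastI[of _ "Suc n"]) simp

lemma cap_le: "n < k * k \<Longrightarrow> cap \<le> k"
  unfolding cap_def by (rule Least_le)

lemma cap_pos: "0 < cap"
  using cap_square by (cases cap) auto

lemma cap_le_Suc: "cap \<le> Suc n"
  by (rule cap_le) simp

lemma cap_pred_square: "(cap - 1) * (cap - 1) \<le> n"
  using cap_le[of "cap - 1"] cap_pos by (cases "n < (cap - 1) * (cap - 1)") auto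

lemma cap_spec:
  assumes s: "graph_arrays s"
  shows "runs W cap_prog s (20 * (n + 2)) (\<lambda>s'. regs s' 2 = cap)"
proof -
  have n: "regs s 0 = n" using s by (simp add: graph_arrays_def)
  let ?s = "s\<lparr>regs := (regs s)(2 := 1)\<rparr>"
  let ?b = "Neg (Less (Reg 0) (Mul (Reg 2) (Reg 2)))"
  let ?I = "\<lambda>s'. regs s' 2 \<le> cap"
  \<comment> \<open>The squares tested are at most (n + 1) * (n + 1), so the machine multiplication
    is exact.\<close>
  have mod: "(k * k) mod W = k * k" "Suc k mod W = Suc k" if "k \<le> cap" for k
  proof -
    have "k \<le> n + 1" using that cap_le_Suc by simp
    then have "k * k \<le> (n + 1) * (n + 1)" by (intro mult_mono) auto
    then show "(k * k) mod W = k * k" using word2 by simp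
    have "Suc k \<le> n + 2" using \<open>k \<le> n + 1\<close> by simp
    moreover have "n + 2 < W" unfolding W using power_strict_increasing[of 1 4 "n + 2"] by simp
    ultimately show "Suc k mod W = Suc k" by simp
  qed
  have "runs W (While ?b (Inc 2)) ?s ((cap - regs ?s 2 + 1) * (1 + bcost ?b + 4)) (\<lambda>s'. ?I s' \<and> \<not> bval W ?b s')"
  proof (rule runs_while[where \<mu> = "\<lambda>s. cap - regs s 2"])
    fix s' assume I: "?I s'" and b: "bval W ?b s'" and fr: "framed (Inc 2) ?s s'"
    have "regs s' 0 = n" using fr n by (simp add: same_except_def)
    then have "\<not> n < regs s' 2 * regs s' 2" using b mod[OF I] by simp
    then have "regs s' 2 \<noteq> cap" using cap_square by auto
    then have "regs s' 2 < cap" using I by simp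
    then show "runs W (Inc 2) s' 4 (\<lambda>s''. ?I s'' \<and> cap - regs s'' 2 < cap - regs s' 2)"
      using mod[OF I] by (intro runs_sem) (auto simp: word_const)
  qed (use cap_pos in simp)
  then have w: "runs W (While ?b (Inc 2)) ?s (12 * (n + 1)) (\<lambda>s'. regs s' 2 = cap)"
  proof (rule runs_mono)
    fix s' assume *: "?I s' \<and> \<not> bval W ?b s'" "framed (While ?b (Inc 2)) ?s s'"
    have "regs s' 0 = n" using *(2) n by (simp add: same_except_def)
    then show "regs s' 2 = cap" using *(1) mod cap_le[of "regs s' 2"] by auto
  next
    show "(cap - regs ?s 2 + 1) * (1 + bcost ?b + 4) \<le> 12 * (n + 1)"
      using cap_le_Suc by (simp add: algebra_simps)
  qed
  show ?thesis
    unfolding cap_prog_def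
    by (rule runs_mono[OF runs_seq[where R = "\<lambda>s'. s' = ?s", OF runs_sem[where T = 2]]])
      (use w in \<open>auto simp: word_const\<close>)
qed

section \<open>Level edges under the raise of one object\<close>

definition dominates :: "(nat \<Rightarrow> nat) \<Rightarrow> nat \<Rightarrow> nat \<Rightarrow> nat \<Rightarrow> bool" where
  "dominates l a b b' \<longleftrightarrow> l b' + of_bool (pref a b' b) < l b + of_bool (pref a b b')"

lemma level_edges_iff:
  "(a, b) \<in> level_edges E pref l \<longleftrightarrow> (a, b) \<in> E \<and> (\<forall>b'. (a, b') \<in> E \<longrightarrow> \<not> dominates l a b' b)"
  by (auto simp: level_edges_def nbrs_def dominates_def not_less)

text \<open>The columns vouched for are a parameter, so that a partly filled matrix can be described
  during initialization.\<close>

definition level_matrix :: "nat set \<Rightarrow> (nat \<Rightarrow> nat) \<Rightarrow> (nat \<Rightarrow> nat) \<Rightarrow> bool" where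
  "level_matrix S l g \<longleftrightarrow>
     (\<forall>a<n. \<forall>b\<in>S. g (a * n + b) = of_bool ((a, b) \<in> level_edges E pref l))"

text \<open>Raising b can only strengthen dominations by b and leaves those between other objects
  alone. So an edge at another object can be lost to b but never gained; only the edges at b itself
  have to be decided afresh.\<close>

lemma level_edges_raise:
  assumes "b' \<noteq> b" and l: "\<And>c. c \<noteq> b \<Longrightarrow> c < n \<Longrightarrow> l0 c = l c" "l0 b \<le> l b"
  shows "(a, b') \<in> level_edges E pref l \<longleftrightarrow>
    (a, b') \<in> level_edges E pref l0 \<and> \<not> ((a, b) \<in> E \<and> (a, b') \<in> E \<and> dominates l a b b')"
proof (cases "(a, b') \<in> E")
  case True
  have "dominates l a c b' \<longleftrightarrow> dominates l0 a c b'" if "c \<noteq> b" "(a, c) \<in> E" for c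
    using l(1) that assms(1) E_less(2) True by (simp add: dominates_def)
  moreover have "dominates l0 a b b' \<Longrightarrow> dominates l a b b'"
    using l(1)[OF assms(1) E_less(2)[OF True]] l(2) by (simp add: dominates_def)
  ultimately show ?thesis unfolding level_edges_iff using True by metis
qed (simp add: level_edges_iff)

text \<open>Serves two callers: after a raise, \<open>S\<close> holds all columns and
  \<open>l0\<close> is the old level function; during initialization, \<open>S\<close> holds the
  columns done so far and \<open>l0\<close> equals the current levels.\<close>

lemma refresh_spec:
  assumes s: "graph_arrays s" and b: "regs s 4 = b" "b < n"
    and g: "level_matrix S l0 (arrs s 8)" and S: "S \<subseteq> {..<n}"
    and l0: "\<And>c. c \<noteq> b \<Longrightarrow> c < n \<Longrightarrow> l0 c = arrs s 7 c" "l0 b \<le> arrs s 7 b"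
    and l: "\<And>c. c < n \<Longrightarrow> arrs s 7 c \<le> n"
  shows "runs W refresh s (200 * (length es + n + 1))
    (\<lambda>s'. level_matrix (insert b S) (arrs s 7) (arrs s' 8))"
proof -
  let ?l = "arrs s 7"
  define P1 where "P1 j s' \<longleftrightarrow> level_matrix (S - {b}) l0 (arrs s' 8)
     \<and> (\<forall>a<j. arrs s' 8 (a * n + b) = of_bool ((a, b) \<in> E))" for j and s' :: state
  let ?body1 = "Store 8 (pair_index 3 4) (Cell 4 (pair_index 3 4))"
  have n0: "regs s 0 = n" "regs s (Suc 0) = length es" using s by (simp_all add: graph_arrays_def)
  have 1: "runs W (for_loop 3 0 ?body1) s ((n + 2) * (ccost ?body1 + 8)) (P1 n)"
  proof (rule runs_for_loop)
    fix j s' assume j: "j < n" "regs s' 3 = j" and P: "P1 j s'" and fr: "framed (for_loop 3 0 ?body1) s s'"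
    have reg: "regs s' 0 = n" "regs s' 4 = b" and adj: "arrs s' 4 (j * n + b) = of_bool ((j, b) \<in> E)"
      using fr n0 b s j(1) by (auto simp: same_except_def graph_arrays_def)
    have "arrs (sem W ?body1 s') 8 = (arrs s' 8)(j * n + b := of_bool ((j, b) \<in> E))"
      using j b adj by (simp add: reg word_row word_pair)
    then have "P1 (Suc j) (sem W ?body1 s')"
      using P j S b(2) unfolding P1_def level_matrix_def
      by (auto simp: pair_eq_iff less_Suc_eq subset_iff)
    then show "runs W ?body1 s' (ccost ?body1) (P1 (Suc j))" by (intro runs_sem) auto
  qed (use n0 n_less_W g in \<open>auto simp: P1_def level_matrix_def\<close>)
  \<comment> \<open>In column b an entry must survive all scanned competitors, starting from plain
    adjacency. In the other columns b is the only new competitor, and it is met when the edge itself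
    is scanned.\<close>
  define P2 where "P2 j s' \<longleftrightarrow>
     (\<forall>a<n. arrs s' 8 (a * n + b) =
        of_bool ((a, b) \<in> E \<and> (\<forall>c. (a, c) \<in> set (take j es) \<longrightarrow> \<not> dominates ?l a c b)))
     \<and> (\<forall>a<n. \<forall>b'\<in>S - {b}. arrs s' 8 (a * n + b') = of_bool ((a, b') \<in> level_edges E pref l0 \<and>
        \<not> ((a, b) \<in> E \<and> (a, b') \<in> set (take j es) \<and> dominates ?l a b b')))" for j and s' :: state
  have 2: "runs W (for_loop 3 1 refresh_body) s1 ((length es + 2) * (ccost refresh_body + 8)) (P2 (length es))"
    if P1: "P1 n s1" and fr1: "framed (for_loop 3 0 ?body1) s s1" for s1
  proof (rule runs_for_loop)
    fix j s' assume j: "j < length es" "regs s' 3 = j" and P: "P2 j s'"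
      and fr: "framed (for_loop 3 1 refresh_body) s1 s'"
    have fr2: "same_except {3, 5, 8, 9, 10} {8} s s'"
      by (rule same_except_trans[OF fr1 fr]) (auto simp: refresh_body_def)
    obtain a0 c0 where e: "es ! j = (a0, c0)" by fastforce
    let ?F = "set (take j es)" and ?F' = "set (take (Suc j) es)"
    have E: "(a0, c0) \<in> E" using es_nth[OF j(1)] e by simp
    have less: "a0 < n" "c0 < n" using E_less[OF E] .
    have F': "?F' = insert (a0, c0) ?F" using j e by (simp add: take_Suc_conv_app_nth)
    have reg: "regs s' 0 = n" "regs s' 4 = b" "arrs s' 0 j = a0" "arrs s' (Suc 0) j = c0"
      "arrs s' 7 = ?l" "arrs s' 2 ((a0 * n + b) * n + c0) = of_bool (pref a0 b c0)"
      "arrs s' 2 ((a0 * n + c0) * n + b) = of_bool (pref a0 c0 b)"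
      "arrs s' 4 (a0 * n + b) = of_bool ((a0, b) \<in> E)"
      using same_exceptD[OF fr2] s b j e less by (auto simp: graph_arrays_def)
    have mod: "(?l c + of_bool x) mod W = ?l c + of_bool x" if "c < n" for c x
      using l[OF that] word2[of "?l c + of_bool x"] by (simp add: of_bool_def)
    have arr: "arrs (sem W refresh_body s') 8 = (if (a0, b) \<in> E
        then if dominates ?l a0 c0 b then (arrs s' 8)(a0 * n + b := 0)
          else if dominates ?l a0 b c0 then (arrs s' 8)(a0 * n + c0 := 0) else arrs s' 8
        else arrs s' 8)"
      using less b
      by (simp add: refresh_body_def j reg word_row word_pair word_pair_row word_triple word_const mod dominates_def)
    \<comment> \<open>The scan also compares b with itself, which must delete nothing.\<close>
    have bb: "\<not> dominates ?l a0 b b" if "b = c0" by (simp add: dominates_def)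
    have asym: "dominates ?l a0 c0 b \<Longrightarrow> \<not> dominates ?l a0 b c0" by (simp add: dominates_def)
    have lt: "b' < n" if "b' \<in> S" for b' using S that by auto
    have "P2 (Suc j) (sem W refresh_body s')"
      unfolding P2_def arr F'
    proof (intro conjI allI impI ballI)
      fix a assume a: "a < n"
      show "(if (a0, b) \<in> E
        then if dominates ?l a0 c0 b then (arrs s' 8)(a0 * n + b := 0)
          else if dominates ?l a0 b c0 then (arrs s' 8)(a0 * n + c0 := 0) else arrs s' 8
        else arrs s' 8) (a * n + b) =
          of_bool ((a, b) \<in> E \<and> (\<forall>c. (a, c) \<in> insert (a0, c0) ?F \<longrightarrow> \<not> dominates ?l a c b))"
        using P a b less bb by (auto simp: P2_def pair_eq_iff)
      fix b' assume b': "b' \<in> S - {b}"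
      show "(if (a0, b) \<in> E
        then if dominates ?l a0 c0 b then (arrs s' 8)(a0 * n + b := 0)
          else if dominates ?l a0 b c0 then (arrs s' 8)(a0 * n + c0 := 0) else arrs s' 8
        else arrs s' 8) (a * n + b') = of_bool ((a, b') \<in> level_edges E pref l0 \<and>
          \<not> ((a, b) \<in> E \<and> (a, b') \<in> insert (a0, c0) ?F \<and> dominates ?l a b b'))"
        using P a b less b' lt[of b'] asym by (auto simp: P2_def pair_eq_iff)
    qed
    then show "runs W refresh_body s' (ccost refresh_body) (P2 (Suc j))"
      by (intro runs_sem) (auto simp: refresh_body_def)
  next
    show "P2 0 s1" using P1 by (auto simp: P1_def P2_def level_matrix_def)
    show "regs s1 1 = length es" using same_exceptD(1)[OF fr1, of 1] n0 by simp
  qed (use length_es in \<open>auto simp: P2_def refresh_body_def\<close>)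
  show ?thesis
    unfolding refresh_def
  proof (rule runs_mono[OF runs_seq[OF 1 2]])
    fix s' assume P: "P2 (length es) s'"
    show "level_matrix (insert b S) ?l (arrs s' 8)"
      unfolding level_matrix_def
    proof (intro allI impI ballI)
      fix a b' assume a: "a < n" and b': "b' \<in> insert b S"
      show "arrs s' 8 (a * n + b') = of_bool ((a, b') \<in> level_edges E pref ?l)"
      proof (cases "b' = b")
        case True
        then show ?thesis using P a es(2) by (auto simp: P2_def level_edges_iff)
      next
        case False
        then show ?thesis using P a b' es(2) level_edges_raise[where ?l0.0 = l0 and l = ?l and a = a, OF False l0] by (auto simp: P2_def)
      qed
    qed
  next
    show "(n + 2) * (ccost ?body1 + 8) + (length es + 2) * (ccost refresh_body + 8)
      \<le> 200 * (length es + n + 1)"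
      by (simp add: refresh_body_def)
  qed
qed

section \<open>The auction\<close>

definition assigned :: "(nat \<Rightarrow> nat) \<Rightarrow> (nat \<times> nat) set" where
  "assigned own = {(a, b). b < n \<and> own b = Suc a}"

text \<open>An owner array gives each object at most one owner by construction; what remains is that
  owners are adjacent and own only one object.\<close>

lemma matching_assigned:
  "matching G (assigned own) \<longleftrightarrow> (\<forall>b<n. \<forall>a. own b = Suc a \<longrightarrow> (a, b) \<in> G)
     \<and> (\<forall>b<n. \<forall>b'<n. own b \<noteq> 0 \<longrightarrow> own b = own b' \<longrightarrow> b = b')" (is "?L \<longleftrightarrow> ?R1 \<and> ?R2")
proof
  assume L: ?L
  then have ?R1 unfolding matching_def assigned_def by blast
  moreover have ?R2
  proof (intro allI impI)
    fix b b' assume *: "b < n" "b' < n" "own b \<noteq> 0" "own b = own b'"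
    obtain a where "own b = Suc a" using *(3) not0_implies_Suc by blast
    then show "b = b'" using matching_right_unique[OF L, of a b b'] * by (simp add: assigned_def)
  qed
  ultimately show "?R1 \<and> ?R2" ..
next
  assume "?R1 \<and> ?R2"
  then show ?L unfolding matching_def assigned_def by auto
qed

text \<open>A count \<open>cnt a = u * deg a + i\<close> means that \<open>a\<close> has made \<open>u\<close> passes through her adjacency list,
  bidding in the pass numbered \<open>u\<close> only at price \<open>u\<close>, and is at position \<open>i\<close> of the next pass.
  The bidder \<open>cur\<close> and the owners are shifted by one, with 0 for none.\<close>

definition auction_inv ::
  "(nat \<times> nat) set \<Rightarrow> (nat \<Rightarrow> nat) \<Rightarrow> (nat \<Rightarrow> nat) \<Rightarrow> (nat \<Rightarrow> nat) \<Rightarrow> (nat \<Rightarrow> nat) \<Rightarrow> nat \<Rightarrow> nat \<Rightarrow> bool" where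
  "auction_inv G nb p own cnt x cur \<longleftrightarrow> x \<le> n \<and> cur \<le> x
     \<and> (\<forall>b<n. \<forall>a. own b = Suc a \<longrightarrow>
          a < x \<and> cur \<noteq> Suc a \<and> (a, b) \<in> G \<and> (\<forall>b'. (a, b') \<in> G \<longrightarrow> p b \<le> p b' + 1))
     \<and> (\<forall>b<n. \<forall>b'<n. own b \<noteq> 0 \<longrightarrow> own b = own b' \<longrightarrow> b = b')
     \<and> (\<forall>b<n. own b = 0 \<longrightarrow> p b = 0)
     \<and> (\<forall>a<n. cnt a \<le> cap * deg a \<and> (\<forall>j<cnt a. (a, nb (a * n + j mod deg a)) \<in> G \<longrightarrow>
          j div deg a < p (nb (a * n + j mod deg a))))
     \<and> (\<forall>a<x. cur \<noteq> Suc a \<longrightarrow> (\<forall>b<n. own b \<noteq> Suc a) \<longrightarrow> cap * deg a \<le> cnt a)"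

lemma auction_enter:
  "auction_inv G nb p own cnt x 0 \<Longrightarrow> x < n \<Longrightarrow> auction_inv G nb p own cnt (Suc x) (Suc x)"
  unfolding auction_inv_def by (auto simp: less_Suc_eq)

lemma auction_give_up:
  "auction_inv G nb p own cnt x (Suc a) \<Longrightarrow> cap * deg a \<le> cnt a \<Longrightarrow> auction_inv G nb p own cnt x 0"
  unfolding auction_inv_def by auto

lemma auction_skip:
  assumes "auction_inv G nb p own cnt x (Suc a)" "cnt a < cap * deg a"
    "\<not> ((a, nb (a * n + cnt a mod deg a)) \<in> G \<and> \<not> cnt a div deg a < p (nb (a * n + cnt a mod deg a)))"
  shows "auction_inv G nb p own (cnt(a := Suc (cnt a))) x (Suc a)"
  using assms unfolding auction_inv_def by (auto simp: less_Suc_eq)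

text \<open>In the previous pass a found every level neighbour priced above the number of that pass,
  and prices never fall. So all her neighbours now cost at least the current pass number, and her
  new price exceeds none of them by more than one. The displaced owner bids next and resumes her own
  counter.\<close>

lemma auction_bid:
  assumes inv: "auction_inv G nb p own cnt x (Suc a)" and cnt: "cnt a < cap * deg a"
    and nb: "(\<lambda>i. nb (a * n + i)) ` {..<deg a} = nbrs E a" and G: "G \<subseteq> E"
    and b: "b = nb (a * n + cnt a mod deg a)" "(a, b) \<in> G" "\<not> cnt a div deg a < p b"
  shows "auction_inv G nb (p(b := Suc (cnt a div deg a))) (own(b := Suc a))
    (cnt(a := Suc (cnt a))) x (own b)"
proof -
  let ?u = "cnt a div deg a"
  let ?p = "p(b := Suc ?u)"
  have dpos: "0 < deg a" using cnt by (cases "deg a") auto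
  have bn: "b < n" using b(2) G E_less by blast
  have mono: "p c \<le> ?p c" for c using b(3) by simp
  have near: "?u \<le> p b'" if "(a, b') \<in> G" for b'
  proof (cases ?u)
    case (Suc v)
    have "b' \<in> nbrs E a" using that G by (auto simp: nbrs_def)
    then obtain i where i: "i < deg a" "b' = nb (a * n + i)" using nb by auto
    let ?j = "v * deg a + i"
    have j: "?j mod deg a = i" "?j div deg a = v" using i dpos by simp_all
    have "?j < Suc v * deg a" using i by simp
    also have "\<dots> \<le> cnt a" using Suc by (metis div_times_less_eq_dividend)
    finally have "v < p b'"
      using inv that i j E_less(1)[of a b'] G unfolding auction_inv_def by (metis subsetD)
    then show ?thesis using Suc by simp
  qed simp
  show ?thesis
    unfolding auction_inv_def
  proof (intro conjI allI impI)
    show "x \<le> n" using inv by (simp add: auction_inv_def)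
    show "own b \<le> x" using inv bn by (cases "own b") (auto simp: auction_inv_def)
  next
    fix c d assume c: "c < n" "(own(b := Suc a)) c = Suc d"
    show "d < x" using inv c by (auto simp: auction_inv_def split: if_splits)
    show "own b \<noteq> Suc d"
      using inv c bn unfolding auction_inv_def by (auto split: if_splits)
    show "(d, c) \<in> G" using inv c b(2) by (auto simp: auction_inv_def split: if_splits)
    fix b' assume b': "(d, b') \<in> G"
    show "?p c \<le> ?p b' + 1"
    proof (cases "c = b")
      case True
      then show ?thesis using c near[of b'] b' by auto
    next
      case False
      then have "p c \<le> p b' + 1" using inv c b' by (auto simp: auction_inv_def)
      then show ?thesis using False mono[of b'] by simp
    qed
  next
    fix c c' assume "c < n" "c' < n" "(own(b := Suc a)) c \<noteq> 0" "(own(b := Suc a)) c = (own(b := Suc a)) c'"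
    then show "c = c'" using inv bn unfolding auction_inv_def by (auto split: if_splits) metis+
  next
    fix c assume "c < n" "(own(b := Suc a)) c = 0"
    then show "?p c = 0" using inv by (auto simp: auction_inv_def split: if_splits)
  next
    fix d assume d: "d < n"
    show "(cnt(a := Suc (cnt a))) d \<le> cap * deg d" using inv cnt d by (auto simp: auction_inv_def)
    fix j assume j: "j < (cnt(a := Suc (cnt a))) d" "(d, nb (d * n + j mod deg d)) \<in> G"
    show "j div deg d < ?p (nb (d * n + j mod deg d))"
    proof (cases "d = a \<and> j = cnt a")
      case True
      then show ?thesis using b(1) by simp
    next
      case False
      then have "j < cnt d" using j(1) by (auto split: if_splits)
      then have "j div deg d < p (nb (d * n + j mod deg d))"
        using inv d j(2) by (auto simp: auction_inv_def)
      then show ?thesis using mono order_less_le_trans by blast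
    qed
  next
    fix d assume d: "d < x" "own b \<noteq> Suc d" "\<forall>c<n. (own(b := Suc a)) c \<noteq> Suc d"
    have "d \<noteq> a" using d(3) bn by auto
    moreover have "\<forall>c<n. own c \<noteq> Suc d" using d by (metis fun_upd_other)
    ultimately show "cap * deg d \<le> (cnt(a := Suc (cnt a))) d"
      using inv d(1) by (auto simp: auction_inv_def)
  qed
qed

lemma auction_final:
  assumes inv: "auction_inv G nb p own cnt n 0" and G: "G \<subseteq> E"
    and nb: "\<And>a. a < n \<Longrightarrow> (\<lambda>i. nb (a * n + i)) ` {..<deg a} = nbrs E a"
  shows "matching G (assigned own)"
    "matching G N \<Longrightarrow> card N \<le> card (assigned own) + n div cap"
proof -
  show M: "matching G (assigned own)"
    using inv unfolding matching_assigned auction_inv_def by blast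
  assume N: "matching G N"
  have "cap * card N \<le> cap * card (assigned own) + card {..<n}"
  proof (rule auction_near_optimal[OF _ _ _ M N, where p = p])
    show "finite G" using G finite_E finite_subset by blast
    show "Range G \<subseteq> {..<n}" using G E_less by blast
    show "p b \<le> p b' + 1" if "(a, b) \<in> assigned own" "(a, b') \<in> G" for a b b'
      using that inv by (auto simp: auction_inv_def assigned_def)
    show "p b = 0" if "b \<in> {..<n}" "b \<notin> Range (assigned own)" for b
    proof -
      have "own b = 0" using that by (cases "own b") (auto simp: assigned_def)
      moreover have "\<forall>b<n. own b = 0 \<longrightarrow> p b = 0" using inv unfolding auction_inv_def by blast
      ultimately show ?thesis using that by simp
    qed
    show "cap \<le> p b" if ab: "(a, b) \<in> G" and free: "a \<notin> Domain (assigned own)" for a b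
    proof -
      have a: "a < n" using ab G E_less by blast
      have "\<forall>b<n. own b \<noteq> Suc a" using free by (auto simp: assigned_def)
      moreover have "\<forall>a<n. 0 \<noteq> Suc a \<longrightarrow> (\<forall>b<n. own b \<noteq> Suc a) \<longrightarrow> cap * deg a \<le> cnt a"
        using inv unfolding auction_inv_def by blast
      ultimately have cnt: "cap * deg a \<le> cnt a" using a by simp
      have seen: "\<forall>j<cnt a. (a, nb (a * n + j mod deg a)) \<in> G \<longrightarrow>
          j div deg a < p (nb (a * n + j mod deg a))"
        using inv a unfolding auction_inv_def by blast
      have "b \<in> nbrs E a" using ab G by (auto simp: nbrs_def)
      then obtain i where i: "i < deg a" "b = nb (a * n + i)" using nb[OF a] by auto
      \<comment> \<open>The inspection of b in the last pass, numbered \<open>cap - 1\<close>, left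
        the price of b above that number.\<close>
      let ?j = "(cap - 1) * deg a + i"
      have "?j < (cap - 1) * deg a + deg a" using i by simp
      also have "\<dots> = cap * deg a" using cap_pos by (cases cap) auto
      finally have "?j < cnt a" using cnt by simp
      moreover have "?j mod deg a = i" "?j div deg a = cap - 1" using i by simp_all
      ultimately have "cap - 1 < p b"
        using seen ab i by metis
      then show ?thesis by simp
    qed
  qed simp
  then have "cap * (card N - card (assigned own)) \<le> n" by (simp add: right_diff_distrib')
  then have "card N - card (assigned own) \<le> n div cap"
    using cap_pos by (simp add: less_eq_div_iff_mult_less_eq mult.commute)
  then show "card N \<le> card (assigned own) + n div cap" by simp
qed

lemma cap_deg: "cap * deg a \<le> n * n + n"
proof -
  have "cap * deg a \<le> Suc n * n" using cap_le_Suc deg_le by (intro mult_mono) auto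
  then show ?thesis by simp
qed

lemma auction_spec:
  assumes s: "graph_arrays s" and K: "regs s 2 = cap"
    and g: "level_matrix {..<n} l (arrs s 8)"
  defines "G \<equiv> level_edges E pref l"
  shows "runs W auction s (200 * (cap * length es + n + 1))
    (\<lambda>s'. matching G (assigned (arrs s' 10)) \<and>
      (\<forall>N. matching G N \<longrightarrow> card N \<le> card (assigned (arrs s' 10)) + n div cap))"
proof -
  have n0: "regs s 0 = n" using s by (simp add: graph_arrays_def)
  have G: "G \<subseteq> E" by (auto simp: G_def level_edges_def)
  let ?clear = "Seqs [Store 9 (Reg 3) (Num 0), Store 10 (Reg 3) (Num 0), Store 11 (Reg 3) (Num 0)]"
  define P where "P j s' \<longleftrightarrow> (\<forall>i<j. arrs s' 9 i = 0 \<and> arrs s' 10 i = 0 \<and> arrs s' 11 i = 0)"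
    for j and s' :: state
  have 1: "runs W (for_loop 3 0 ?clear) s ((n + 2) * (ccost ?clear + 8)) (P n)"
  proof (rule runs_for_loop)
    fix j s' assume "j < n" "regs s' 3 = j" "P j s'" 
    then show "runs W ?clear s' (ccost ?clear) (P (Suc j))"
      by (intro runs_sem) (auto simp: P_def word_const less_Suc_eq)
  qed (use n0 n_less_W in \<open>auto simp: P_def\<close>)
  define I where "I s' \<longleftrightarrow>
    auction_inv G (arrs s 5) (arrs s' 9) (arrs s' 10) (arrs s' 11) (regs s' 6) (regs s' 7)" for s' :: state
  \<comment> \<open>Admission activates a bidder, so agents yet to enter count twice. An inspection
    lowers the sum, and the indicator cannot grow then because a bidder was already active.\<close>
  define \<mu> where "\<mu> s' = 2 * (n - regs s' 6) + (if regs s' 7 = 0 then 0 else 1) +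
    (\<Sum>a<n. cap * deg a - arrs s' 11 a)" for s' :: state
  \<comment> \<open>Positive exactly while some agent has not entered or a bidder is active; under
    the invariant the sum does not wrap.\<close>
  let ?b = "Less (Num 0) (Add (Sub (Reg 0) (Reg 6)) (Reg 7))"
  have nb: "(\<lambda>i. arrs s 5 (a * n + i)) ` {..<deg a} = nbrs E a" if "a < n" for a
    using s that by (simp add: graph_arrays_def)
  have step: "runs W auction_body s' (ccost auction_body) (\<lambda>s''. I s'' \<and> \<mu> s'' < \<mu> s')"
    if I: "I s'" and b: "bval W ?b s'" and fr: "same_except {3, 5, 6, 7, 8, 9} {9, 10, 11} s s'" for s'
  proof -
    have reg: "regs s' 0 = n" "regs s' 2 = cap" "arrs s' 5 = arrs s 5"
      using same_exceptD[OF fr] n0 K by simp_all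
    have arr: "\<And>a. a < n \<Longrightarrow> arrs s' 6 a = deg a"
      "\<And>a b. a < n \<Longrightarrow> b < n \<Longrightarrow> arrs s' 8 (a * n + b) = of_bool ((a, b) \<in> G)"
      using same_exceptD[OF fr] s g by (simp_all add: graph_arrays_def level_matrix_def G_def)
    have xn: "regs s' 6 \<le> n" "regs s' 7 \<le> regs s' 6" using I by (simp_all add: I_def auction_inv_def)
    have lf: "loop_free auction_body" by (simp add: auction_body_def)
    have "I (sem W auction_body s') \<and> \<mu> (sem W auction_body s') < \<mu> s'"
    proof (cases "regs s' 7")
      case 0
      have "(n - regs s' 6) mod W = n - regs s' 6" using n_less_W by simp
      then have x: "regs s' 6 < n" using b 0 by (simp add: word_const reg)
      let ?t = "sem W auction_body s'"
      have t: "regs ?t 6 = Suc (regs s' 6)" "regs ?t 7 = Suc (regs s' 6)" "arrs ?t = arrs s'"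
        using 0 x by (simp_all add: auction_body_def word_const word_small)
      show ?thesis
        using auction_enter[of G "arrs s 5" "arrs s' 9" "arrs s' 10" "arrs s' 11" "regs s' 6"] I 0 x
        by (simp add: I_def \<mu>_def t)
    next
      case (Suc a)
      then have a: "a < n" using xn by simp
      have inv: "auction_inv G (arrs s 5) (arrs s' 9) (arrs s' 10) (arrs s' 11) (regs s' 6) (Suc a)"
        using I Suc by (simp add: I_def)
      let ?cnt = "arrs s' 11"
      have mod: "(cap * deg a) mod W = cap * deg a" using cap_deg by (rule word_small)
      show ?thesis
      proof (cases "?cnt a < cap * deg a")
        case False
        let ?t = "sem W auction_body s'"
        have t: "regs ?t 6 = regs s' 6" "regs ?t 7 = 0" "arrs ?t = arrs s'"
          using Suc False a by (simp_all add: auction_body_def word_const reg arr mod)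
        show ?thesis
          using auction_give_up[OF inv] False Suc by (simp add: I_def \<mu>_def t)
      next
        case True
        define b where "b = arrs s 5 (a * n + ?cnt a mod deg a)"
        have dpos: "0 < deg a" using True by (cases "deg a") auto
        then have r: "?cnt a mod deg a < deg a" "?cnt a mod deg a < n"
          using deg_le[of a] mod_less_divisor[of "deg a" "?cnt a"] by linarith+
        have "b \<in> nbrs E a" using r nb[OF a] unfolding b_def by blast
        then have bn: "b < n" using E_less by (auto simp: nbrs_def)
        have cnt_le: "?cnt a \<le> n * n + n" using True cap_deg[of a] by simp
        have u: "?cnt a div deg a \<le> n * n + n" using cnt_le div_le_dividend order_trans by blast
        have sum: "(\<Sum>d<n. cap * deg d - (?cnt(a := Suc (?cnt a))) d) < (\<Sum>d<n. cap * deg d - ?cnt d)"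
          using a True by (intro sum_strict_mono_ex1) auto
        let ?t = "sem W auction_body s'"
        show ?thesis
        proof (cases "(a, b) \<in> G \<and> \<not> ?cnt a div deg a < arrs s' 9 b")
          case False
          have t: "regs ?t 6 = regs s' 6" "regs ?t 7 = Suc a" "arrs ?t = (arrs s')(11 := ?cnt(a := Suc (?cnt a)))"
            using Suc True a False bn r cnt_le
            by (auto simp: auction_body_def word_const reg arr mod word_row word_pair word_small b_def[symmetric])
          show ?thesis
            using auction_skip[OF inv True] False sum Suc by (simp add: I_def \<mu>_def t b_def)
        next
          case bid: True
          have t: "regs ?t 6 = regs s' 6" "regs ?t 7 = arrs s' 10 b"
            "arrs ?t = (arrs s')(11 := ?cnt(a := Suc (?cnt a)),
               9 := (arrs s' 9)(b := Suc (?cnt a div deg a)), 10 := (arrs s' 10)(b := Suc a))"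
            using Suc True a bid bn r cnt_le u
            by (auto simp: auction_body_def word_const reg arr mod word_row word_pair word_small b_def[symmetric])
          show ?thesis
            using auction_bid[OF inv True nb[OF a] G b_def] bid sum Suc by (simp add: I_def \<mu>_def t)
        qed
      qed
    qed
    then show ?thesis using lf by (intro runs_sem) auto
  qed
  have 2: "runs W (While ?b auction_body) s2 ((2 * n + cap * length es + 1) * (8 + ccost auction_body))
     (\<lambda>s'. matching G (assigned (arrs s' 10)) \<and>
      (\<forall>N. matching G N \<longrightarrow> card N \<le> card (assigned (arrs s' 10)) + n div cap))"
    if P: "P n s2" and r: "regs s2 6 = 0" "regs s2 7 = 0"
      and fr: "same_except {3, 6, 7} {9, 10, 11} s s2" for s2
  proof (rule runs_mono[OF runs_while[where I = I and \<mu> = \<mu> and T = "ccost auction_body"]])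
    show "I s2" using P r by (auto simp: I_def P_def auction_inv_def)
    show "runs W auction_body s' (ccost auction_body) (\<lambda>s''. I s'' \<and> \<mu> s'' < \<mu> s')"
      if "I s'" "bval W ?b s'" "framed auction_body s2 s'" for s'
      by (rule step[OF that(1,2)], rule same_except_trans[OF fr that(3)])
        (auto simp: auction_body_def)
    have "(\<Sum>a<n. cap * deg a - arrs s2 11 a) \<le> (\<Sum>a<n. cap * deg a)" by (rule sum_mono) simp
    also have "\<dots> = cap * length es" by (simp add: sum_distrib_left[symmetric] sum_deg)
    finally have "\<mu> s2 \<le> 2 * n + cap * length es" using r by (simp add: \<mu>_def)
    then show "(\<mu> s2 + 1) * (1 + bcost ?b + ccost auction_body)
        \<le> (2 * n + cap * length es + 1) * (8 + ccost auction_body)"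
      by (intro mult_mono) auto
  next
    fix s' assume *: "I s' \<and> \<not> bval W ?b s'" and f: "framed (While ?b auction_body) s2 s'"
    have fr': "same_except {3, 5, 6, 7, 8, 9} {9, 10, 11} s s'"
      by (rule same_except_trans[OF fr f]) (auto simp: auction_body_def)
    have "regs s' 0 = n" using same_exceptD(1)[OF fr', of 0] n0 by simp
    moreover have "regs s' 6 \<le> n" "regs s' 7 \<le> regs s' 6" using * by (simp_all add: I_def auction_inv_def)
    moreover have "(n - regs s' 6 + regs s' 7) mod W = n - regs s' 6 + regs s' 7"
      using calculation n_less_W by simp
    ultimately have "regs s' 6 = n" "regs s' 7 = 0" using * by (simp_all add: word_const)
    then have "auction_inv G (arrs s 5) (arrs s' 9) (arrs s' 10) (arrs s' 11) n 0"
      using * by (simp add: I_def)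
    from auction_final[OF this G nb] show "matching G (assigned (arrs s' 10)) \<and>
      (\<forall>N. matching G N \<longrightarrow> card N \<le> card (assigned (arrs s' 10)) + n div cap)" by blast
  qed
  let ?Q = "\<lambda>s'. matching G (assigned (arrs s' 10)) \<and>
      (\<forall>N. matching G N \<longrightarrow> card N \<le> card (assigned (arrs s' 10)) + n div cap)"
  have 3: "runs W (Seqs [Assign 6 (Num 0), Assign 7 (Num 0), While ?b auction_body]) s1
     (2 + (2 + ((2 * n + cap * length es + 1) * (8 + ccost auction_body) + 1))) ?Q"
    if P: "P n s1" and fr: "framed (for_loop 3 0 ?clear) s s1" for s1
  proof -
    let ?s2 = "sem W (Assign 7 (Num 0)) (sem W (Assign 6 (Num 0)) s1)"
    have fr2: "same_except {3, 6, 7} {9, 10, 11} s ?s2"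
      using fr by (auto simp: same_except_def)
    have w: "runs W (While ?b auction_body) ?s2 ((2 * n + cap * length es + 1) * (8 + ccost auction_body)) ?Q"
      by (rule 2[OF _ _ _ fr2]) (use P in \<open>auto simp: P_def word_const\<close>)
    show ?thesis
      unfolding Seqs.simps by (rule runs_mono[OF runs_seq_sem[OF _ runs_seq_sem[OF _ w]]]) auto
  qed
  show ?thesis
    unfolding auction_def Seqs.simps(3)[of "for_loop _ _ _"]
    by (rule runs_mono[OF runs_seq[OF 1 3]]) (auto simp: auction_body_def)
qed

section \<open>Search and augmentation\<close>

text \<open>\<open>vis b\<close> is the queue length when \<open>b\<close> was discovered, hence also the queue position of the owner
  of \<open>b\<close>; it decreases along the augmenting path.\<close>

definition search_inv ::
  "(nat \<times> nat) set \<Rightarrow> (nat \<Rightarrow> nat) \<Rightarrow> (nat \<Rightarrow> nat) \<Rightarrow> (nat \<Rightarrow> nat) \<Rightarrow> (nat \<Rightarrow> nat) \<Rightarrow> (nat \<Rightarrow> nat) \<Rightarrow> nat \<Rightarrow> bool" where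
  "search_inv G own vis par pre Q tail \<longleftrightarrow> inj_on Q {..<tail} \<and> (\<forall>j<tail. Q j < n)
     \<and> (\<forall>a<n. (\<forall>b<n. own b \<noteq> Suc a) \<longrightarrow> (\<exists>j<tail. Q j = a))
     \<and> (\<forall>b<n. vis b \<noteq> 0 \<longrightarrow> (\<exists>j<vis b. Q j = par b) \<and> vis b \<le> tail \<and> (par b, b) \<in> G \<and>
          (own b \<noteq> 0 \<longrightarrow> vis b < tail \<and> own b = Suc (Q (vis b))))
     \<and> (\<forall>j<tail. pre (Q j) = 0 \<and> (\<forall>b<n. own b \<noteq> Suc (Q j)) \<or>
          (\<exists>b<n. pre (Q j) = Suc b \<and> vis b = j \<and> 0 < j \<and> own b = Suc (Q j)))"

text \<open>Progress of the scan, kept apart from \<open>search_inv\<close>, which records the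
  structure read when the path is traversed.\<close>

definition scan_inv ::
  "(nat \<times> nat) set \<Rightarrow> (nat \<Rightarrow> nat) \<Rightarrow> (nat \<Rightarrow> nat) \<Rightarrow> (nat \<Rightarrow> nat) \<Rightarrow> (nat \<Rightarrow> nat) \<Rightarrow> nat \<Rightarrow> nat \<Rightarrow> nat \<Rightarrow> nat \<Rightarrow> bool" where
  "scan_inv G nb own vis Q tail head idx found \<longleftrightarrow> head \<le> tail
     \<and> (\<forall>j<head. \<forall>b. (Q j, b) \<in> G \<longrightarrow> vis b \<noteq> 0)
     \<and> (head < tail \<longrightarrow> idx \<le> deg (Q head) \<and>
          (\<forall>i<idx. (Q head, nb (Q head * n + i)) \<in> G \<longrightarrow> vis (nb (Q head * n + i)) \<noteq> 0))
     \<and> (head = tail \<longrightarrow> idx = 0)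
     \<and> (found = 0 \<longrightarrow> (\<forall>b<n. vis b \<noteq> 0 \<longrightarrow> own b \<noteq> 0))
     \<and> (\<forall>b. found = Suc b \<longrightarrow> b < n \<and> vis b \<noteq> 0 \<and> own b = 0)"

lemma search_tail_le:
  assumes "search_inv G own vis par pre Q tail" shows "tail \<le> n"
proof -
  have "inj_on Q {..<tail}" "Q ` {..<tail} \<subseteq> {..<n}"
    using assms unfolding search_inv_def by auto
  then show ?thesis using card_inj_on_le[of Q "{..<tail}" "{..<n}"] by simp
qed

text \<open>An agent costs one step per list position and one for moving on. Queue entries are
  distinct, so the degrees sum to at most m.\<close>

lemma search_progress:
  assumes inv: "search_inv G own vis par pre Q tail" and "head < tail" "idx \<le> deg (Q head)"
  shows "(\<Sum>j<head. deg (Q j) + 1) + idx < length es + n"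
proof -
  have inj: "inj_on Q {..<Suc head}" and sub: "Q ` {..<Suc head} \<subseteq> {..<n}"
    using inv assms(2) unfolding search_inv_def by (auto intro: inj_on_subset)
  have "(\<Sum>j<head. deg (Q j) + 1) + idx < (\<Sum>j<Suc head. deg (Q j) + 1)"
    using assms(3) by simp
  also have "\<dots> = (\<Sum>a\<in>Q ` {..<Suc head}. deg a + 1)"
    by (simp only: sum.reindex[OF inj] comp_def)
  also have "\<dots> \<le> (\<Sum>a<n. deg a + 1)" using sub by (intro sum_mono2) auto
  also have "\<dots> = (\<Sum>a<n. deg a) + n" by (simp only: sum.distrib) simp
  also have "\<dots> = length es + n" by (simp only: sum_deg)
  finally show ?thesis .
qed

lemma discover_free:
  assumes inv: "search_inv G own vis par pre Q tail" and h: "head < tail"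
    and c: "(Q head, c) \<in> G" "vis c = 0" "own c = 0"
  shows "search_inv G own (vis(c := tail)) (par(c := Q head)) pre Q tail"
proof -
  show ?thesis
    unfolding search_inv_def
  proof (intro conjI allI impI)
    show "inj_on Q {..<tail}" using inv by (simp add: search_inv_def)
    show "Q j < n" if "j < tail" for j using inv that by (simp add: search_inv_def)
    show "\<exists>j<tail. Q j = a" if "a < n" "\<forall>b<n. own b \<noteq> Suc a" for a
      using inv that by (simp add: search_inv_def)
  next
    fix b assume b: "b < n" "(vis(c := tail)) b \<noteq> 0"
    show "\<exists>j<(vis(c := tail)) b. Q j = (par(c := Q head)) b"
      using inv b h by (auto simp: search_inv_def)
    show "(vis(c := tail)) b \<le> tail" using inv b by (auto simp: search_inv_def)
    show "((par(c := Q head)) b, b) \<in> G" using inv b c(1) by (auto simp: search_inv_def)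
    assume o: "own b \<noteq> 0"
    then have bc: "b \<noteq> c" using c(3) by auto
    show "(vis(c := tail)) b < tail" using inv b o bc by (auto simp: search_inv_def)
    show "own b = Suc (Q ((vis(c := tail)) b))" using inv b o bc by (auto simp: search_inv_def)
  next
    fix j assume j: "j < tail"
    have "pre (Q j) = 0 \<and> (\<forall>b<n. own b \<noteq> Suc (Q j)) \<or>
        (\<exists>b<n. pre (Q j) = Suc b \<and> vis b = j \<and> 0 < j \<and> own b = Suc (Q j))"
      using inv j unfolding search_inv_def by blast
    then show "pre (Q j) = 0 \<and> (\<forall>b<n. own b \<noteq> Suc (Q j)) \<or>
        (\<exists>b<n. pre (Q j) = Suc b \<and> (vis(c := tail)) b = j \<and> 0 < j \<and> own b = Suc (Q j))"
      using c(2) by (metis fun_upd_other less_numeral_extra(3))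
  qed
qed

lemma discover_owned:
  assumes M: "matching G (assigned own)" and G: "G \<subseteq> E"
    and inv: "search_inv G own vis par pre Q tail" and h: "head < tail"
    and c: "(Q head, c) \<in> G" "vis c = 0" "own c = Suc a"
  shows "search_inv G own (vis(c := tail)) (par(c := Q head)) (pre(a := Suc c)) (Q(tail := a)) (Suc tail)"
proof -
  have cn: "c < n" using c(1) G E_less by blast
  have an: "a < n" using M c(3) cn G E_less(1)[of a c] unfolding matching_assigned by blast
  have uniq: "b = c" if "b < n" "own b = Suc a" for b
    using M that cn c(3) unfolding matching_assigned by simp
  \<comment> \<open>A queued agent is a root, who owns nothing, or owns an object of positive
    discovery time; a owns \<open>c\<close>, whose time is still 0. Hence the queue stays
    injective.\<close>
  have new: "Q j \<noteq> a" if j: "j < tail" for j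
  proof
    assume "Q j = a"
    have "pre (Q j) = 0 \<and> (\<forall>b<n. own b \<noteq> Suc (Q j)) \<or>
        (\<exists>b<n. pre (Q j) = Suc b \<and> vis b = j \<and> 0 < j \<and> own b = Suc (Q j))"
      using inv j unfolding search_inv_def by blast
    then show False using \<open>Q j = a\<close> cn c uniq by (metis less_numeral_extra(3))
  qed
  show ?thesis
    unfolding search_inv_def
  proof (intro conjI allI impI)
    have "inj_on (Q(tail := a)) {..<tail}"
      using inv by (auto simp: search_inv_def inj_on_def)
    then show "inj_on (Q(tail := a)) {..<Suc tail}"
      using new by (auto simp: lessThan_Suc)
    show "(Q(tail := a)) j < n" if "j < Suc tail" for j
      using inv that an by (auto simp: search_inv_def less_Suc_eq)
    fix d assume "d < n" "\<forall>b<n. own b \<noteq> Suc d"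
    then obtain j where "j < tail" "Q j = d" using inv unfolding search_inv_def by blast
    then show "\<exists>j<Suc tail. (Q(tail := a)) j = d" by (intro exI[of _ j]) auto
  next
    fix b assume b: "b < n" "(vis(c := tail)) b \<noteq> 0"
    show "\<exists>j<(vis(c := tail)) b. (Q(tail := a)) j = (par(c := Q head)) b"
    proof (cases "b = c")
      case True
      then show ?thesis using h by (intro exI[of _ head]) auto
    next
      case False
      then obtain j where "j < vis b" "Q j = par b" "vis b \<le> tail"
        using inv b unfolding search_inv_def by auto
      then show ?thesis using False by (intro exI[of _ j]) auto
    qed
    show "(vis(c := tail)) b \<le> Suc tail" using inv b by (fastforce simp: search_inv_def)
    show "((par(c := Q head)) b, b) \<in> G" using inv b c(1) by (auto simp: search_inv_def)
    assume o: "own b \<noteq> 0"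
    show "(vis(c := tail)) b < Suc tail" using inv b o by (fastforce simp: search_inv_def)
    show "own b = Suc ((Q(tail := a)) ((vis(c := tail)) b))"
      using inv b o c(3) by (fastforce simp: search_inv_def)
  next
    fix j assume j: "j < Suc tail"
    show "(pre(a := Suc c)) ((Q(tail := a)) j) = 0 \<and> (\<forall>b<n. own b \<noteq> Suc ((Q(tail := a)) j)) \<or>
        (\<exists>b<n. (pre(a := Suc c)) ((Q(tail := a)) j) = Suc b \<and> (vis(c := tail)) b = j \<and> 0 < j \<and>
          own b = Suc ((Q(tail := a)) j))"
    proof (cases "j = tail")
      case True
      then show ?thesis using cn c(3) h by auto
    next
      case False
      then have jt: "j < tail" using j by simp
      have "pre (Q j) = 0 \<and> (\<forall>b<n. own b \<noteq> Suc (Q j)) \<or>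
          (\<exists>b<n. pre (Q j) = Suc b \<and> vis b = j \<and> 0 < j \<and> own b = Suc (Q j))"
        using inv jt unfolding search_inv_def by blast
      then show ?thesis using False new[OF jt] c(2)
        by (simp only: fun_upd_other not_False_eq_True) (metis fun_upd_other less_numeral_extra(3))
    qed
  qed
qed

lemma scan_next_agent:
  assumes scan: "scan_inv G nb own vis Q tail head idx found" and h: "head < tail"
    and idx: "\<not> idx < deg (Q head)" and G: "G \<subseteq> E" and Q: "Q head < n"
    and nb: "\<And>a. a < n \<Longrightarrow> (\<lambda>i. nb (a * n + i)) ` {..<deg a} = nbrs E a"
  shows "scan_inv G nb own vis Q tail (Suc head) 0 found"
proof -
  have idx': "idx = deg (Q head)" using scan h idx by (simp add: scan_inv_def)
  have "vis b \<noteq> 0" if "(Q head, b) \<in> G" for b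
  proof -
    have "b \<in> nbrs E (Q head)" using that G by (auto simp: nbrs_def)
    then obtain i where "i < deg (Q head)" "b = nb (Q head * n + i)" using nb[OF Q] by auto
    then show ?thesis using scan h that idx' by (auto simp: scan_inv_def)
  qed
  then show ?thesis using scan h unfolding scan_inv_def by (auto simp: less_Suc_eq)
qed

lemma scan_skip:
  assumes "scan_inv G nb own vis Q tail head idx found" "head < tail" "idx < deg (Q head)"
    "\<not> ((Q head, nb (Q head * n + idx)) \<in> G \<and> vis (nb (Q head * n + idx)) = 0)"
  shows "scan_inv G nb own vis Q tail head (Suc idx) found"
  using assms unfolding scan_inv_def by (auto simp: less_Suc_eq)

text \<open>The time \<open>tail\<close> is positive because of \<open>head < tail\<close>, so it
  differs from 0, the mark of undiscovered objects.\<close>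

lemma scan_discover_free:
  assumes "scan_inv G nb own vis Q tail head idx 0" "head < tail" "idx < deg (Q head)"
    "c = nb (Q head * n + idx)" "c < n" "own c = 0"
  shows "scan_inv G nb own (vis(c := tail)) Q tail head (Suc idx) (Suc c)"
  using assms unfolding scan_inv_def by (auto simp: less_Suc_eq)

lemma scan_discover_owned:
  assumes "scan_inv G nb own vis Q tail head idx 0" "head < tail" "idx < deg (Q head)"
    "c = nb (Q head * n + idx)" "c < n" "own c = Suc a"
  shows "scan_inv G nb own (vis(c := tail)) (Q(tail := a)) (Suc tail) head (Suc idx) 0"
  using assms unfolding scan_inv_def by (auto simp: less_Suc_eq)

text \<open>The trace of a failed search, in the shape that the strict inequality between levels and
  certificates consumes: the set has all free objects, and every agent with a level edge into it is
  matched into it.\<close>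

definition blocked :: "(nat \<times> nat) set \<Rightarrow> (nat \<Rightarrow> nat) \<Rightarrow> bool" where
  "blocked G own \<longleftrightarrow> (\<exists>R \<subseteq> {..<n}. (\<forall>b<n. own b = 0 \<longrightarrow> b \<in> R) \<and>
     (\<forall>a c. (a, c) \<in> G \<longrightarrow> c \<in> R \<longrightarrow> (\<exists>d\<in>R. (a, d) \<in> assigned own)))"

text \<open>Take the undiscovered objects. An agent with a level edge to one of them was never
  queued. So she is matched, as free agents are roots, and her object is undiscovered, as its
  discovery would have queued her.\<close>

lemma exhausted_search_blocked:
  assumes inv: "search_inv G own vis par pre Q tail" and scan: "scan_inv G nb own vis Q tail tail idx 0"
    and G: "G \<subseteq> E"
  shows "blocked G own"
  unfolding blocked_def
proof (intro exI[of _ "{b. b < n \<and> vis b = 0}"] conjI allI impI)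
  fix b assume "b < n" "own b = 0"
  then show "b \<in> {b. b < n \<and> vis b = 0}" using scan by (auto simp: scan_inv_def)
next
  fix a c assume ac: "(a, c) \<in> G" "c \<in> {b. b < n \<and> vis b = 0}"
  have a: "a < n" using ac(1) G E_less by blast
  have notin: "Q j \<noteq> a" if "j < tail" for j
    using scan ac that unfolding scan_inv_def by blast
  then obtain d where d: "d < n" "own d = Suc a" using inv a unfolding search_inv_def by blast
  have "vis d = 0"
  proof (rule ccontr)
    assume "vis d \<noteq> 0"
    then have "vis d < tail" "own d = Suc (Q (vis d))" using inv d unfolding search_inv_def by auto
    then show False using notin[of "vis d"] d(2) by simp
  qed
  then show "\<exists>d\<in>{b. b < n \<and> vis b = 0}. (a, d) \<in> assigned own" using d by (auto simp: assigned_def)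
qed auto

text \<open>While the path is being traversed, the current object \<open>b\<close> is about to change hands and
  its recorded owner is ignored.\<close>

definition augment_inv ::
  "(nat \<times> nat) set \<Rightarrow> (nat \<Rightarrow> nat) \<Rightarrow> (nat \<Rightarrow> nat) \<Rightarrow> (nat \<Rightarrow> nat) \<Rightarrow> nat \<Rightarrow> bool" where
  "augment_inv G own0 vis own found \<longleftrightarrow>
     (found = 0 \<longrightarrow> matching G (assigned own) \<and>
        (\<exists>a. a \<notin> Domain (assigned own0) \<and> Domain (assigned own) = insert a (Domain (assigned own0))))
     \<and> (\<forall>b. found = Suc b \<longrightarrow> b < n \<and> vis b \<noteq> 0 \<and> matching G (assigned (own(b := 0))) \<and>
        Domain (assigned (own(b := 0))) = Domain (assigned own0) \<and>
        (\<forall>c<n. vis c \<noteq> 0 \<longrightarrow> vis c < vis b \<longrightarrow> own c = own0 c))"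

lemma assigned_upd: "b < n \<Longrightarrow> assigned (own(b := Suc a)) = insert (a, b) (assigned (own(b := 0)))"
  by (auto simp: assigned_def)

lemma augment_start:
  assumes "matching G (assigned own)" "scan_inv G nb own vis Q tail head idx found" "found \<noteq> 0"
  shows "augment_inv G own vis own found"
proof -
  obtain b where b: "found = Suc b" "b < n" "vis b \<noteq> 0" "own b = 0"
    using assms(2,3) by (cases found) (auto simp: scan_inv_def)
  then have "own(b := 0) = own" by auto
  then show ?thesis using assms(1) b by (simp add: augment_inv_def)
qed

text \<open>The pending object goes to the agent that discovered it. If she was a root, the path
  ends and the matched agents grow by her; otherwise her former object becomes pending. That object
  was discovered earlier, so its owner entry is still the original one.\<close>

lemma augment_step:
  assumes inv: "search_inv G own0 vis par pre Q tail" and aug: "augment_inv G own0 vis own (Suc b)"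
  shows "par b < n" "augment_inv G own0 vis (own(b := Suc (par b))) (pre (par b))"
    "pre (par b) \<noteq> 0 \<Longrightarrow> vis (pre (par b) - 1) < vis b"
proof -
  let ?a = "par b"
  have b: "b < n" "vis b \<noteq> 0" and M: "matching G (assigned (own(b := 0)))"
    and D: "Domain (assigned (own(b := 0))) = Domain (assigned own0)"
    and old: "\<And>c. c < n \<Longrightarrow> vis c \<noteq> 0 \<Longrightarrow> vis c < vis b \<Longrightarrow> own c = own0 c"
    using aug by (simp_all add: augment_inv_def)
  have G: "(?a, b) \<in> G" using inv b by (auto simp: search_inv_def)
  obtain j where j: "j < vis b" "Q j = ?a" "vis b \<le> tail" using inv b unfolding search_inv_def by blast
  then have jt: "j < tail" by simp
  then show "?a < n" using inv j(2) by (auto simp: search_inv_def)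
  have "pre (Q j) = 0 \<and> (\<forall>c<n. own0 c \<noteq> Suc (Q j)) \<or>
        (\<exists>c<n. pre (Q j) = Suc c \<and> vis c = j \<and> 0 < j \<and> own0 c = Suc (Q j))"
    using inv jt unfolding search_inv_def by blast
  note pre = this[unfolded j(2)]
  then show "vis (pre ?a - 1) < vis b" if "pre ?a \<noteq> 0"
    using that j(1) by auto
  from pre show "augment_inv G own0 vis (own(b := Suc ?a)) (pre ?a)"
  proof (elim disjE exE conjE)
    assume pre: "pre ?a = 0" and free: "\<forall>c<n. own0 c \<noteq> Suc ?a"
    have fr: "?a \<notin> Domain (assigned own0)" using free by (auto simp: assigned_def)
    then have "?a \<notin> Domain (assigned (own(b := 0)))" using D by simp
    moreover have "b \<notin> Range (assigned (own(b := 0)))" by (auto simp: assigned_def)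
    ultimately have "matching G (insert (?a, b) (assigned (own(b := 0))))"
      using M G unfolding matching_def by blast
    then show ?thesis
      using fr D by (simp add: augment_inv_def pre assigned_upd[OF b(1)]) blast
  next
    fix c assume c: "c < n" "pre ?a = Suc c" "vis c = j" "0 < j" "own0 c = Suc ?a"
    have cb: "c \<noteq> b" using c(3) j(1) by auto
    have oc: "own c = Suc ?a" using old[OF c(1)] c j(1) by simp
    let ?own = "(own(b := Suc ?a))(c := 0)"
    have inj: "\<And>d d'. d < n \<Longrightarrow> d' < n \<Longrightarrow> (own(b := 0)) d \<noteq> 0 \<Longrightarrow> (own(b := 0)) d = (own(b := 0)) d' \<Longrightarrow> d = d'"
      and GG: "\<And>d x. d < n \<Longrightarrow> (own(b := 0)) d = Suc x \<Longrightarrow> (x, d) \<in> G"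
      using M unfolding matching_assigned by blast+
    \<comment> \<open>Besides b, only c can name this agent as owner, and c is the object being
      released.\<close>
    have only: "d = c" if "d < n" "d \<noteq> b" "own d = Suc ?a" for d
      using inj[of d c] that c(1) cb oc by simp
    have "matching G (assigned ?own)"
      unfolding matching_assigned
    proof (intro conjI allI impI)
      fix d x assume "d < n" "?own d = Suc x"
      then show "(x, d) \<in> G" using G GG[of d x] by (auto split: if_splits)
    next
      fix d d' assume d: "d < n" "d' < n" "?own d \<noteq> 0" "?own d = ?own d'"
      then have "d \<noteq> c" "d' \<noteq> c" by auto
      then have eq: "(own(b := Suc ?a)) d = (own(b := Suc ?a)) d'" and nz: "(own(b := Suc ?a)) d \<noteq> 0"
        using d(3,4) by simp_all
      show "d = d'"
      proof (rule ccontr)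
        assume ne: "d \<noteq> d'"
        then consider "d = b" "d' \<noteq> b" | "d' = b" "d \<noteq> b" | "d \<noteq> b" "d' \<noteq> b" by blast
        then show False
        proof cases
          case 1
          then show False using eq only[OF d(2)] \<open>d' \<noteq> c\<close> by simp
        next
          case 2
          then show False using eq only[OF d(1)] \<open>d \<noteq> c\<close> by simp
        next
          case 3
          then show False using inj[OF d(1,2)] eq nz ne by simp
        qed
      qed
    qed
    moreover have "Domain (assigned ?own) = Domain (assigned (own(b := 0)))"
    proof (intro subset_antisym subsetI)
      fix x assume "x \<in> Domain (assigned ?own)"
      then obtain d where "d < n" "?own d = Suc x" by (auto simp: assigned_def)
      then show "x \<in> Domain (assigned (own(b := 0)))"
        using oc c(1) cb by (cases "d = b") (auto simp: assigned_def split: if_splits)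
    next
      fix x assume "x \<in> Domain (assigned (own(b := 0)))"
      then obtain d where "d < n" "d \<noteq> b" "own d = Suc x" by (auto simp: assigned_def split: if_splits)
      then show "x \<in> Domain (assigned ?own)"
        using oc b(1) cb by (cases "d = c") (auto simp: assigned_def)
    qed
    ultimately show ?thesis
      using c old cb j(1) D by (auto simp: augment_inv_def)
  qed
qed

lemma card_assigned: "matching G (assigned own) \<Longrightarrow> card (assigned own) = card (Domain (assigned own))"
proof -
  assume M: "matching G (assigned own)"
  have "inj_on fst (assigned own)" using M unfolding inj_on_def matching_def by fastforce
  then show ?thesis by (simp add: Domain_fst card_image)
qed

lemma finite_assigned: "matching G (assigned own) \<Longrightarrow> G \<subseteq> E \<Longrightarrow> finite (assigned own)"
  using finite_E finite_subset[of "assigned own" E] by (auto simp: matching_def)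

section \<open>Running the search and the augmentation\<close>

lemma search_body_step:
  assumes s: "graph_arrays s'" and g: "level_matrix {..<n} l (arrs s' 8)"
    and G: "G = level_edges E pref l" and own: "own = arrs s' 10" and M: "matching G (assigned own)"
    and inv: "search_inv G own (arrs s' 12) (arrs s' 13) (arrs s' 14) (arrs s' 15) (regs s' 12)"
    and scan: "scan_inv G (arrs s' 5) own (arrs s' 12) (arrs s' 15) (regs s' 12) (regs s' 11) (regs s' 13) (regs s' 14)"
    and h: "regs s' 11 < regs s' 12" and nf: "regs s' 14 = 0"
  defines "t \<equiv> sem W search_body s'"
  defines "\<mu> \<equiv> \<lambda>s :: state. length es + n - ((\<Sum>j<regs s 11. deg (arrs s 15 j) + 1) + regs s 13)"
  shows "search_inv G own (arrs t 12) (arrs t 13) (arrs t 14) (arrs t 15) (regs t 12) \<and>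
    scan_inv G (arrs s' 5) own (arrs t 12) (arrs t 15) (regs t 12) (regs t 11) (regs t 13) (regs t 14) \<and>
    \<mu> t < \<mu> s'"
proof -
  let ?vis = "arrs s' 12" and ?par = "arrs s' 13" and ?pre = "arrs s' 14" and ?Q = "arrs s' 15"
  let ?head = "regs s' 11" and ?tail = "regs s' 12" and ?idx = "regs s' 13"
  have GE: "G \<subseteq> E" by (auto simp: G level_edges_def)
  have nb: "(\<lambda>i. arrs s' 5 (a * n + i)) ` {..<deg a} = nbrs E a" if "a < n" for a
    using s that by (simp add: graph_arrays_def)
  define a where "a = ?Q ?head"
  have a: "a < n" using inv h unfolding a_def search_inv_def by blast
  have tail: "?tail \<le> n" by (rule search_tail_le[OF inv])
  have idx: "?idx \<le> deg a" using scan h by (simp add: scan_inv_def a_def)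
  have prog: "(\<Sum>j<?head. deg (?Q j) + 1) + ?idx < length es + n"
    using search_progress[OF inv h] idx by (simp add: a_def)
  have reg: "regs s' 0 = n" "arrs s' 6 a = deg a" using s a by (simp_all add: graph_arrays_def)
  have gd: "arrs s' 8 (a * n + b) = of_bool ((a, b) \<in> G)" if "b < n" for b
    using g a that by (simp add: level_matrix_def G)
  have degn: "deg a \<le> n" by (rule deg_le)
  show ?thesis
  proof (cases "?idx < deg a")
    case False
    have t: "arrs t = arrs s'" "regs t 11 = Suc ?head" "regs t 12 = ?tail" "regs t 13 = 0" "regs t 14 = 0"
      using False h tail nf
      by (simp_all add: t_def search_body_def reg a_def[symmetric] word_const word_small)
    have "\<not> ?idx < deg (?Q ?head)" "?Q ?head < n" using False a by (simp_all add: a_def)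
    from scan_next_agent[OF scan h this(1) GE this(2) nb] show ?thesis
      using inv prog idx nf h by (simp add: t \<mu>_def a_def[symmetric])
  next
    case True
    define c where "c = arrs s' 5 (a * n + ?idx)"
    have "c \<in> nbrs E a" using nb[OF a] True unfolding c_def by blast
    then have c: "c < n" using E_less by (auto simp: nbrs_def)
    have idxn: "?idx < n" using True degn by simp
    have idxQ: "?idx < deg (?Q ?head)" and cQ: "c = arrs s' 5 (?Q ?head * n + ?idx)"
      using True by (simp_all add: a_def c_def)
    have scan0: "scan_inv G (arrs s' 5) own ?vis ?Q ?tail ?head ?idx 0" using scan nf by simp
    note simps = t_def search_body_def reg a_def[symmetric] c_def[symmetric] word_const word_small
      word_row word_pair True gd nf
    show ?thesis
    proof (cases "(a, c) \<in> G \<and> ?vis c = 0")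
      case False
      have t: "arrs t = arrs s'" "regs t 11 = ?head" "regs t 12 = ?tail" "regs t 13 = Suc ?idx" "regs t 14 = 0"
        using False a c idxn by (auto simp: simps)
      show ?thesis
        using scan_skip[OF scan0 h idxQ] False inv prog
        by (auto simp: t \<mu>_def a_def[symmetric] c_def[symmetric])
    next
      case new: True
      then have ac: "(?Q ?head, c) \<in> G" "?vis c = 0" by (simp_all add: a_def)
      show ?thesis
      proof (cases "own c")
        case 0
        have t: "arrs t = (arrs s')(12 := ?vis(c := ?tail), 13 := ?par(c := a))"
          "regs t 11 = ?head" "regs t 12 = ?tail" "regs t 13 = Suc ?idx" "regs t 14 = Suc c"
          using new 0 own a c idxn by (auto simp: simps)
        show ?thesis
          using discover_free[OF inv h ac 0] scan_discover_free[OF scan0 h idxQ cQ c 0] prog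
          by (simp add: t \<mu>_def a_def[symmetric])
      next
        case (Suc a')
        have a': "a' < n" using M c Suc GE E_less(1)[of a' c] unfolding matching_assigned by blast
        have t: "arrs t = (arrs s')(12 := ?vis(c := ?tail), 13 := ?par(c := a),
             15 := ?Q(?tail := a'), 14 := ?pre(a' := Suc c))"
          "regs t 11 = ?head" "regs t 12 = Suc ?tail" "regs t 13 = Suc ?idx" "regs t 14 = 0"
          using new Suc own a' tail a c idxn by (auto simp: simps)
        have "(\<Sum>j<?head. deg ((?Q(?tail := a')) j) + 1) = (\<Sum>j<?head. deg (?Q j) + 1)"
          using h by (intro sum.cong) auto
        then show ?thesis
          using discover_owned[OF M GE inv h ac Suc] scan_discover_owned[OF scan0 h idxQ cQ c Suc] prog
          by (simp add: t \<mu>_def a_def[symmetric])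
      qed
    qed
  qed
qed

lemma search_spec:
  assumes s: "graph_arrays s" and g: "level_matrix {..<n} l (arrs s 8)"
    and G: "G = level_edges E pref l" and own: "own = arrs s 10" and M: "matching G (assigned own)"
  shows "runs W search s (200 * (length es + n + 1))
    (\<lambda>s'. (\<exists>tail. search_inv G own (arrs s' 12) (arrs s' 13) (arrs s' 14) (arrs s' 15) tail) \<and>
      (if regs s' 14 = 0 then blocked G own else augment_inv G own (arrs s' 12) own (regs s' 14)))"
    (is "runs W search s _ ?Q")
proof -
  have n0: "regs s 0 = n" using s by (simp add: graph_arrays_def)
  have GE: "G \<subseteq> E" by (auto simp: G level_edges_def)
  have ownn: "own b \<le> n" if "b < n" for b
  proof (cases "own b")
    case (Suc a)
    then show ?thesis using M that GE E_less(1)[of a b] unfolding matching_assigned by (auto simp: Suc_le_eq)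
  qed simp
  let ?clear = "Seqs [Store 12 (Reg 3) (Num 0), Store 14 (Reg 3) (Num 0), Store 16 (Add (Reg 3) (Num 1)) (Num 0)]"
  let ?mark = "Store 16 (Cell 10 (Reg 3)) (Num 1)"
  let ?root = "Cond (Equal (Cell 16 (Add (Reg 3) (Num 1))) (Num 0))
        (Seqs [Store 15 (Reg 12) (Reg 3), Inc 12]) Skip"
  let ?b = "Conj (Less (Reg 11) (Reg 12)) (Equal (Reg 14) (Num 0))"
  define P1 where "P1 j s' \<longleftrightarrow> (\<forall>i<j. arrs s' 12 i = 0 \<and> arrs s' 14 i = 0 \<and> arrs s' 16 (Suc i) = 0)"
    for j and s' :: state
  have 1: "runs W (for_loop 3 0 ?clear) s ((n + 2) * (ccost ?clear + 8)) (P1 n)"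
  proof (rule runs_for_loop)
    fix j s' assume "j < n" "regs s' 3 = j" "P1 j s'"
    then show "runs W ?clear s' (ccost ?clear) (P1 (Suc j))"
      by (intro runs_sem) (auto simp: P1_def word_const word_small less_Suc_eq)
  qed (use n0 n_less_W in \<open>auto simp: P1_def\<close>)
  \<comment> \<open>Owner codes serve directly as addresses: slot 0 absorbs the marks of unowned
    objects, and slot \<open>Suc i\<close> tells whether agent i owns one.\<close>
  define P2 where "P2 j s' \<longleftrightarrow> (\<forall>i<n. arrs s' 12 i = 0 \<and> arrs s' 14 i = 0 \<and>
      (arrs s' 16 (Suc i) = 0 \<longleftrightarrow> (\<forall>b<j. own b \<noteq> Suc i)))" for j and s' :: state
  have 2: "runs W (for_loop 3 0 ?mark) s1 ((n + 2) * (ccost ?mark + 8)) (P2 n)"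
    if P: "P1 n s1" and fr: "framed (for_loop 3 0 ?clear) s s1" for s1
  proof (rule runs_for_loop)
    fix j s' assume j: "j < n" "regs s' 3 = j" "P2 j s'" and fr': "framed (for_loop 3 0 ?mark) s1 s'"
    have "arrs s' 10 = own" using fr fr' own by (simp add: same_except_def)
    then show "runs W ?mark s' (ccost ?mark) (P2 (Suc j))"
      using j by (intro runs_sem) (auto simp: P2_def word_const less_Suc_eq)
  next
    show "regs s1 0 = n" using fr n0 by (simp add: same_except_def)
  qed (use n_less_W P in \<open>auto simp: P1_def P2_def\<close>)
  define P3 where "P3 j s' \<longleftrightarrow> regs s' 12 \<le> j \<and> inj_on (arrs s' 15) {..<regs s' 12} \<and>
      arrs s' 15 ` {..<regs s' 12} = {i. i < j \<and> (\<forall>b<n. own b \<noteq> Suc i)}" for j and s' :: state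
  have 3: "runs W (for_loop 3 0 ?root) s2 ((n + 2) * (ccost ?root + 8)) (P3 n)"
    if P: "P2 n s2" and fr: "same_except {3, 12} {12, 14, 16} s s2" and z: "regs s2 12 = 0" for s2
  proof (rule runs_for_loop)
    fix j s' assume j: "j < n" "regs s' 3 = j" "P3 j s'" and fr': "framed (for_loop 3 0 ?root) s2 s'"
    have eq: "arrs s' 16 (Suc j) = 0 \<longleftrightarrow> (\<forall>b<n. own b \<noteq> Suc j)"
      using fr' P j by (simp add: same_except_def P2_def)
    let ?k = "regs s' 12" and ?Q = "arrs s' 15"
    have "P3 (Suc j) (sem W ?root s')"
    proof (cases "\<forall>b<n. own b \<noteq> Suc j")
      case True
      have t: "arrs (sem W ?root s') 15 = ?Q(?k := j)" "regs (sem W ?root s') 12 = Suc ?k"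
        using True eq j by (simp_all add: word_const word_small P3_def)
      have img: "?Q(?k := j) ` {..<Suc ?k} = insert j (?Q ` {..<?k})"
        by (auto simp: lessThan_Suc)
      have "inj_on (?Q(?k := j)) {..<Suc ?k}"
        using j(3) by (auto simp: P3_def lessThan_Suc inj_on_def)
      then show ?thesis
        using j True unfolding P3_def t img by (auto simp: less_Suc_eq)
    next
      case False
      then have "arrs s' 16 (Suc j) \<noteq> 0" using eq by blast
      then have t: "sem W ?root s' = s'"
        using j by (simp add: word_const word_small)
      show ?thesis unfolding t using j False by (auto simp: P3_def less_Suc_eq)
    qed
    then show "runs W ?root s' (ccost ?root) (P3 (Suc j))" by (intro runs_sem) auto
  next
    show "regs s2 0 = n" using fr n0 by (simp add: same_except_def)
  qed (use n_less_W z in \<open>auto simp: P3_def\<close>)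
  define I where "I s' \<longleftrightarrow>
    search_inv G own (arrs s' 12) (arrs s' 13) (arrs s' 14) (arrs s' 15) (regs s' 12) \<and>
    scan_inv G (arrs s' 5) own (arrs s' 12) (arrs s' 15) (regs s' 12) (regs s' 11) (regs s' 13) (regs s' 14)"
    for s' :: state
  define \<mu> where "\<mu> s' = length es + n - ((\<Sum>j<regs s' 11. deg (arrs s' 15 j) + 1) + regs s' 13)"
    for s' :: state
  have 4: "runs W (While ?b search_body) s4 ((length es + n + 1) * (1 + bcost ?b + ccost search_body)) ?Q"
    if I: "I s4" and fr: "same_except {3, 11, 12, 13, 14} {12, 14, 15, 16} s s4" for s4
  proof (rule runs_mono[OF runs_while[where I = I and \<mu> = \<mu> and T = "ccost search_body"]])
    fix s' assume I: "I s'" and b: "bval W ?b s'" and fr': "framed search_body s4 s'"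
    have f: "same_except {3, 5, 8, 9, 11, 12, 13, 14} {12, 13, 14, 15, 16} s s'"
      by (rule same_except_trans[OF fr fr']) (auto simp: search_body_def)
    have s': "graph_arrays s'" by (rule graph_arrays_frame[OF s f]) auto
    have g': "level_matrix {..<n} l (arrs s' 8)" and own': "own = arrs s' 10"
      using same_exceptD(2)[OF f] g own by simp_all
    have b': "regs s' 11 < regs s' 12" "regs s' 14 = 0" using b by (simp_all add: word_const)
    have lf: "loop_free search_body" by (simp add: search_body_def)
    have eq: "arrs (sem W search_body s') 5 = arrs s' 5"
    proof -
      obtain t where "exec W search_body s' t (sem W search_body s')" using exec_sem[OF lf] by blast
      from same_exceptD(2)[OF exec_framed[OF this], of 5] show ?thesis by (simp add: search_body_def)
    qed
    note I' = I[unfolded I_def, THEN conjunct1] I[unfolded I_def, THEN conjunct2]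
    have "I (sem W search_body s') \<and> \<mu> (sem W search_body s') < \<mu> s'"
      using search_body_step[OF s' g' G own' M I' b'] unfolding I_def \<mu>_def eq by blast
    then show "runs W search_body s' (ccost search_body) (\<lambda>s''. I s'' \<and> \<mu> s'' < \<mu> s')"
      using lf by (intro runs_sem) auto
  next
    fix s' assume *: "I s' \<and> \<not> bval W ?b s'"
    show "?Q s'"
    proof (cases "regs s' 14 = 0")
      case True
      then have "regs s' 11 = regs s' 12" using * by (auto simp: I_def scan_inv_def word_const)
      then have "blocked G own"
        using * True exhausted_search_blocked[OF _ _ GE] unfolding I_def by metis
      then show ?thesis using * True by (auto simp: I_def)
    next
      case False
      then show ?thesis using * augment_start[OF M] unfolding I_def by auto
    qed
  next
    show "(\<mu> s4 + 1) * (1 + bcost ?b + ccost search_body)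
        \<le> (length es + n + 1) * (1 + bcost ?b + ccost search_body)"
      by (intro mult_right_mono) (simp_all add: \<mu>_def)
  qed (rule I)
  have 5: "runs W (Seqs [Assign 11 (Num 0), Assign 13 (Num 0), Assign 14 (Num 0), While ?b search_body]) s3
      (6 + (length es + n + 1) * (1 + bcost ?b + ccost search_body)) ?Q"
    if P: "P3 n s3" and P2: "P2 n s3" and fr: "same_except {3, 12} {12, 14, 15, 16} s s3" for s3
  proof -
    let ?s4 = "sem W (Assign 14 (Num 0)) (sem W (Assign 13 (Num 0)) (sem W (Assign 11 (Num 0)) s3))"
    have fr4: "same_except {3, 11, 12, 13, 14} {12, 14, 15, 16} s ?s4"
      using fr by (auto simp: same_except_def)
    have "\<exists>j<regs s3 12. arrs s3 15 j = a" if "a < n" "\<forall>b<n. own b \<noteq> Suc a" for a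
    proof -
      have "a \<in> arrs s3 15 ` {..<regs s3 12}" using P that by (simp add: P3_def)
      then show ?thesis by auto
    qed
    moreover have "arrs s3 15 j < n \<and> (\<forall>b<n. own b \<noteq> Suc (arrs s3 15 j))" if "j < regs s3 12" for j
    proof -
      have "arrs s3 15 j \<in> arrs s3 15 ` {..<regs s3 12}" using that by simp
      then show ?thesis using P by (simp add: P3_def)
    qed
    ultimately have I: "I ?s4" using P P2
      by (simp add: I_def word_const search_inv_def scan_inv_def P2_def P3_def)
    show ?thesis
      unfolding Seqs.simps
      by (rule runs_mono[OF runs_seq_sem[OF _ runs_seq_sem[OF _ runs_seq_sem[OF _ 4[OF I fr4]]]]]) auto
  qed
  have 6: "runs W (Seq (Assign 12 (Num 0)) (Seq (for_loop 3 0 ?root)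
        (Seqs [Assign 11 (Num 0), Assign 13 (Num 0), Assign 14 (Num 0), While ?b search_body]))) s2
      (2 + ((n + 2) * (ccost ?root + 8) + (6 + (length es + n + 1) * (1 + bcost ?b + ccost search_body)))) ?Q"
    if P: "P2 n s2" and fr: "same_except {3} {12, 14, 16} s s2" for s2
  proof -
    let ?s3 = "sem W (Assign 12 (Num 0)) s2"
    have P': "P2 n ?s3" using P by (simp add: P2_def)
    have fr': "same_except {3, 12} {12, 14, 16} s ?s3" using fr by (auto simp: same_except_def)
    have r: "runs W (for_loop 3 0 ?root) ?s3 ((n + 2) * (ccost ?root + 8)) (P3 n)"
      by (rule 3[OF P' fr']) (simp add: word_const)
    show ?thesis
    proof (rule runs_mono[OF runs_seq_sem[OF _ runs_seq[OF r 5]]])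
      fix s4 assume f: "framed (for_loop 3 0 ?root) ?s3 s4"
      show "same_except {3, 12} {12, 14, 15, 16} s s4"
        by (rule same_except_trans[OF fr' f]) auto
      show "P2 n s4" using P' f by (simp add: P2_def same_except_def)
    qed auto
  qed
  have 7: "runs W search s ((n + 2) * (ccost ?clear + 8) + ((n + 2) * (ccost ?mark + 8) + 
      (2 + ((n + 2) * (ccost ?root + 8) + (6 + (length es + n + 1) * (1 + bcost ?b + ccost search_body)))))) ?Q"
    unfolding search_def Seqs.simps(3)[of "for_loop _ _ _"] Seqs.simps(3)[of "Assign 12 _"]
  proof (rule runs_seq[OF 1 runs_seq[OF 2 6]])
    fix s1 s2 assume f1: "framed (for_loop 3 0 ?clear) s s1" and f2: "framed (for_loop 3 0 ?mark) s1 s2"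
    show "same_except {3} {12, 14, 16} s s2"
      by (rule same_except_trans[OF f1 f2]) auto
  qed auto
  show ?thesis by (rule runs_mono[OF 7]) (auto simp: search_body_def)
qed

lemma augment_spec:
  assumes inv: "search_inv G own0 (arrs s 12) (arrs s 13) (arrs s 14) (arrs s 15) tail"
    and aug: "augment_inv G own0 (arrs s 12) (arrs s 10) (regs s 14)"
  shows "runs W augment s (30 * (n + 1)) (\<lambda>s'. matching G (assigned (arrs s' 10)) \<and>
    (\<exists>a. a \<notin> Domain (assigned own0) \<and> Domain (assigned (arrs s' 10)) = insert a (Domain (assigned own0))))"
proof -
  let ?b = "Neg (Equal (Reg 14) (Num 0))"
  \<comment> \<open>The discovery time of the pending object bounds the rest of the path: it is at
    most the queue length, hence at most \<open>n\<close>, and drops at each step.\<close>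
  define \<mu> where "\<mu> s' = (if regs s' 14 = 0 then 0 else arrs s 12 (regs s' 14 - 1))" for s' :: state
  have vis: "arrs s 12 b \<le> n" if "b < n" for b
    using inv that search_tail_le[OF inv] unfolding search_inv_def by (cases "arrs s 12 b = 0") force+
  show ?thesis
    unfolding augment_def
  proof (rule runs_mono[OF runs_while[where \<mu> = \<mu> and T = "ccost augment_body" and
        I = "\<lambda>s'. augment_inv G own0 (arrs s 12) (arrs s' 10) (regs s' 14)"]])
    fix s' assume I: "augment_inv G own0 (arrs s 12) (arrs s' 10) (regs s' 14)"
      and b: "bval W ?b s'" and fr: "framed augment_body s s'"
    obtain b where b: "regs s' 14 = Suc b" using b by (cases "regs s' 14") (auto simp: word_const)
    have arr: "arrs s' 13 = arrs s 13" "arrs s' 14 = arrs s 14"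
      using fr by (auto simp: same_except_def augment_body_def)
    have bn: "b < n" "arrs s 12 b \<noteq> 0" using I b by (simp_all add: augment_inv_def)
    note st = augment_step[OF inv, of "arrs s' 10" b]
    have a: "arrs s 13 b < n" using st(1) I b by simp
    let ?t = "sem W augment_body s'"
    have t: "arrs ?t 10 = (arrs s' 10)(b := Suc (arrs s 13 b))" "regs ?t 14 = arrs s 14 (arrs s 13 b)"
      using a b by (simp_all add: augment_body_def arr word_const word_small)
    show "runs W augment_body s' (ccost augment_body) (\<lambda>s''.
      augment_inv G own0 (arrs s 12) (arrs s'' 10) (regs s'' 14) \<and> \<mu> s'' < \<mu> s')"
      using st(2,3) I b bn by (intro runs_sem) (auto simp: t \<mu>_def, simp_all add: augment_body_def)
  next
    fix s' assume "augment_inv G own0 (arrs s 12) (arrs s' 10) (regs s' 14) \<and> \<not> bval W ?b s'"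
    then show "matching G (assigned (arrs s' 10)) \<and>
      (\<exists>a. a \<notin> Domain (assigned own0) \<and> Domain (assigned (arrs s' 10)) = insert a (Domain (assigned own0)))"
      by (auto simp: augment_inv_def word_const)
  next
    have "\<mu> s \<le> n" using aug vis by (cases "regs s 14") (auto simp: \<mu>_def augment_inv_def)
    then have "(\<mu> s + 1) * (1 + bcost ?b + ccost augment_body) \<le> (n + 1) * (1 + bcost ?b + ccost augment_body)"
      by (intro mult_right_mono) auto
    also have "\<dots> \<le> 30 * (n + 1)" by (simp add: augment_body_def)
    finally show "(\<mu> s + 1) * (1 + bcost ?b + ccost augment_body) \<le> 30 * (n + 1)" .
  qed (rule aug)
qed

lemma improve_spec:
  assumes s: "graph_arrays s" and g: "level_matrix {..<n} l (arrs s 8)"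
    and G: "G = level_edges E pref l" and M: "matching G (assigned (arrs s 10))"
    and near: "\<And>N. matching G N \<Longrightarrow> card N \<le> card (assigned (arrs s 10)) + n div cap"
  shows "runs W improve s ((n div cap + 3) * (300 * (length es + n + 1)))
    (\<lambda>s'. matching G (assigned (arrs s' 10)) \<and> blocked G (arrs s' 10))"
proof -
  let ?b = "Equal (Reg 15) (Num 1)"
  let ?body = "Seq search (Seq (Cond (Equal (Reg 14) (Num 0)) (Assign 15 (Num 0)) Skip) augment)"
  let ?T = "200 * (length es + n + 1) + (6 + 30 * (n + 1))"
  have GE: "G \<subseteq> E" by (auto simp: G level_edges_def)
  define B where "B = card (assigned (arrs s 10)) + n div cap"
  define I where "I s' \<longleftrightarrow> matching G (assigned (arrs s' 10)) \<and>
    (regs s' 15 = 1 \<or> regs s' 15 = 0 \<and> blocked G (arrs s' 10))" for s' :: state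
  \<comment> \<open>No matching of level edges exceeds \<open>B\<close>, so at most
    \<open>n div cap\<close> searches succeed; register 15 accounts for the one that fails.\<close>
  define \<mu> where "\<mu> s' = B - card (assigned (arrs s' 10)) + regs s' 15" for s' :: state
  have step: "runs W ?body s' ?T (\<lambda>s''. I s'' \<and> \<mu> s'' < \<mu> s')"
    if I: "I s'" and b: "bval W ?b s'" and fr: "same_except {3, 5, 8, 9, 11, 12, 13, 14, 15} {10, 12, 13, 14, 15, 16} s s'"
    for s'
  proof -
    have s': "graph_arrays s'" by (rule graph_arrays_frame[OF s fr]) auto
    have g': "level_matrix {..<n} l (arrs s' 8)" using same_exceptD(2)[OF fr] g by simp
    let ?own = "arrs s' 10"
    have M': "matching G (assigned ?own)" using I by (simp add: I_def)
    have f15: "regs s' 15 = 1" using b by (simp add: word_const)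
    show ?thesis
    proof (rule runs_seq[OF search_spec[OF s' g' G refl M']])
      fix s1
      assume Q: "(\<exists>tail. search_inv G ?own (arrs s1 12) (arrs s1 13) (arrs s1 14) (arrs s1 15) tail) \<and>
          (if regs s1 14 = 0 then blocked G ?own else augment_inv G ?own (arrs s1 12) ?own (regs s1 14))"
        and f: "framed search s' s1"
      have o: "arrs s1 10 = ?own" "regs s1 15 = 1"
        using f f15 by (auto simp: same_except_def search_def search_body_def)
      show "runs W (Seq (Cond (Equal (Reg 14) (Num 0)) (Assign 15 (Num 0)) Skip) augment) s1
          (6 + 30 * (n + 1)) (\<lambda>s''. I s'' \<and> \<mu> s'' < \<mu> s')"
      proof (cases "regs s1 14 = 0")
        case True
        let ?s2 = "s1\<lparr>regs := (regs s1)(15 := 0)\<rparr>"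
        have "runs W augment ?s2 (30 * (n + 1)) (\<lambda>s''. I s'' \<and> \<mu> s'' < \<mu> s')"
          unfolding augment_def
        \<comment> \<open>After a failed search the guard is false at once. The body never runs,
          which allows the budget 0.\<close>
        proof (rule runs_mono[OF runs_while[where I = "\<lambda>s'. s' = ?s2" and \<mu> = "\<lambda>_. 0" and T = 0]])
          fix s'' assume "s'' = ?s2 \<and> \<not> bval W (Neg (Equal (Reg 14) (Num 0))) s''"
          then show "I s'' \<and> \<mu> s'' < \<mu> s'" using M' Q True f15 o by (simp add: I_def \<mu>_def)
        qed (use True in \<open>auto simp: word_const\<close>)
        then show ?thesis
          using True by (intro runs_mono[OF runs_seq_sem[where T = "30 * (n + 1)"]]) (auto simp: word_const)
      next
        case False
        then obtain tail where inv: "search_inv G ?own (arrs s1 12) (arrs s1 13) (arrs s1 14) (arrs s1 15) tail"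
          and aug: "augment_inv G ?own (arrs s1 12) (arrs s1 10) (regs s1 14)" using Q o by auto
        have "runs W augment s1 (30 * (n + 1)) (\<lambda>s''. I s'' \<and> \<mu> s'' < \<mu> s')"
        proof (rule runs_mono[OF augment_spec[OF inv aug]])
          fix s'' assume *: "matching G (assigned (arrs s'' 10)) \<and> (\<exists>a. a \<notin> Domain (assigned ?own) \<and>
              Domain (assigned (arrs s'' 10)) = insert a (Domain (assigned ?own)))"
            and f2: "framed augment s1 s''"
          have fin: "finite (Domain (assigned ?own))" using finite_assigned[OF M' GE] by (rule finite_Domain)
          have c: "card (assigned (arrs s'' 10)) = Suc (card (assigned ?own))"
            using * card_assigned M' fin by auto
          have le: "card (assigned (arrs s'' 10)) \<le> B" using near * by (simp add: B_def)
          have "regs s'' 15 = 1" using f2 o by (auto simp: same_except_def augment_def augment_body_def)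
          then show "I s'' \<and> \<mu> s'' < \<mu> s'" using * c le f15 by (simp add: I_def \<mu>_def)
        qed simp
        then show ?thesis
          using False by (intro runs_mono[OF runs_seq_sem[where T = "30 * (n + 1)"]]) (auto simp: word_const)
      qed
    qed
  qed
  let ?s1 = "sem W (Assign 15 (Num 1)) s"
  have fr1: "same_except {3, 5, 8, 9, 11, 12, 13, 14, 15} {10, 12, 13, 14, 15, 16} s ?s1"
    by (simp add: same_except_def)
  have w: "runs W (While ?b ?body) ?s1 ((n div cap + 2) * (1 + bcost ?b + ?T))
    (\<lambda>s'. matching G (assigned (arrs s' 10)) \<and> blocked G (arrs s' 10))"
  proof (rule runs_mono[OF runs_while[where I = I and \<mu> = \<mu> and T = ?T]])
    show "I ?s1" using M by (simp add: I_def word_const)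
    show "runs W ?body s' ?T (\<lambda>s''. I s'' \<and> \<mu> s'' < \<mu> s')"
      if "I s'" "bval W ?b s'" "framed ?body ?s1 s'" for s'
      by (rule step[OF that(1,2)], rule same_except_trans[OF fr1 that(3)])
        (auto simp: search_def search_body_def augment_def augment_body_def)
    have "\<mu> ?s1 = n div cap + 1" by (simp add: \<mu>_def B_def word_const)
    then show "(\<mu> ?s1 + 1) * (1 + bcost ?b + ?T) \<le> (n div cap + 2) * (1 + bcost ?b + ?T)" by simp
  qed (auto simp: I_def word_const)
  have r: "runs W improve s (2 + (n div cap + 2) * (1 + bcost ?b + ?T))
    (\<lambda>s'. matching G (assigned (arrs s' 10)) \<and> blocked G (arrs s' 10))"
    unfolding improve_def by (rule runs_mono[OF runs_seq_sem[OF _ w]]) auto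
  have "2 + (n div cap + 2) * (1 + bcost ?b + ?T) \<le> (n div cap + 3) * (1 + bcost ?b + ?T)"
    by (simp add: algebra_simps)
  also have "\<dots> \<le> (n div cap + 3) * (300 * (length es + n + 1))" by (intro mult_left_mono) auto
  finally show ?thesis by (rule runs_mono[OF r]) auto
qed

section \<open>Correctness and running time\<close>

lemma find_free_spec:
  assumes "regs s 0 = n"
  shows "runs W find_free s (30 * (n + 1)) (\<lambda>s'. regs s' 4 \<le> n \<and> (\<forall>b<regs s' 4. arrs s 10 b \<noteq> 0) \<and>
    (regs s' 4 < n \<longrightarrow> arrs s 10 (regs s' 4) = 0))"
proof -
  let ?b = "Conj (Less (Reg 4) (Reg 0)) (Neg (Equal (Cell 10 (Reg 4)) (Num 0)))"
  let ?s1 = "sem W (Assign 4 (Num 0)) s"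
  let ?I = "\<lambda>s'. regs s' 4 \<le> n \<and> (\<forall>b<regs s' 4. arrs s 10 b \<noteq> 0)"
  have w: "runs W (While ?b (Inc 4)) ?s1 ((n + 1) * (1 + bcost ?b + 4)) (\<lambda>s'. ?I s' \<and>
    (regs s' 4 < n \<longrightarrow> arrs s 10 (regs s' 4) = 0))"
  proof (rule runs_mono[OF runs_while[where I = ?I and \<mu> = "\<lambda>s. n - regs s 4" and T = 4]])
    show "?I ?s1" by (simp add: word_const)
    fix s' assume I: "?I s'" and b: "bval W ?b s'" and fr: "framed (Inc 4) ?s1 s'"
    have eq: "regs s' 0 = n" "arrs s' = arrs s"
      using fr assms by (auto simp: same_except_def)
    have lt: "regs s' 4 < n" "arrs s 10 (regs s' 4) \<noteq> 0" using b by (simp_all add: eq word_const)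
    have "Suc (regs s' 4) mod W = Suc (regs s' 4)" using lt(1) by (intro word_small) simp
    then show "runs W (Inc 4) s' 4 (\<lambda>s''. ?I s'' \<and> n - regs s'' 4 < n - regs s' 4)"
      using I lt by (intro runs_sem) (auto simp: word_const less_Suc_eq)
  next
    fix s' assume *: "?I s' \<and> \<not> bval W ?b s'" and fr: "framed (While ?b (Inc 4)) ?s1 s'"
    have "regs s' 0 = n" "arrs s' = arrs s"
      using fr assms by (auto simp: same_except_def)
    then show "?I s' \<and> (regs s' 4 < n \<longrightarrow> arrs s 10 (regs s' 4) = 0)"
      using * by (simp add: word_const)
  qed (simp add: word_const)
  show ?thesis
    unfolding find_free_def by (rule runs_mono[OF runs_seq_sem[OF _ w]]) auto
qed

section \<open>The main loop: levels below every certificate\<close>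

definition certificate :: "(nat \<Rightarrow> nat) \<Rightarrow> bool" where
  "certificate y \<longleftrightarrow> (\<forall>b<n. y b < n) \<and>
     (\<exists>M. perfect_matching {..<n} {..<n} E M \<and> M \<subseteq> level_edges E pref y)"

lemma popular_certificate:
  "popular_assignment {..<n} {..<n} E pref M \<Longrightarrow> \<exists>y. certificate y"
  using popular_level_certificate[OF _ _ E_sub, of pref M] unfolding certificate_def
  by (auto simp: popular_assignment_def)

lemma blocked_raise:
  assumes M: "matching (level_edges E pref l) (assigned own)"
    and "blocked (level_edges E pref l) own" and b: "b < n" "own b = 0"
    and y: "certificate y" and l: "\<forall>b<n. l b \<le> y b"
  shows "l b < y b"
proof -
  obtain R where R: "R \<subseteq> {..<n}" "\<forall>b<n. own b = 0 \<longrightarrow> b \<in> R"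
    "\<forall>a c. (a, c) \<in> level_edges E pref l \<longrightarrow> c \<in> R \<longrightarrow> (\<exists>d\<in>R. (a, d) \<in> assigned own)"
    using assms(2) unfolding blocked_def by blast
  obtain N where N: "perfect_matching {..<n} {..<n} E N" "N \<subseteq> level_edges E pref y"
    using y unfolding certificate_def by blast
  have sub: "assigned own \<subseteq> level_edges E pref l" using M by (simp add: matching_def)
  also have "\<dots> \<subseteq> E" by (auto simp: level_edges_def)
  finally have ME: "matching E (assigned own)" using M by (simp add: matching_def)
  show ?thesis
  proof (rule level_less_certificate[OF E_sub N _ ME sub])
    show "finite R" using R(1) finite_subset by blast
    show "b \<notin> Range (assigned own)" using b(2) by (auto simp: assigned_def)
  qed (use l R b in auto)
qed

text \<open>The \<open>n\<close> objects have distinct owners among \<open>n\<close> agents, so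
  counting shows that every agent is matched.\<close>

lemma full_matching_perfect:
  assumes M: "matching (level_edges E pref l) (assigned own)" and full: "\<forall>b<n. own b \<noteq> 0"
  shows "perfect_matching {..<n} {..<n} E (assigned own)"
    "popular_assignment {..<n} {..<n} E pref (assigned own)"
proof -
  have sub: "assigned own \<subseteq> level_edges E pref l" using M by (simp add: matching_def)
  also have E: "\<dots> \<subseteq> E" by (auto simp: level_edges_def)
  finally have ME: "matching E (assigned own)" using M by (simp add: matching_def)
  have R: "Range (assigned own) = {..<n}"
  proof (intro subset_antisym subsetI)
    fix b assume "b \<in> {..<n}"
    then obtain a where "b < n" "own b = Suc a" using full not0_implies_Suc[of "own b"] by auto
    then show "b \<in> Range (assigned own)" by (auto simp: assigned_def)
  qed (auto simp: assigned_def)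
  have "inj_on snd (assigned own)" using ME unfolding inj_on_def matching_def by fastforce
  then have "card (assigned own) = n"
    using R card_image[of snd "assigned own"] by (simp add: Range_snd)
  moreover have "Domain (assigned own) \<subseteq> {..<n}" using sub E E_sub by blast
  ultimately have "Domain (assigned own) = {..<n}"
    using card_assigned[OF M] by (intro card_subset_eq) auto
  then show P: "perfect_matching {..<n} {..<n} E (assigned own)"
    using ME R by (simp add: perfect_matching_def)
  show "popular_assignment {..<n} {..<n} E pref (assigned own)"
    by (rule popular_if_level_edges[OF _ P sub]) simp
qed

text \<open>While undecided, nothing is claimed of the owner array, as each phase recomputes it. The
  weak bound by \<open>n\<close> covers the last raise of a negative run, which may reach
  \<open>n\<close>.\<close>

definition main_inv :: "state \<Rightarrow> bool" where
  "main_inv s \<longleftrightarrow> graph_arrays s \<and> regs s 2 = cap \<and> (\<forall>b<n. arrs s 7 b \<le> n) \<and>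
     (regs s 16 = 2 \<and> (\<nexists>y. certificate y) \<or>
      regs s 16 = 1 \<and> (\<forall>b<n. arrs s 10 b \<noteq> 0) \<and>
        (\<exists>l. matching (level_edges E pref l) (assigned (arrs s 10))) \<or>
      regs s 16 = 0 \<and> level_matrix {..<n} (arrs s 7) (arrs s 8) \<and>
        (\<forall>b<n. arrs s 7 b < n) \<and> (\<forall>y. certificate y \<longrightarrow> (\<forall>b<n. arrs s 7 b \<le> y b)))"

text \<open>The indicator pays for the phase that announces success without raising any
  level.\<close>

definition main_measure :: "state \<Rightarrow> nat" where
  "main_measure s = n * n - (\<Sum>b<n. arrs s 7 b) + (if regs s 16 = 0 then 1 else 0)"

lemma sum_raise:
  fixes f :: "nat \<Rightarrow> nat"
  assumes "b < n"
  shows "(\<Sum>c<n. (f(b := Suc (f b))) c) = Suc (\<Sum>c<n. f c)"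
proof -
  have "(\<Sum>c<n. (f(b := Suc (f b))) c) = (\<Sum>c<n. f c + of_bool (c = b))"
    by (intro sum.cong) auto
  also have "\<dots> = (\<Sum>c<n. f c) + 1" using assms by (simp add: sum.distrib of_bool_def)
  finally show ?thesis by simp
qed

lemma raise_spec:
  assumes inv: "main_inv s" and u: "regs s 16 = 0"
    and M: "matching (level_edges E pref (arrs s 7)) (assigned (arrs s 10))"
    and bl: "blocked (level_edges E pref (arrs s 7)) (arrs s 10)"
    and b: "regs s 4 \<le> n" "\<forall>b<regs s 4. arrs s 10 b \<noteq> 0" "regs s 4 < n \<longrightarrow> arrs s 10 (regs s 4) = 0"
  shows "runs W raise s (300 * (length es + n + 1)) (\<lambda>s'. main_inv s' \<and> main_measure s' < main_measure s)"
proof -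
  let ?b = "regs s 4" and ?l = "arrs s 7"
  let ?Q = "\<lambda>s'. main_inv s' \<and> main_measure s' < main_measure s"
  have n: "regs s 0 = n" and g: "graph_arrays s" and K: "regs s 2 = cap"
    using inv by (auto simp: main_inv_def graph_arrays_def)
  have lm: "level_matrix {..<n} ?l (arrs s 8)" and lt: "\<forall>b<n. ?l b < n"
    and cert: "\<And>y. certificate y \<Longrightarrow> \<forall>b<n. ?l b \<le> y b"
    using inv u unfolding main_inv_def by auto
  let ?l' = "?l(?b := Suc (?l ?b))"
  let ?s1 = "s\<lparr>arrs := (arrs s)(7 := ?l')\<rparr>"
  have g1: "graph_arrays ?s1" by (rule graph_arrays_frame[OF g, of "{}" "{7}"]) (auto simp: same_except_def)
  have above: "\<forall>c<n. ?l' c \<le> y c" if b: "?b < n" and y: "certificate y" for y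
    using blocked_raise[OF M bl b _ y cert[OF y]] assms(7) b cert[OF y] by auto
  have sum: "(\<Sum>c<n. ?l' c) = Suc (\<Sum>c<n. ?l c)" if "?b < n" using sum_raise[OF that] .
  have "(\<Sum>c<n. ?l c) \<le> n * n" using sum_bounded_above[of "{..<n}" ?l n] lt by (simp add: less_imp_le)
  moreover have "(\<Sum>c<n. ?l' c) \<le> n * n" if b: "?b < n"
    using sum_bounded_above[of "{..<n}" ?l' n] lt b by (simp add: less_imp_le Suc_le_eq)
  ultimately have dec: "n * n - (\<Sum>c<n. ?l' c) < n * n - (\<Sum>c<n. ?l c)" if "?b < n"
    using sum[OF that] that by fastforce
  have 1: "runs W (Cond (Less (Cell 7 (Reg 4)) (Reg 0)) refresh (Assign 16 (Num 2))) ?s1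
      (1 + bcost (Less (Cell 7 (Reg 4)) (Reg 0)) + 200 * (length es + n + 1)) ?Q" if b: "?b < n"
  proof (rule runs_cond)
    assume "bval W (Less (Cell 7 (Reg 4)) (Reg 0)) ?s1"
    then have less: "Suc (?l ?b) < n" by (simp add: n)
    have r: "runs W refresh ?s1 (200 * (length es + n + 1))
        (\<lambda>s'. level_matrix (insert ?b {..<n}) (arrs ?s1 7) (arrs s' 8))"
      by (rule refresh_spec[OF g1 _ b, where S = "{..<n}" and ?l0.0 = ?l])
        (use lm lt b less in \<open>auto simp: less_imp_le\<close>)
    show "runs W refresh ?s1 (200 * (length es + n + 1)) ?Q"
    proof (rule runs_mono[OF r])
      fix s' assume q: "level_matrix (insert ?b {..<n}) (arrs ?s1 7) (arrs s' 8)"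
        and f: "framed refresh ?s1 s'"
      have eq: "arrs s' 7 = ?l'" "regs s' 16 = 0" "regs s' 2 = cap"
        using f u K by (auto simp: same_except_def refresh_def refresh_body_def)
      have "graph_arrays s'"
        by (rule graph_arrays_frame[OF g1 f]) (auto simp: refresh_def refresh_body_def)
      moreover have "insert ?b {..<n} = {..<n}" using b by auto
      moreover have lt': "\<forall>c<n. ?l' c < n" using lt less by simp
      ultimately have "main_inv s'"
        using q above[OF b] unfolding main_inv_def eq by (auto simp: less_imp_le)
      then show "?Q s'" using dec[OF b] u by (simp add: main_measure_def eq)
    qed simp
  next
    assume "\<not> bval W (Less (Cell 7 (Reg 4)) (Reg 0)) ?s1"
    then have ge: "n \<le> Suc (?l ?b)" by (simp add: n)
    let ?s2 = "sem W (Assign 16 (Num 2)) ?s1"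
    \<comment> \<open>The raised level is at least \<open>n\<close> yet still below every
      certificate, whose levels are less than \<open>n\<close>.\<close>
    have no: "\<nexists>y. certificate y"
    proof
      assume "\<exists>y. certificate y"
      then obtain y where y: "certificate y" by blast
      then have "y ?b < n" using b by (simp add: certificate_def)
      moreover have "?l' ?b \<le> y ?b" using above[OF b y] b by blast
      ultimately show False using ge by simp
    qed
    have g2: "graph_arrays ?s2" by (rule graph_arrays_frame[OF g1, of "{16}" "{}"]) (auto simp: same_except_def)
    have "main_inv ?s2"
      using g2 K no lt b unfolding main_inv_def by (auto simp: word_const less_imp_le Suc_le_eq)
    moreover have "main_measure ?s2 < main_measure s"
      using dec[OF b] by (simp add: main_measure_def word_const u)
    ultimately show "runs W (Assign 16 (Num 2)) ?s1 (200 * (length es + n + 1)) ?Q"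
      by (intro runs_sem) auto
  qed
  have r: "runs W raise s (1 + bcost (Less (Reg 4) (Reg 0)) +
      (10 + (1 + bcost (Less (Cell 7 (Reg 4)) (Reg 0)) + 200 * (length es + n + 1)))) ?Q"
    unfolding raise_def
  proof (rule runs_cond)
    assume "bval W (Less (Reg 4) (Reg 0)) s"
    then have b: "?b < n" by (simp add: n)
    have "?l ?b < n" using lt b by blast
    then have "Suc (?l ?b) mod W = Suc (?l ?b)" by (intro word_small) simp
    then have "sem W (Store 7 (Reg 4) (Add (Cell 7 (Reg 4)) (Num 1))) s = ?s1"
      by (simp add: word_const)
    then show "runs W (Seq (Store 7 (Reg 4) (Add (Cell 7 (Reg 4)) (Num 1)))
       (Cond (Less (Cell 7 (Reg 4)) (Reg 0)) refresh (Assign 16 (Num 2)))) s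
       (10 + (1 + bcost (Less (Cell 7 (Reg 4)) (Reg 0)) + 200 * (length es + n + 1))) ?Q"
      using 1[OF b] by (intro runs_mono[OF runs_seq_sem[where
        T = "1 + bcost (Less (Cell 7 (Reg 4)) (Reg 0)) + 200 * (length es + n + 1)"]]) auto
  next
    assume "\<not> bval W (Less (Reg 4) (Reg 0)) s"
    then have "?b = n" using b(1) by (simp add: n)
    then have full: "\<forall>b<n. arrs s 10 b \<noteq> 0" using b(2) by simp
    let ?s2 = "sem W (Assign 16 (Num 1)) s"
    have g2: "graph_arrays ?s2" by (rule graph_arrays_frame[OF g, of "{16}" "{}"]) (auto simp: same_except_def)
    have "main_inv ?s2"
      using g2 K full M lt unfolding main_inv_def by (auto simp: word_const less_imp_le)
    moreover have "main_measure ?s2 < main_measure s" by (simp add: main_measure_def word_const u)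
    ultimately show "runs W (Assign 16 (Num 1)) s
       (10 + (1 + bcost (Less (Cell 7 (Reg 4)) (Reg 0)) + 200 * (length es + n + 1))) ?Q"
      by (intro runs_sem) auto
  qed
  show ?thesis by (rule runs_mono[OF r]) auto
qed

text \<open>This is the balance: repairing the matching takes no more than about \<open>cap\<close>
  searches, the order of the auction itself.\<close>

lemma cap_div: "n div cap \<le> cap"
proof -
  have "n div cap < cap" using cap_square by (simp add: less_mult_imp_div_less)
  then show ?thesis by simp
qed

lemma phase_spec:
  assumes inv: "main_inv s" and u: "regs s 16 = 0"
  shows "runs W phase s (2000 * (cap * (length es + n + 1)))
    (\<lambda>s'. main_inv s' \<and> main_measure s' < main_measure s)" (is "runs W phase s _ ?Q")
proof -
  let ?l = "arrs s 7" and ?X = "length es + n + 1"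
  let ?G = "level_edges E pref ?l"
  have g: "graph_arrays s" and K: "regs s 2 = cap" and lm: "level_matrix {..<n} ?l (arrs s 8)"
    using inv u unfolding main_inv_def by auto
  let ?R = "{3, 5, 6, 7, 8, 9, 11, 12, 13, 14, 15}" and ?A = "{9, 10, 11, 12, 13, 14, 15, 16}"
  have r: "runs W phase s (200 * (cap * length es + n + 1) + ((n div cap + 3) * (300 * ?X) +
      (30 * (n + 1) + 300 * ?X))) ?Q"
    unfolding phase_def
  proof (rule runs_seq[OF auction_spec[OF g K lm]], elim conjE)
    fix s1 assume M1: "matching ?G (assigned (arrs s1 10))"
      and near: "\<forall>N. matching ?G N \<longrightarrow> card N \<le> card (assigned (arrs s1 10)) + n div cap"
      and f: "framed auction s s1"
    have f1: "same_except ?R ?A s s1"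
      by (rule same_except_trans[OF f same_except_refl[of "{}" "{}"]])
        (auto simp: auction_def auction_body_def)
    have g1: "graph_arrays s1" by (rule graph_arrays_frame[OF g f1]) auto
    have lm1: "level_matrix {..<n} ?l (arrs s1 8)" using lm same_exceptD(2)[OF f1] by simp
    show "runs W (Seq improve (Seq find_free raise)) s1 ((n div cap + 3) * (300 * ?X) +
        (30 * (n + 1) + 300 * ?X)) ?Q"
    proof (rule runs_seq[OF improve_spec[OF g1 lm1 refl M1]], use near in blast, elim conjE)
      fix s2 assume M2: "matching ?G (assigned (arrs s2 10))" and bl: "blocked ?G (arrs s2 10)"
        and f: "framed improve s1 s2"
      have f2: "same_except ?R ?A s s2"
        by (rule same_except_trans[OF f1 f])
          (auto simp: improve_def search_def search_body_def augment_def augment_body_def)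
      have n2: "regs s2 0 = n" using same_exceptD(1)[OF f2, of 0] g by (simp add: graph_arrays_def)
      show "runs W (Seq find_free raise) s2 (30 * (n + 1) + 300 * ?X) ?Q"
      proof (rule runs_seq[OF find_free_spec[OF n2]], elim conjE)
        fix s3 assume b: "regs s3 4 \<le> n" "\<forall>b<regs s3 4. arrs s2 10 b \<noteq> 0"
            "regs s3 4 < n \<longrightarrow> arrs s2 10 (regs s3 4) = 0"
          and f: "framed find_free s2 s3"
        have eq: "arrs s3 = arrs s2" using f by (auto simp: same_except_def find_free_def)
        have f3: "same_except (insert 4 ?R) ?A s s3"
          by (rule same_except_trans[OF f2 f]) (auto simp: find_free_def)
        have g3: "graph_arrays s3" by (rule graph_arrays_frame[OF g f3]) auto
        have eq7: "arrs s3 7 = ?l" "arrs s3 8 = arrs s 8" "regs s3 16 = 0" "regs s3 2 = cap"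
          using same_exceptD[OF f3] u K by simp_all
        have inv3: "main_inv s3" using inv g3 u unfolding main_inv_def eq7 by auto
        have eq10: "arrs s3 10 = arrs s2 10" using eq by simp
        have "main_measure s3 = main_measure s" by (simp add: main_measure_def eq7 u)
        moreover have "runs W raise s3 (300 * ?X) (\<lambda>s'. main_inv s' \<and> main_measure s' < main_measure s3)"
          by (rule raise_spec[OF inv3 eq7(3)]) (use M2 bl b in \<open>simp_all only: eq7(1) eq10\<close>)
        ultimately show "runs W raise s3 (300 * ?X) ?Q" by simp
      qed
    qed
  qed
  have "200 * (cap * length es + n + 1) + ((n div cap + 3) * (300 * ?X) + (30 * (n + 1) + 300 * ?X))
      \<le> 2000 * (cap * ?X)"
  proof -
    \<comment> \<open>Naming the products leaves an inequality that is linear in them.\<close>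
    define X Y Z V where "X = ?X" and "Y = cap * X" and "Z = n div cap * X" and "V = cap * length es"
    have 1: "X \<le> Y" using cap_pos by (cases cap) (auto simp: Y_def)
    have 2: "n + 1 \<le> X" by (simp add: X_def)
    have 3: "V \<le> Y" unfolding X_def Y_def V_def by (intro mult_left_mono) auto
    have 4: "Z \<le> Y" unfolding Y_def Z_def using cap_div by (intro mult_right_mono) auto
    have eq: "(n div cap + 3) * (300 * X) = 300 * Z + 900 * X" by (simp add: Z_def algebra_simps)
    show ?thesis
      unfolding X_def[symmetric] Y_def[symmetric] V_def[symmetric] eq using 1 2 3 4 by simp
  qed
  then show ?thesis by (rule runs_mono[OF r]) auto
qed

lemma main_prog_spec:
  assumes s: "s = input_state n es pref"
  shows "runs W main_prog s
    (100 * (length es + 1) + (20 * (n + 2) + ((n + 2) * (200 * (length es + n + 1) + 8) +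
      ((n * n + 2) * (4 + 2000 * (cap * (length es + n + 1))) + ((n + 2) * 16 + 4)))))
    (correct_output n E pref)"
proof -
  let ?X = "length es + n + 1" and ?Q = "correct_output n E pref"
  have z: "regs s 16 = 0" "arrs s 7 b = 0" for b by (simp_all add: s input_state_def)
  let ?out = "Store 3 (Sub (Cell 10 (Reg 3)) (Num 1)) (Reg 3)"
  have 1: "runs W (Seq (for_loop 3 0 ?out) (Assign 0 (Sub (Num 2) (Reg 16)))) s5 ((n + 2) * 16 + 4) ?Q"
    if inv: "main_inv s5" and d: "regs s5 16 \<noteq> 0" for s5
  proof -
    have n5: "regs s5 0 = n" using inv by (simp add: main_inv_def graph_arrays_def)
    let ?own = "arrs s5 10"
    \<comment> \<open>With verdict 2 the owners need not be all nonzero; the copy loop still runs,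
      but nothing is claimed of array 3.\<close>
    define P where "P j s' \<longleftrightarrow> (regs s5 16 = 1 \<longrightarrow> (\<forall>i<j. arrs s' 3 (?own i - 1) = i))"
      for j and s' :: state
    have one: "(\<forall>b<n. ?own b \<noteq> 0) \<and> (\<exists>l. matching (level_edges E pref l) (assigned ?own))" if "regs s5 16 = 1"
      using inv that unfolding main_inv_def by auto
    \<comment> \<open>Distinct objects have distinct nonzero owner codes, so no store of the copy
      loop overwrites an earlier one.\<close>
    have inj: "i = j" if "regs s5 16 = 1" "i < n" "j < n" "?own i - 1 = ?own j - 1" for i j
    proof -
      have "?own i \<noteq> 0" "?own j \<noteq> 0" using one that by auto
      moreover from this have "?own i = ?own j" using that(4) by simp
      ultimately show ?thesis using one[OF that(1)] that(2,3) unfolding matching_assigned by blast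
    qed
    have "runs W (for_loop 3 0 ?out) s5 ((n + 2) * (ccost ?out + 8)) (P n)"
    proof (rule runs_for_loop)
      fix j s' assume j: "j < n" "regs s' 3 = j" "P j s'" and fr: "framed (for_loop 3 0 ?out) s5 s'"
      have "arrs s' 10 = ?own" using fr by (simp add: same_except_def)
      then have t: "arrs (sem W ?out s') 3 = (arrs s' 3)(?own j - 1 := j)"
        using j by (simp add: word_const)
      have "P (Suc j) (sem W ?out s')"
        unfolding P_def t
      proof (intro impI allI)
        fix i assume r1: "regs s5 16 = 1" and i: "i < Suc j"
        show "((arrs s' 3)(?own j - 1 := j)) (?own i - 1) = i"
        proof (cases "?own i - 1 = ?own j - 1")
          case True
          then have "i = j" using inj[OF r1 _ j(1) True] i j(1) by simp
          then show ?thesis by simp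
        next
          case False
          then have "i < j" using i less_Suc_eq by auto
          then show ?thesis using False j(3) r1 by (simp add: P_def)
        qed
      qed
      then show "runs W ?out s' (ccost ?out) (P (Suc j))" by (intro runs_sem) auto
    qed (use n5 n_less_W in \<open>auto simp: P_def\<close>)
    then have r: "runs W (for_loop 3 0 ?out) s5 ((n + 2) * 16) (P n)"
      by (rule runs_mono) auto
    show ?thesis
    proof (rule runs_seq[OF r])
      fix s6 assume P: "P n s6" and f: "framed (for_loop 3 0 ?out) s5 s6"
      have eq: "regs s6 16 = regs s5 16" using f by (simp add: same_except_def)
      let ?t = "sem W (Assign 0 (Sub (Num 2) (Reg 16))) s6"
      have "?Q ?t"
      proof (cases "regs s5 16 = 1")
        case True
        obtain l where M: "matching (level_edges E pref l) (assigned ?own)" and full: "\<forall>b<n. ?own b \<noteq> 0"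
          using one[OF True] by blast
        note pm = full_matching_perfect[OF M full]
        have out: "arrs ?t 3 (?own b - 1) = b" if "b < n" for b using P that True by (simp add: P_def)
        have "output_assignment n ?t = assigned ?own"
        proof (intro subset_antisym subsetI)
          fix e assume "e \<in> output_assignment n ?t"
          then obtain a where a: "a < n" "e = (a, arrs ?t 3 a)" by (auto simp: output_assignment_def)
          have "a \<in> Domain (assigned ?own)" using pm(1) a(1) by (simp add: perfect_matching_def)
          then obtain b where b: "b < n" "?own b = Suc a" by (auto simp: assigned_def)
          then have "arrs ?t 3 a = b" using out[OF b(1)] by simp
          then show "e \<in> assigned ?own" using a b by (simp add: assigned_def)
        next
          fix e assume "e \<in> assigned ?own"
          then obtain a b where ab: "e = (a, b)" "b < n" "?own b = Suc a" by (auto simp: assigned_def)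
          have "a \<in> Domain (assigned ?own)" using ab by (auto simp: assigned_def)
          then have "a < n" using pm(1) by (simp add: perfect_matching_def)
          moreover have "arrs ?t 3 a = b" using out[OF ab(2)] ab(3) by simp
          ultimately show "e \<in> output_assignment n ?t" using ab(1) by (auto simp: output_assignment_def)
        qed
        then show ?thesis using pm(2) True eq by (auto simp: correct_output_def word_const)
      next
        case False
        then have "regs s5 16 = 2" "\<nexists>y. certificate y" using inv d unfolding main_inv_def by auto
        then show ?thesis using popular_certificate eq by (auto simp: correct_output_def word_const)
      qed
      then show "runs W (Assign 0 (Sub (Num 2) (Reg 16))) s6 4 ?Q" by (intro runs_sem) auto
    qed
  qed
  have 2: "runs W (While (Equal (Reg 16) (Num 0)) phase) s4 ((n * n + 2) * (4 + 2000 * (cap * ?X)))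
      (\<lambda>s'. main_inv s' \<and> regs s' 16 \<noteq> 0)" if "main_inv s4" for s4
  proof (rule runs_mono[OF runs_while[where I = main_inv and \<mu> = main_measure and T = "2000 * (cap * ?X)"]])
    show "runs W phase s' (2000 * (cap * ?X)) (\<lambda>s''. main_inv s'' \<and> main_measure s'' < main_measure s')"
      if "main_inv s'" "bval W (Equal (Reg 16) (Num 0)) s'" for s'
      by (rule phase_spec) (use that in \<open>auto simp: word_const\<close>)
    have "main_measure s4 + 1 \<le> n * n + 2"
      by (auto simp: main_measure_def intro: le_SucI)
    then show "(main_measure s4 + 1) * (1 + bcost (Equal (Reg 16) (Num 0)) + 2000 * (cap * ?X))
        \<le> (n * n + 2) * (4 + 2000 * (cap * ?X))" by (intro mult_mono) auto
  qed (use that in \<open>auto simp: word_const\<close>)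
  have 3: "runs W (for_loop 4 0 refresh) s2 ((n + 2) * (200 * ?X + 8))
      (\<lambda>s'. level_matrix {..<n} (\<lambda>_. 0) (arrs s' 8))"
    if g: "graph_arrays s2" and l: "\<And>b. arrs s2 7 b = 0" for s2
  proof (rule runs_for_loop[where P = "\<lambda>j s'. level_matrix {..<j} (\<lambda>_. 0) (arrs s' 8)" and N = n])
    fix j s' assume j: "j < n" "regs s' 4 = j" and lm: "level_matrix {..<j} (\<lambda>_. 0) (arrs s' 8)"
      and f: "framed (for_loop 4 0 refresh) s2 s'"
    have g': "graph_arrays s'"
      by (rule graph_arrays_frame[OF g f]) (auto simp: refresh_def refresh_body_def)
    have l': "arrs s' 7 = (\<lambda>_. 0)" using f l by (auto simp: same_except_def refresh_def refresh_body_def)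
    have "runs W refresh s' (200 * ?X) (\<lambda>s''. level_matrix (insert j {..<j}) (arrs s' 7) (arrs s'' 8))"
      by (rule refresh_spec[OF g' j(2,1) lm]) (use j l' in auto)
    then show "runs W refresh s' (200 * ?X) (\<lambda>s''. level_matrix {..<Suc j} (\<lambda>_. 0) (arrs s'' 8))"
      by (simp add: l' lessThan_Suc)
  qed (use g n_less_W in \<open>auto simp: graph_arrays_def level_matrix_def refresh_def refresh_body_def\<close>)
  show ?thesis
    unfolding main_prog_def
  proof (rule runs_seq[OF build_spec[OF s]])
    fix s1 assume g1: "graph_arrays s1" and f1: "framed (for_loop 3 1 build_body) s s1"
    have z1: "regs s1 16 = 0" "arrs s1 7 b = 0" for b
      using f1 z by (auto simp: same_except_def build_body_def)
    show "runs W (Seq cap_prog (Seq (for_loop 4 0 refresh) (Seq (While (Equal (Reg 16) (Num 0)) phase)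
       (Seq (for_loop 3 0 ?out) (Assign 0 (Sub (Num 2) (Reg 16))))))) s1
       (20 * (n + 2) + ((n + 2) * (200 * ?X + 8) + ((n * n + 2) * (4 + 2000 * (cap * ?X)) + ((n + 2) * 16 + 4)))) ?Q"
    proof (rule runs_seq[OF cap_spec[OF g1]])
      fix s2 assume K: "regs s2 2 = cap" and f2: "framed cap_prog s1 s2"
      have g2: "graph_arrays s2" by (rule graph_arrays_frame[OF g1 f2]) (auto simp: cap_prog_def)
      have z2: "regs s2 16 = 0" "arrs s2 7 b = 0" for b
        using f2 z1 by (auto simp: same_except_def cap_prog_def)
      show "runs W (Seq (for_loop 4 0 refresh) (Seq (While (Equal (Reg 16) (Num 0)) phase)
         (Seq (for_loop 3 0 ?out) (Assign 0 (Sub (Num 2) (Reg 16)))))) s2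
         ((n + 2) * (200 * ?X + 8) + ((n * n + 2) * (4 + 2000 * (cap * ?X)) + ((n + 2) * 16 + 4))) ?Q"
      proof (rule runs_seq[OF 3[OF g2 z2(2)]])
        fix s3 assume lm: "level_matrix {..<n} (\<lambda>_. 0) (arrs s3 8)" and f3: "framed (for_loop 4 0 refresh) s2 s3"
        have g3: "graph_arrays s3"
          by (rule graph_arrays_frame[OF g2 f3]) (auto simp: refresh_def refresh_body_def)
        have z3: "regs s3 16 = 0" "arrs s3 7 = (\<lambda>_. 0)" "regs s3 2 = cap"
          using f3 z2 K by (auto simp: same_except_def refresh_def refresh_body_def)
        have inv: "main_inv s3" using g3 lm by (simp add: main_inv_def z3)
        show "runs W (Seq (While (Equal (Reg 16) (Num 0)) phase)
           (Seq (for_loop 3 0 ?out) (Assign 0 (Sub (Num 2) (Reg 16))))) s3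
           ((n * n + 2) * (4 + 2000 * (cap * ?X)) + ((n + 2) * 16 + 4)) ?Q"
          by (rule runs_seq[OF 2[OF inv] 1]) auto
      qed
    qed
  qed
qed

section \<open>From step counts to the exponent 5/2\<close>

lemma time_bound:
  assumes "n \<le> m"
  shows "100 * (m + 1) + (20 * (n + 2) + ((n + 2) * (200 * (m + n + 1) + 8) +
      ((n * n + 2) * (4 + 2000 * (cap * (m + n + 1))) + ((n + 2) * 16 + 4))))
    \<le> 30000 * (m + 1 + m * (n * n * cap))"
proof (cases "n = 0")
  case True
  then have "cap = 1" using cap_le_Suc cap_pos by simp
  then show ?thesis using True by simp
next
  case False
  let ?X = "m + n + 1"
  define Z where "Z = m * (n * n * cap)"
  have X: "?X \<le> 3 * m" using assms False by simp
  have c: "1 \<le> cap" using cap_pos by simp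
  have "1 * (1 * 1) \<le> n * (n * cap)" using c False by (intro mult_mono) auto
  then have "m * 1 \<le> m * (n * n * cap)" by (intro mult_left_mono) (auto simp: mult.assoc)
  then have m: "m \<le> Z" by (simp add: Z_def)
  have "1 * n \<le> (n * cap) * n" using c False by (intro mult_right_mono) auto
  then have "m * n \<le> m * ((n * cap) * n)" by (intro mult_left_mono) auto
  then have nm: "n * m \<le> Z" by (simp add: Z_def mult_ac)
  \<comment> \<open>For positive \<open>n\<close> the summand 2 goes into 3 * (n * n), the summand 4
    turns 2000 into 2004, and \<open>?X\<close> is at most 3 * m; 3 * 2004 * 3 = 18036.\<close>
  have "(n * n + 2) * (4 + 2000 * (cap * ?X)) \<le> (3 * (n * n)) * (2004 * (cap * (3 * m)))"
  proof (rule mult_mono)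
    have "1 * 1 \<le> n * n" using False by (intro mult_mono) auto
    then show "n * n + 2 \<le> 3 * (n * n)" by simp
    have "cap * ?X \<le> cap * (3 * m)" using X by (rule mult_left_mono) simp
    moreover have "1 * 1 \<le> cap * (3 * m)" using c X by (intro mult_mono) auto
    ultimately show "4 + 2000 * (cap * ?X) \<le> 2004 * (cap * (3 * m))" by simp
  qed auto
  then have 1: "(n * n + 2) * (4 + 2000 * (cap * ?X)) \<le> 18036 * Z" by (simp add: Z_def mult_ac)
  have "(n + 2) * (200 * ?X + 8) \<le> (3 * n) * (208 * (3 * m))"
    using X False by (intro mult_mono) auto
  also have "\<dots> = 1872 * (n * m)" by simp
  also have "\<dots> \<le> 1872 * Z" using nm by (rule mult_left_mono) simp
  finally have 2: "(n + 2) * (200 * ?X + 8) \<le> 1872 * Z" .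
  have "n \<le> Z" using m assms by (rule order_trans[rotated])
  then have 3: "20 * (n + 2) \<le> 60 * Z" "(n + 2) * 16 + 4 \<le> 52 * Z" using False by simp_all
  show ?thesis
    unfolding Z_def[symmetric] using add_mono[OF 3(1) add_mono[OF 2 add_mono[OF 1 3(2)]]] by simp
qed

text \<open>Minimality bounds \<open>cap - 1\<close> by sqrt n; the missing 1 is itself at most sqrt
  n.\<close>

lemma cap_le_sqrt: "0 < n \<Longrightarrow> real cap \<le> 2 * sqrt (real n)"
proof -
  assume "0 < n"
  have "real (cap - 1) \<le> sqrt (real n)"
    using cap_pred_square by (intro real_le_rsqrt) (simp add: power2_eq_square flip: of_nat_mult)
  moreover have "1 \<le> sqrt (real n)" using \<open>0 < n\<close> by simp
  moreover have "real (cap - 1) = real cap - 1" using cap_pos by simp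
  ultimately show ?thesis by linarith
qed

text \<open>The outer test costs 4 units, which turns the factor 30000 into 30004.\<close>

lemma popular_prog_spec:
  "runs W popular_prog (input_state n es pref) (30004 * (length es + 1 + length es * (n * n * cap)))
    (correct_output n E pref)"
proof -
  let ?s = "input_state n es pref" and ?T = "30000 * (length es + 1 + length es * (n * n * cap))"
  have reg: "regs ?s 0 = n" "regs ?s (Suc 0) = length es" by (simp_all add: input_state_def)
  have "runs W popular_prog ?s (1 + bcost (Less (Reg 1) (Reg 0)) + ?T) (correct_output n E pref)"
    unfolding popular_prog_def
  proof (rule runs_cond)
    assume "bval W (Less (Reg 1) (Reg 0)) ?s"
    then have less: "length es < n" by (simp add: reg)
    have "\<not> popular_assignment {..<n} {..<n} E pref M" for M
    proof
      assume "popular_assignment {..<n} {..<n} E pref M"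
      then have M: "M \<subseteq> E" "Domain M = {..<n}"
        by (auto simp: popular_assignment_def perfect_matching_def matching_def)
      have "n = card (fst ` M)" using M(2) by (simp flip: Domain_fst)
      also have "\<dots> \<le> card M" using M(1) finite_E finite_subset by (intro card_image_le) blast
      also have "\<dots> \<le> card E" using M(1) finite_E by (intro card_mono)
      also have "\<dots> = length es" using es distinct_card[of es] by simp
      finally show False using less by simp
    qed
    then show "runs W (Assign 0 (Num 0)) ?s ?T (correct_output n E pref)"
      by (intro runs_sem) (auto simp: correct_output_def word_const)
  next
    assume "\<not> bval W (Less (Reg 1) (Reg 0)) ?s"
    then have "n \<le> length es" by (simp add: reg)
    from time_bound[OF this] show "runs W main_prog ?s ?T (correct_output n E pref)"
      by (rule runs_mono[OF main_prog_spec[OF refl]])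
  qed
  then show ?thesis by (rule runs_mono) auto
qed

lemma real_time_bound:
  "real (30004 * (length es + 1 + length es * (n * n * cap)))
    \<le> 100000 * (1 + real (card E) * real n powr (5 / 2))"
proof (cases "n = 0")
  case True
  then have "E = {}" using E_sub by auto
  then show ?thesis using True es(2) by simp
next
  case False
  let ?m = "real (length es)" and ?p = "real n powr (5 / 2)"
  have m: "card E = length es" using es distinct_card[of es] by simp
  have "?p = real n powr (2 + 1 / 2)" by simp
  also have "\<dots> = real n powr 2 * real n powr (1 / 2)" by (rule powr_add)
  also have "\<dots> = real n * real n * sqrt (real n)"
    by (simp add: powr_half_sqrt power2_eq_square)
  finally have p: "?p = real n * real n * sqrt (real n)" .
  have "real n * real n * real cap \<le> real n * real n * (2 * sqrt (real n))"
    using cap_le_sqrt False by (intro mult_left_mono) auto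
  then have "?m * (real n * real n * real cap) \<le> ?m * (2 * ?p)"
    unfolding p by (intro mult_left_mono) auto
  moreover have "1 \<le> ?p" using False by (intro ge_one_powr_ge_zero) auto
  then have "?m * 1 \<le> ?m * ?p" by (intro mult_left_mono) auto
  \<comment> \<open>One copy of m * n^(5/2) covers m and two cover the phases; three times 30004
    stays below 100000.\<close>
  ultimately have "?m + 1 + ?m * (real n * real n * real cap) \<le> 1 + 3 * (?m * ?p)" by simp
  moreover have "0 \<le> ?m * ?p" by simp
  moreover have "30004 * x \<le> 100000 * (1 + y)" if "x \<le> 1 + 3 * y" "0 \<le> y" for x y :: real
  proof -
    have "30004 * x \<le> 30004 * (1 + 3 * y)" using that(1) by (rule mult_left_mono) simp
    also have "\<dots> \<le> 100000 * (1 + y)" using that(2) by (simp add: algebra_simps)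
    finally show ?thesis .
  qed
  ultimately have "30004 * (?m + 1 + ?m * (real n * real n * real cap)) \<le> 100000 * (1 + ?m * ?p)"
    by blast
  then show ?thesis by (simp add: m)
qed

end

theorem theorem1:
  "\<exists>(p :: com) (k :: nat) (C :: real).
     solves_popular_assignment p k (\<lambda>n m. C * (1 + real m * real n powr (5 / 2)))"
proof (intro exI)
  \<comment> \<open>Exponent 4 leaves room for all table indices and, at n = 0, for the constants of
    the program.\<close>
  show "solves_popular_assignment popular_prog 4
     (\<lambda>n m. 100000 * (1 + real m * real n powr (5 / 2)))"
    unfolding solves_popular_assignment_def
  proof (intro conjI allI impI)
    fix n :: nat and E :: "(nat \<times> nat) set" and pref :: "nat \<Rightarrow> nat \<Rightarrow> nat \<Rightarrow> bool"
      and es :: "(nat \<times> nat) list"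
    assume "assignment_instance {..<n} {..<n} E pref \<and> distinct es \<and> set es = E"
    then interpret popular_machine n E pref es "(n + 2) ^ 4"
      by unfold_locales auto
    obtain t s where "exec ((n + 2) ^ 4) popular_prog (input_state n es pref) t s"
      "t \<le> 30004 * (length es + 1 + length es * (n * n * cap))" "correct_output n E pref s"
      using popular_prog_spec by (auto simp: runs_def)
    then show "\<exists>t s. exec ((n + 2) ^ 4) popular_prog (input_state n es pref) t s \<and>
        real t \<le> 100000 * (1 + real (card E) * real n powr (5 / 2)) \<and> correct_output n E pref s"
      using real_time_bound by (meson of_nat_mono order_trans)
  qed simp
qed

end
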